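(* Let $d=3$, $\kappa\in\mathbb R^4$ with all $\kappa_i>-1$, and $\nu,\mu\in\mathbb N_0^3$ with $|\nu|=|\mu|=n$. Then $$\widehat c_{\nu,\mu}^{\,(13)}(\kappa)=(-1)^{\nu_2}\sum_{\ell=0}^{n-\nu_3}b_{\nu,\mu}(\ell)\,\widehat R_{\nu_2}(\lambda(\ell);\sigma)\,\widehat{\mathsf R}_{(\mu_3,\mu_2)}\big((\nu_3,\ell+\nu_3);\beta,n\big),$$ where $b_{\nu,\mu}(\ell)=(-1)^\ell\sqrt{w_R(\ell;\sigma)}\sqrt{w_{\mathsf R}((\nu_3,\ell+\nu_3);\beta,n)}$ with $$\sigma=(-n+\nu_3-1,\ n+\nu_3+|\kappa|-\kappa_3+2,\ \kappa_1+\kappa_4+2\nu_3+1,\ \kappa_3),$$ $$\beta=(\kappa_1,\ \kappa_1+\kappa_4+1,\ \kappa_1+\kappa_3+\kappa_4+2,\ |\kappa|+3).$$ Here $\widehat R$ is the orthonormal one-variable Racah polynomial with weight $w_R$, and $\widehat{\mathsf R}$ is the orthonormal two-variable Racah polynomial with weight $w_{\mathsf R}$.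
   Context: **Vectors.** $|y|$ is the sum of the entries of $y$; $\mathbf y_j=(y_1,\dots,y_j)$; $\mathbf y^j$ is the tail from the $j$-th to the last entry ($\boldsymbol\kappa^j=(\kappa_j,\dots,\kappa_{d+1})$, $\boldsymbol\nu^j=(\nu_j,\dots,\nu_d)$); empty parts have sum $0$. $(a)_k=a(a+1)\cdots(a+k-1)$. $(13)$ is a transposition. **Jacobi polynomials on the simplex** ($d=3$ here). $T^d=\{x\in\mathbb R^d:x_i\ge0,|x|\le1\}$, $W_\kappa(x)=x_1^{\kappa_1}\cdots x_d^{\kappa_d}(1-|x|)^{\kappa_{d+1}}$, $\langle f,g\rangle_{W_\kappa}=\frac{\Gamma(|\kappa|+d+1)}{\prod_{i=1}^{d+1}\Gamma(\kappa_i+1)}\int_{T^d}fgW_\kappa\,dx$. With $a_j=|\boldsymbol\kappa^{j+1}|+2|\boldsymbol\nu^{j+1}|+d-j$, $$P_\nu^\kappa(x)=\prod_{j=1}^d(1-|\mathbf x_{j-1}|)^{\nu_j}P_{\nu_j}^{(a_j,\kappa_j)}\Big(\frac{2x_j}{1-|\mathbf x_{j-1}|}-1\Big)$$ (classical Jacobi polynomials, $P_n^{(\alpha,\beta)}(1)=(\alpha+1)_n/n!$). For each $n$ these, $|\nu|=n$, form an orthogonal basis of the space of degree-$n$ orthogonal polynomials; $A_\nu(\kappa)=\langle P_\nu^\kappa,P_\nu^\kappa\rangle_{W_\kappa}$. **Connection coefficients.** For $\tau\in S_{d+1}$: $\tau y=(y_{\tau(1)},\dots,y_{\tau(d+1)})$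 for $y\in\mathbb R^{d+1}$, and $\tau x=(x_{\tau(1)},\dots,x_{\tau(d)})$ with $x_{d+1}:=1-|x|$ for $x\in T^d$. $c^\tau_{\nu,\mu}(\kappa)$ is defined by $P_\nu^{\tau\kappa}(\tau x)=\sum_{|\mu|=|\nu|}c^\tau_{\nu,\mu}(\kappa)P_\mu^\kappa(x)$, and $\widehat c^{\,\tau}_{\nu,\mu}(\kappa)=\sqrt{A_\mu(\kappa)/A_\nu(\tau\kappa)}\,c^\tau_{\nu,\mu}(\kappa)$. **One-variable Racah polynomials.** For $\sigma=(\alpha,\beta,\gamma,\delta)$ with $\alpha+1=-M$, $M\in\mathbb N_0$ (here $M=n-\nu_3$), $\lambda(x)=x(x+\gamma+\delta+1)$, and $0\le m,x\le M$, $$R_m(\lambda(x);\sigma)={}_4F_3\!\left(\begin{matrix}-m,\ m+\alpha+\beta+1,\ -x,\ x+\gamma+\delta+1\\ \alpha+1,\ \beta+\delta+1,\ \gamma+1\end{matrix};1\right),$$ $$w_R(x;\sigma)=\frac{(\gamma+\delta+1)_x((\gamma+\delta+3)/2)_x(\alpha+1)_x(\beta+\delta+1)_x(\gamma+1)_x}{x!\,((\gamma+\delta+1)/2)_x(\gamma+\delta-\alpha+1)_x(\gamma-\beta+1)_x(\delta+1)_x}.$$ These are orthogonal on $\{0,\dots,M\}$ with weight $w_R$; $\widehat R_m=R_m/(\sum_{x=0}^Mw_RR_m^2)^{1/2}$. **Racah polynomials of $p$ variables** (here $p=2$). Let $N\in\mathbb N_0$, $\beta=(\beta_0,\dots,\beta_{p+1})$,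 $V_N=\{x\in\mathbb N_0^p:0\le x_1\le\cdots\le x_p\le N\}$, $x_0=0$, $x_{p+1}=N$, $$w_{\mathsf R}(x;\beta,N)=\prod_{j=0}^p\frac{(\beta_{j+1}-\beta_j)_{x_{j+1}-x_j}(\beta_{j+1})_{x_{j+1}+x_j}}{(x_{j+1}-x_j)!\,(\beta_j+1)_{x_{j+1}+x_j}}\prod_{j=1}^p\frac{((\beta_j+2)/2)_{x_j}}{(\beta_j/2)_{x_j}}.$$ For $\nu\in\mathbb N_0^p$, $|\nu|\le N$, $$\mathsf R_\nu(x;\beta,N)=\prod_{j=1}^p(u_j)_{\nu_j}(v_j)_{\nu_j}(t_j)_{\nu_j}\;{}_4F_3\!\left(\begin{matrix}-\nu_j,\ \nu_j+2|\boldsymbol\nu_{j-1}|+\beta_{j+1}-\beta_0-1,\ |\boldsymbol\nu_{j-1}|-x_j,\ |\boldsymbol\nu_{j-1}|+\beta_j+x_j\\ u_j,\ v_j,\ t_j\end{matrix};1\right),$$ $u_j=2|\boldsymbol\nu_{j-1}|+\beta_j-\beta_0$, $v_j=|\boldsymbol\nu_{j-1}|+\beta_{j+1}+x_{j+1}$, $t_j=|\boldsymbol\nu_{j-1}|-x_{j+1}$, where $(u)_m(v)_m(t)_m\,{}_4F_3(-m,a,b,c;u,v,t;1)$ means $\sum_{k=0}^m\frac{(-m)_k(a)_k(b)_k(c)_k}{k!}(u+k)_{m-k}(v+k)_{m-k}(t+k)_{m-k}$. These are mutually orthogonal on $V_N$ with weight $w_{\mathsf R}$; $\widehat{\mathsf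 R}_\nu=\mathsf R_\nu/r_\nu$, $r_\nu^2=\sum_{y\in V_N}w_{\mathsf R}(y;\beta,N)\mathsf R_\nu(y;\beta,N)^2$. The products $\sqrt{w_R}\,\widehat R$ and $\sqrt{w_{\mathsf R}}\,\widehat{\mathsf R}$ occurring in the sum are read as $R\cdot\sqrt{w_R/\sum w_RR^2}$ and $\mathsf R\cdot\sqrt{w_{\mathsf R}/r^2}$ (positive roots), extended by continuity in the parameters at removable singularities. *)

theory Defs
  imports "HOL-Analysis.Analysis"
begin

text \<open>
  A vector of length \<open>m\<close> is a function on \<open>nat\<close> of which only the entries with index in
  \<open>{1..m}\<close> matter (\<open>{0..p + 1}\<close> for the parameters of the multivariable Racah polynomials).
  Where vectors form a set that is summed or integrated over, they are taken in
  \<open>{1..m} \<rightarrow>\<^sub>E UNIV\<close>, so that every vector has exactly one representative.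
\<close>

definition list_vec :: "'a list \<Rightarrow> nat \<Rightarrow> 'a" where
  "list_vec xs i = xs ! (i - 1)"

definition multi_indices :: "nat \<Rightarrow> nat \<Rightarrow> (nat \<Rightarrow> nat) set" where
  "multi_indices d n = {\<nu> \<in> {1..d} \<rightarrow>\<^sub>E UNIV. (\<Sum>i=1..d. \<nu> i) = n}"


section \<open>Jacobi polynomials on the simplex\<close>

definition simplex_dom :: "nat \<Rightarrow> (nat \<Rightarrow> real) set" where
  "simplex_dom d = {x \<in> {1..d} \<rightarrow>\<^sub>E UNIV. (\<forall>i\<in>{1..d}. 0 \<le> x i) \<and> (\<Sum>i=1..d. x i) \<le> 1}"

text \<open>\<open>0 powr 0 = 0\<close> and the values of negative powers at \<open>0\<close> only concern the boundary of the
  simplex, a null set.\<close>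

definition simplex_weight :: "nat \<Rightarrow> (nat \<Rightarrow> real) \<Rightarrow> (nat \<Rightarrow> real) \<Rightarrow> real" where
  "simplex_weight d \<kappa> x =
     (\<Prod>i=1..d. x i powr \<kappa> i) * (1 - (\<Sum>i=1..d. x i)) powr \<kappa> (d + 1)"

definition simplex_inner ::
  "nat \<Rightarrow> (nat \<Rightarrow> real) \<Rightarrow> ((nat \<Rightarrow> real) \<Rightarrow> real) \<Rightarrow> ((nat \<Rightarrow> real) \<Rightarrow> real) \<Rightarrow> real" where
  "simplex_inner d \<kappa> f g =
     Gamma ((\<Sum>i=1..d+1. \<kappa> i) + real d + 1) / (\<Prod>i=1..d+1. Gamma (\<kappa> i + 1)) *
     (LINT x:simplex_dom d|(\<Pi>\<^sub>M i\<in>{1..d}. lborel). f x * g x * simplex_weight d \<kappa> x)"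

text \<open>The classical Jacobi polynomial
  \<open>(\<alpha> + 1)\<^sub>n / n! \<cdot> \<^sub>2F\<^sub>1(-n, n + \<alpha> + \<beta> + 1; \<alpha> + 1; (1 - t) / 2)\<close>, for \<open>\<alpha> > -1\<close>.\<close>

definition jacobi_poly :: "nat \<Rightarrow> real \<Rightarrow> real \<Rightarrow> real \<Rightarrow> real" where
  "jacobi_poly n \<alpha> \<beta> t = pochhammer (\<alpha> + 1) n / fact n *
     (\<Sum>k\<le>n. pochhammer (- real n) k * pochhammer (real n + \<alpha> + \<beta> + 1) k /
              (pochhammer (\<alpha> + 1) k * fact k) * ((1 - t) / 2) ^ k)"

text \<open>At a point of the simplex with \<open>x\<^sub>1 + \<dots> + x\<^bsub>j-1\<^esub> = 1\<close> the \<open>j\<close>-th factor of the polynomial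
  is \<open>1\<close> if \<open>\<nu>\<^sub>j = 0\<close> and \<open>0\<close> otherwise, because \<open>x\<^sub>j = 0\<close> there; this is also what the formula
  below gives, whatever the value of the quotient.\<close>

definition simplex_jacobi :: "nat \<Rightarrow> (nat \<Rightarrow> real) \<Rightarrow> (nat \<Rightarrow> nat) \<Rightarrow> (nat \<Rightarrow> real) \<Rightarrow> real" where
  "simplex_jacobi d \<kappa> \<nu> x =
     (\<Prod>j=1..d.
        (1 - (\<Sum>i=1..<j. x i)) ^ \<nu> j *
        jacobi_poly (\<nu> j)
          ((\<Sum>i=j+1..d+1. \<kappa> i) + 2 * real (\<Sum>i=j+1..d. \<nu> i) + (real d - real j)) (\<kappa> j)
          (2 * x j / (1 - (\<Sum>i=1..<j. x i)) - 1))"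

definition simplex_jacobi_norm2 :: "nat \<Rightarrow> (nat \<Rightarrow> real) \<Rightarrow> (nat \<Rightarrow> nat) \<Rightarrow> real" where
  "simplex_jacobi_norm2 d \<kappa> \<nu> = simplex_inner d \<kappa> (simplex_jacobi d \<kappa> \<nu>) (simplex_jacobi d \<kappa> \<nu>)"


section \<open>Connection coefficients\<close>

definition simplex_perm :: "nat \<Rightarrow> (nat \<Rightarrow> nat) \<Rightarrow> (nat \<Rightarrow> real) \<Rightarrow> (nat \<Rightarrow> real)" where
  "simplex_perm d \<tau> x = (\<lambda>i\<in>{1..d}. (x(d + 1 := 1 - (\<Sum>k=1..d. x k))) (\<tau> i))"

definition conn_coeff ::
  "nat \<Rightarrow> (nat \<Rightarrow> nat) \<Rightarrow> (nat \<Rightarrow> real) \<Rightarrow> (nat \<Rightarrow> nat) \<Rightarrow> (nat \<Rightarrow> nat) \<Rightarrow> real" where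
  "conn_coeff d \<tau> \<kappa> \<nu> =
     (THE c. (\<forall>\<mu>. \<mu> \<notin> multi_indices d (\<Sum>i=1..d. \<nu> i) \<longrightarrow> c \<mu> = 0) \<and>
             (\<forall>x\<in>simplex_dom d.
                simplex_jacobi d (\<kappa> \<circ> \<tau>) \<nu> (simplex_perm d \<tau> x) =
                (\<Sum>\<mu>\<in>multi_indices d (\<Sum>i=1..d. \<nu> i). c \<mu> * simplex_jacobi d \<kappa> \<mu> x)))"

definition conn_coeff_hat ::
  "nat \<Rightarrow> (nat \<Rightarrow> nat) \<Rightarrow> (nat \<Rightarrow> real) \<Rightarrow> (nat \<Rightarrow> nat) \<Rightarrow> (nat \<Rightarrow> nat) \<Rightarrow> real" where
  "conn_coeff_hat d \<tau> \<kappa> \<nu> \<mu> =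
     sqrt (simplex_jacobi_norm2 d \<kappa> \<mu> / simplex_jacobi_norm2 d (\<kappa> \<circ> \<tau>) \<nu>) *
     conn_coeff d \<tau> \<kappa> \<nu> \<mu>"


section \<open>Continuous extension in the parameters\<close>

definition cont_ext ::
  "'a::topological_space set \<Rightarrow> ('a \<Rightarrow> 'b::t2_space) \<Rightarrow> 'a \<Rightarrow> 'b" where
  "cont_ext D f p = (if p \<in> D then f p else Lim (at p within D) f)"


section \<open>Racah polynomials of one variable\<close>

text \<open>Throughout, \<open>(\<alpha>, \<beta>, \<gamma>, \<delta>)\<close> are the parameters, with \<open>\<alpha> + 1 = -M\<close>.\<close>

definition hyp_4F3 :: "nat \<Rightarrow> real \<Rightarrow> real \<Rightarrow> real \<Rightarrow> real \<Rightarrow> real \<Rightarrow> real \<Rightarrow> real" where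
  "hyp_4F3 m a b c u v t =
     (\<Sum>k\<le>m. pochhammer (- real m) k * pochhammer a k * pochhammer b k * pochhammer c k /
              (pochhammer u k * pochhammer v k * pochhammer t k * fact k))"

definition racah1_poly :: "nat \<Rightarrow> nat \<Rightarrow> real \<times> real \<times> real \<times> real \<Rightarrow> real" where
  "racah1_poly m x = (\<lambda>(\<alpha>, \<beta>, \<gamma>, \<delta>).
     hyp_4F3 m (real m + \<alpha> + \<beta> + 1) (- real x) (real x + \<gamma> + \<delta> + 1)
       (\<alpha> + 1) (\<beta> + \<delta> + 1) (\<gamma> + 1))"

definition racah1_weight_num :: "nat \<Rightarrow> real \<times> real \<times> real \<times> real \<Rightarrow> real" where
  "racah1_weight_num x = (\<lambda>(\<alpha>, \<beta>, \<gamma>, \<delta>).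
     pochhammer (\<gamma> + \<delta> + 1) x * pochhammer ((\<gamma> + \<delta> + 3) / 2) x * pochhammer (\<alpha> + 1) x *
     pochhammer (\<beta> + \<delta> + 1) x * pochhammer (\<gamma> + 1) x)"

definition racah1_weight_den :: "nat \<Rightarrow> real \<times> real \<times> real \<times> real \<Rightarrow> real" where
  "racah1_weight_den x = (\<lambda>(\<alpha>, \<beta>, \<gamma>, \<delta>).
     fact x * pochhammer ((\<gamma> + \<delta> + 1) / 2) x * pochhammer (\<gamma> + \<delta> - \<alpha> + 1) x *
     pochhammer (\<gamma> - \<beta> + 1) x * pochhammer (\<delta> + 1) x)"

definition racah1_weight :: "nat \<Rightarrow> real \<times> real \<times> real \<times> real \<Rightarrow> real" where
  "racah1_weight x \<sigma> = racah1_weight_num x \<sigma> / racah1_weight_den x \<sigma>"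

definition racah1_norm2 :: "nat \<Rightarrow> nat \<Rightarrow> real \<times> real \<times> real \<times> real \<Rightarrow> real" where
  "racah1_norm2 M m \<sigma> = (\<Sum>x=0..M. racah1_weight x \<sigma> * (racah1_poly m x \<sigma>)\<^sup>2)"

text \<open>The parameters for which no denominator in the formulas vanishes.\<close>

definition racah1_regular :: "nat \<Rightarrow> nat \<Rightarrow> (real \<times> real \<times> real \<times> real) set" where
  "racah1_regular M m = {(\<alpha>, \<beta>, \<gamma>, \<delta>). \<alpha> + 1 = - real M \<and>
     (\<forall>k\<le>m. pochhammer (\<alpha> + 1) k * pochhammer (\<beta> + \<delta> + 1) k * pochhammer (\<gamma> + 1) k \<noteq> 0) \<and>
     (\<forall>x\<le>M. racah1_weight_den x (\<alpha>, \<beta>, \<gamma>, \<delta>) \<noteq> 0) \<and>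
     racah1_norm2 M m (\<alpha>, \<beta>, \<gamma>, \<delta>) \<noteq> 0}"

text \<open>The product of the square root of the weight and the orthonormal polynomial, as a function
  of the parameters. Its limits are taken with \<open>\<alpha>\<close> fixed, since \<open>racah1_regular M m\<close> lies in the
  hyperplane \<open>\<alpha> + 1 = -M\<close>.\<close>

definition racah1_fun :: "nat \<Rightarrow> nat \<Rightarrow> nat \<Rightarrow> real \<times> real \<times> real \<times> real \<Rightarrow> real" where
  "racah1_fun M m x = cont_ext (racah1_regular M m)
     (\<lambda>\<sigma>. racah1_poly m x \<sigma> * sqrt (racah1_weight x \<sigma> / racah1_norm2 M m \<sigma>))"


section \<open>Racah polynomials of several variables\<close>

text \<open>Adjoins \<open>x\<^sub>0 = 0\<close> and \<open>x\<^bsub>p+1\<^esub> = N\<close>.\<close>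

definition racah_pad :: "nat \<Rightarrow> nat \<Rightarrow> (nat \<Rightarrow> nat) \<Rightarrow> nat \<Rightarrow> nat" where
  "racah_pad p N x = x(0 := 0, p + 1 := N)"

definition racah_dom :: "nat \<Rightarrow> nat \<Rightarrow> (nat \<Rightarrow> nat) set" where
  "racah_dom p N =
     {x \<in> {1..p} \<rightarrow>\<^sub>E UNIV. \<forall>j\<in>{0..p}. racah_pad p N x j \<le> racah_pad p N x (j + 1)}"

definition racah_weight_num :: "nat \<Rightarrow> nat \<Rightarrow> (nat \<Rightarrow> nat) \<Rightarrow> (nat \<Rightarrow> real) \<Rightarrow> real" where
  "racah_weight_num p N x \<beta> = (let y = racah_pad p N x in
     (\<Prod>j=0..p. pochhammer (\<beta> (j + 1) - \<beta> j) (y (j + 1) - y j) *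
                 pochhammer (\<beta> (j + 1)) (y (j + 1) + y j)) *
     (\<Prod>j=1..p. pochhammer ((\<beta> j + 2) / 2) (y j)))"

definition racah_weight_den :: "nat \<Rightarrow> nat \<Rightarrow> (nat \<Rightarrow> nat) \<Rightarrow> (nat \<Rightarrow> real) \<Rightarrow> real" where
  "racah_weight_den p N x \<beta> = (let y = racah_pad p N x in
     (\<Prod>j=0..p. fact (y (j + 1) - y j) * pochhammer (\<beta> j + 1) (y (j + 1) + y j)) *
     (\<Prod>j=1..p. pochhammer (\<beta> j / 2) (y j)))"

definition racah_weight :: "nat \<Rightarrow> nat \<Rightarrow> (nat \<Rightarrow> nat) \<Rightarrow> (nat \<Rightarrow> real) \<Rightarrow> real" where
  "racah_weight p N x \<beta> = racah_weight_num p N x \<beta> / racah_weight_den p N x \<beta>"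

text \<open>\<open>(u)\<^sub>m (v)\<^sub>m (t)\<^sub>m \<^sub>4F\<^sub>3(-m, a, b, c; u, v, t; 1)\<close>, with the denominators cancelled.\<close>

definition hyp_4F3_reg :: "nat \<Rightarrow> real \<Rightarrow> real \<Rightarrow> real \<Rightarrow> real \<Rightarrow> real \<Rightarrow> real \<Rightarrow> real" where
  "hyp_4F3_reg m a b c u v t =
     (\<Sum>k\<le>m. pochhammer (- real m) k * pochhammer a k * pochhammer b k * pochhammer c k / fact k *
              pochhammer (u + real k) (m - k) * pochhammer (v + real k) (m - k) *
              pochhammer (t + real k) (m - k))"

definition racah_poly ::
  "nat \<Rightarrow> nat \<Rightarrow> (nat \<Rightarrow> nat) \<Rightarrow> (nat \<Rightarrow> nat) \<Rightarrow> (nat \<Rightarrow> real) \<Rightarrow> real" where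
  "racah_poly p N \<nu> x \<beta> = (\<Prod>j=1..p.
     let s = real (\<Sum>i=1..<j. \<nu> i);
         y = (\<lambda>i. real (racah_pad p N x i))
     in hyp_4F3_reg (\<nu> j)
          (real (\<nu> j) + 2 * s + \<beta> (j + 1) - \<beta> 0 - 1) (s - y j) (s + \<beta> j + y j)
          (2 * s + \<beta> j - \<beta> 0) (s + \<beta> (j + 1) + y (j + 1)) (s - y (j + 1)))"

definition racah_norm2 :: "nat \<Rightarrow> nat \<Rightarrow> (nat \<Rightarrow> nat) \<Rightarrow> (nat \<Rightarrow> real) \<Rightarrow> real" where
  "racah_norm2 p N \<nu> \<beta> =
     (\<Sum>y\<in>racah_dom p N. racah_weight p N y \<beta> * (racah_poly p N \<nu> y \<beta>)\<^sup>2)"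

definition racah_regular :: "nat \<Rightarrow> nat \<Rightarrow> (nat \<Rightarrow> nat) \<Rightarrow> (nat \<Rightarrow> real) set" where
  "racah_regular p N \<nu> =
     {\<beta>. (\<forall>x\<in>racah_dom p N. racah_weight_den p N x \<beta> \<noteq> 0) \<and> racah_norm2 p N \<nu> \<beta> \<noteq> 0}"

text \<open>The product of the square root of the weight and the orthonormal polynomial, as a function
  of the parameters \<open>\<beta>\<close> (with the product topology). All weights may be negative, in which case
  the quotient is still positive. They may also all vanish (if \<open>\<beta>\<^bsub>p+1\<^esub> = 0 < N\<close>), in which case
  the norm vanishes too and the singularity of the quotient is removable.\<close>

definition racah_fun ::
  "nat \<Rightarrow> nat \<Rightarrow> (nat \<Rightarrow> nat) \<Rightarrow> (nat \<Rightarrow> nat) \<Rightarrow> (nat \<Rightarrow> real) \<Rightarrow> real" where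
  "racah_fun p N \<nu> x = cont_ext (racah_regular p N \<nu>)
     (\<lambda>\<beta>. racah_poly p N \<nu> x \<beta> * sqrt (racah_weight p N x \<beta> / racah_norm2 p N \<nu> \<beta>))"

end

theory Submission
  imports Defs "HOL-Computational_Algebra.Formal_Power_Series"
begin

text \<open>Set \<open>x\<^sub>4 = 1 - |x|\<close>. Homogenized, the simplex polynomial is a product of three Jacobi polynomials
  along the binary tree \<open>((4 3) 2) 1\<close>: one in the pair \<open>(x\<^sub>4, x\<^sub>3)\<close>, one in \<open>(x\<^sub>3 + x\<^sub>4, x\<^sub>2)\<close> and
  one in \<open>(x\<^sub>2 + x\<^sub>3 + x\<^sub>4, x\<^sub>1)\<close>, where the exponent of a sum of variables absorbs the degrees used
  inside it. The transposition \<open>(13)\<close> replaces this tree by \<open>((4 1) 2) 3\<close>, and three exchanges of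
  neighbouring branches lead back:
  \<open>((4 1) 2) 3 \<rightarrow> ((4 1) 3) 2 \<rightarrow> ((4 3) 1) 2 \<rightarrow> ((4 3) 2) 1\<close>.
  Every exchange is an instance of one identity in three variables (\<open>hjac_tree_swap\<close>), whose
  coefficients are explicit factors times a \<open>\<^sub>4F\<^sub>3\<close>. The first exchange keeps the total degree
  \<open>n - \<nu>\<^sub>3\<close> of the two branches it involves and introduces the summation index \<open>l\<close>, with a
  one-variable Racah polynomial. The other two introduce \<open>\<mu>\<^sub>3\<close> and \<open>\<mu>\<^sub>2\<close>, so nothing is left to be
  summed; their product is a two-variable Racah polynomial.

  The three-variable identity holds because both sides are homogeneous and annihilated by
  \<open>x \<partial>\<^sub>x\<^sup>2 + (a + 1) \<partial>\<^sub>x + y \<partial>\<^sub>y\<^sup>2 + (b + 1) \<partial>\<^sub>y + z \<partial>\<^sub>z\<^sup>2 + (c + 1) \<partial>\<^sub>z\<close>, and such polynomials are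
  determined by their restriction to \<open>z = 0\<close>. There the identity becomes an expansion in one
  variable (\<open>hjac_face_expansion\<close>), which rests on an inverse pair of triangular matrices.

  The normalization needs no summation formula for Racah polynomials. A coefficient of the
  exchange times the squared norm of its target is visibly symmetric (\<open>swap_coeff_symmetric\<close>), and the
  exchanges in the two directions are inverse to each other, so that the normalized coefficients
  form an orthogonal matrix (\<open>swap_coeff_orthonormal\<close>). The Racah weights are, up to a common factor,
  the squares of the elementary factors of the coefficients divided by the squared norms of
  the source polynomials. Orthogonality is therefore exactly the statement that fixes the norm of the Racah
  polynomial, and polynomial times normalized root of the weight is the normalized coefficient up to
  sign (\<open>normalized_weight\<close>). The norms of the simplex polynomials come from iterated Beta integrals.

  For some parameters the Racah weights have removable singularities, caused by the factors
  \<open>(s)\<^bsub>y+z\<^esub> (s/2 + 1)\<^sub>y / (s/2)\<^sub>y\<close> at \<open>s = 0\<close>, and in two variables by a factor common to all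
  weights. Both are removed by formulas that are continuous there, and the extension by continuity
  takes the value of these formulas (\<open>cont_ext_eq\<close>).\<close>

section \<open>Pochhammer symbols and the Chu--Vandermonde sum\<close>

lemma pochhammer_neg_of_nat:
  assumes "k \<le> n"
  shows "pochhammer (- real n) k = (-1) ^ k * fact n / fact (n - k)"
proof -
  have "(fact n :: real) = fact (n - k) * pochhammer (1 + real (n - k)) k"
    using pochhammer_product[of "n - k" n "1 :: real"] assms by (simp add: pochhammer_fact)
  then have "pochhammer (1 + real (n - k)) k = fact n / (fact (n - k) :: real)"
    by (simp add: field_simps)
  then show ?thesis
    using assms by (simp add: pochhammer_minus of_nat_diff algebra_simps)
qed

text \<open>The powers of \<open>u + v\<close> in the hypergeometric form of a Jacobi polynomial are expanded by the binomial
  theorem; this turns the inner sum into a Chu--Vandermonde sum with \<open>i\<close> in place of \<open>n\<close>.\<close>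

lemma pochhammer_neg_of_nat_times_binomial:
  assumes "k \<le> i" "i \<le> n"
  shows "pochhammer (- real n) k * real ((n - k) choose (i - k)) =
         real (n choose i) * pochhammer (- real i) k"
  using assms
  by (simp add: pochhammer_neg_of_nat binomial_fact field_simps)

lemma chu_vandermonde:
  fixes x c :: real
  assumes "pochhammer c n \<noteq> 0"
  shows "(\<Sum>k\<le>n. pochhammer (- real n) k * pochhammer x k / (pochhammer c k * fact k)) =
         pochhammer (c - x) n / pochhammer c n"
proof -
  have "\<forall>i\<in>{0..<n}. c \<noteq> - real i"
    using assms by (auto simp: pochhammer_eq_0_iff)
  from Vandermonde_pochhammer[OF this, of x] show ?thesis
    by (simp add: atMost_atLeast0 mult.commute)
qed

section \<open>Homogeneous Jacobi polynomials\<close>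

text \<open>These are the coefficients of the symmetric expansion
  \<open>P\<^sub>n\<^bsup>(a,b)\<^esup>(t) = (\<Sum>i\<le>n. (-1)\<^sup>i (n+a choose n-i) (n+b choose i) ((1-t)/2)\<^sup>i ((1+t)/2)\<^bsup>n-i\<^esup>)\<close>.
  Unlike the hypergeometric form it treats both variables alike, and two neighbouring coefficients
  satisfy the recurrence that makes the polynomial harmonic.\<close>

definition jac_coeff :: "nat \<Rightarrow> real \<Rightarrow> real \<Rightarrow> nat \<Rightarrow> real" where
  "jac_coeff n a b i = (-1) ^ i * pochhammer (a + 1 + real i) (n - i) *
     pochhammer (b + 1 + real (n - i)) i / (fact i * fact (n - i))"

definition hjac :: "nat \<Rightarrow> real \<Rightarrow> real \<Rightarrow> real \<Rightarrow> real \<Rightarrow> real" where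
  "hjac n a b u v = (\<Sum>i\<le>n. jac_coeff n a b i * u ^ i * v ^ (n - i))"

lemma pochhammer_neq_0_if_pos:
  fixes x :: real
  assumes "x > 0 \<or> n = 0"
  shows "pochhammer x n \<noteq> 0"
  using assms pochhammer_pos[of x n] by auto

lemma sum_pow_times_power_sum:
  fixes c :: "nat \<Rightarrow> real"
  shows "(\<Sum>k\<le>n. c k * u ^ k * (u + v) ^ (n - k)) =
    (\<Sum>i\<le>n. (\<Sum>k\<le>i. c k * real ((n - k) choose (i - k))) * u ^ i * v ^ (n - i))"
proof -
  have e: "u ^ k * (u + v) ^ (n - k) =
      (\<Sum>i\<le>n. if k \<le> i then real ((n - k) choose (i - k)) * u ^ i * v ^ (n - i) else 0)"
    if "k \<le> n" for k
  proof -
    have "(\<Sum>i\<le>n. if k \<le> i then real ((n - k) choose (i - k)) * u ^ i * v ^ (n - i) else 0) =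
      (\<Sum>i\<in>{k..n}. real ((n - k) choose (i - k)) * u ^ i * v ^ (n - i))"
      by (intro sum.mono_neutral_cong_right) auto
    also have "\<dots> = (\<Sum>j\<le>n - k. real ((n - k) choose j) * u ^ (k + j) * v ^ (n - k - j))"
      by (rule sum.reindex_bij_witness[of _ "\<lambda>j. j + k" "\<lambda>i. i - k"]) (use that in auto)
    also have "\<dots> = u ^ k * (u + v) ^ (n - k)"
      by (simp add: binomial_ring sum_distrib_left power_add mult_ac)
    finally show ?thesis by simp
  qed
  have "(\<Sum>k\<le>n. c k * u ^ k * (u + v) ^ (n - k)) = (\<Sum>k\<le>n. \<Sum>i\<le>n.
      if k \<le> i then c k * real ((n - k) choose (i - k)) * u ^ i * v ^ (n - i) else 0)"
    by (intro sum.cong refl) (simp add: mult.assoc e sum_distrib_left if_distrib cong: if_cong)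
  also have "\<dots> = (\<Sum>i\<le>n. \<Sum>k\<le>n.
      if k \<le> i then c k * real ((n - k) choose (i - k)) * u ^ i * v ^ (n - i) else 0)"
    by (rule sum.swap)
  also have "\<dots> = (\<Sum>i\<le>n. \<Sum>k\<le>i. c k * real ((n - k) choose (i - k)) * u ^ i * v ^ (n - i))"
    by (intro sum.cong refl sum.mono_neutral_cong_right) auto
  finally show ?thesis by (simp add: sum_distrib_right)
qed

lemma hjac_eq_hypergeometric:
  assumes "a > -1"
  shows "hjac n a b u v = pochhammer (a + 1) n / fact n *
    (\<Sum>k\<le>n. pochhammer (- real n) k * pochhammer (real n + a + b + 1) k /
       (pochhammer (a + 1) k * fact k) * u ^ k * (u + v) ^ (n - k))"
proof -
  define c where "c k = pochhammer (- real n) k * pochhammer (real n + a + b + 1) k /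
       (pochhammer (a + 1) k * fact k)" for k
  have "jac_coeff n a b i =
      pochhammer (a + 1) n / fact n * (\<Sum>k\<le>i. c k * real ((n - k) choose (i - k)))"
    if "i \<le> n" for i
  proof -
    have "(\<Sum>k\<le>i. c k * real ((n - k) choose (i - k))) =
        (\<Sum>k\<le>i. real (n choose i) * (pochhammer (- real i) k * pochhammer (real n + a + b + 1) k /
       (pochhammer (a + 1) k * fact k)))"
    proof (intro sum.cong refl)
      fix k assume "k \<in> {..i}"
      then have "c k * real ((n - k) choose (i - k)) =
          (pochhammer (- real n) k * real ((n - k) choose (i - k))) *
          (pochhammer (real n + a + b + 1) k / (pochhammer (a + 1) k * fact k))"
        by (simp add: c_def)
      also have "pochhammer (- real n) k * real ((n - k) choose (i - k)) =
          real (n choose i) * pochhammer (- real i) k"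
        using \<open>k \<in> {..i}\<close> that by (intro pochhammer_neg_of_nat_times_binomial) auto
      finally show "c k * real ((n - k) choose (i - k)) = real (n choose i) *
          (pochhammer (- real i) k * pochhammer (real n + a + b + 1) k /
            (pochhammer (a + 1) k * fact k))"
        by simp
    qed
    also have "\<dots> = real (n choose i) *
        (pochhammer (a + 1 - (real n + a + b + 1)) i / pochhammer (a + 1) i)"
      using chu_vandermonde[of "a + 1" i "real n + a + b + 1"] pochhammer_neq_0_if_pos[of "a + 1" i]
        assms unfolding sum_distrib_left[symmetric] by simp
    also have "pochhammer (a + 1 - (real n + a + b + 1)) i =
        (-1) ^ i * pochhammer (b + 1 + real (n - i)) i"
      using pochhammer_minus[of "real n + b" i] that by (simp add: of_nat_diff algebra_simps)
    finally show ?thesis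
      using that pochhammer_neq_0_if_pos[of "a + 1" i] assms
      by (simp add: jac_coeff_def binomial_fact pochhammer_product[of i n] field_simps)
  qed
  then have "hjac n a b u v = pochhammer (a + 1) n / fact n *
      (\<Sum>i\<le>n. (\<Sum>k\<le>i. c k * real ((n - k) choose (i - k))) * u ^ i * v ^ (n - i))"
    by (simp add: hjac_def sum_distrib_left mult_ac)
  then show ?thesis
    unfolding sum_pow_times_power_sum[symmetric] by (simp add: c_def)
qed

lemma hjac_swap: "hjac n a b u v = (-1) ^ n * hjac n b a v u"
proof -
  have "jac_coeff n a b i = (-1) ^ n * jac_coeff n b a (n - i)" if "i \<le> n" for i
  proof -
    have sign: "(-1 :: real) ^ i = (-1) ^ n * (-1) ^ (n - i)"
      using that by (simp add: minus_one_power_iff)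
    show ?thesis
      using that unfolding jac_coeff_def sign by (simp add: mult_ac)
  qed
  then have "hjac n a b u v = (\<Sum>i\<le>n. (-1) ^ n * jac_coeff n b a (n - i) * u ^ i * v ^ (n - i))"
    by (simp add: hjac_def)
  also have "\<dots> = (\<Sum>i\<le>n. (-1) ^ n * jac_coeff n b a i * u ^ (n - i) * v ^ i)"
    by (rule sum.reindex_bij_witness[of _ "\<lambda>i. n - i" "\<lambda>i. n - i"]) auto
  finally show ?thesis by (simp add: hjac_def sum_distrib_left mult_ac)
qed

lemma hjac_0_right: "hjac n a b u 0 = (-1) ^ n * pochhammer (b + 1) n / fact n * u ^ n"
proof -
  have "hjac n a b u 0 = (\<Sum>i\<in>{n}. jac_coeff n a b i * u ^ i * 0 ^ (n - i))"
    unfolding hjac_def by (intro sum.mono_neutral_right) auto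
  then show ?thesis by (simp add: jac_coeff_def)
qed

lemma hjac_0_left: "hjac n a b 0 v = pochhammer (a + 1) n / fact n * v ^ n"
  by (subst hjac_swap) (simp add: hjac_0_right flip: power_mult_distrib)

lemma hjac_scale: "hjac n a b (r * u) (r * v) = r ^ n * hjac n a b u v"
  unfolding hjac_def sum_distrib_left
  by (intro sum.cong refl) (simp add: power_mult_distrib flip: power_add)

text \<open>For \<open>s = 0\<close> the argument of the Jacobi polynomial is \<open>-1\<close> by the convention for division by zero;
  the case is needed because \<open>1 - |\<^bold>x\<^bsub>j-1\<^esub>|\<close> vanishes on a part of the boundary of the simplex.\<close>

lemma jacobi_poly_homogeneous:
  assumes "a > -1" "s \<noteq> 0 \<or> x = 0"
  shows "s ^ n * jacobi_poly n a b (2 * x / s - 1) = hjac n a b (s - x) x"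
proof (cases "s = 0")
  case True
  then show ?thesis
    using assms by (cases "n = 0") (simp_all add: hjac_0_right jacobi_poly_def)
next
  case False
  have e: "(1 - (2 * x / s - 1)) / 2 = (s - x) / s" using False by (simp add: field_simps)
  have pw: "s ^ n * ((s - x) / s) ^ k = (s - x) ^ k * s ^ (n - k)" if "k \<le> n" for k
    using False that by (simp add: field_simps flip: power_add)
  show ?thesis
    unfolding jacobi_poly_def hjac_eq_hypergeometric[OF assms(1)] e
    by (simp add: sum_distrib_left) (intro sum.cong refl, simp add: pw[symmetric])
qed

section \<open>Expansion of a Jacobi polynomial on a face\<close>

text \<open>The summand is, for \<open>A \<noteq> 0\<close>, the terminating very-well-poised term
  \<open>(-1)\<^sup>j (A + 2 j) / (j! (p - j)! (A + j)\<^bsub>p+1\<^esub>)\<close>, which has a closed form for its partial sums. Written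
  without the factor \<open>A + 2 j\<close> it also makes sense for \<open>A = 0\<close>, which occurs if \<open>a + c = -1\<close>.\<close>

lemma pochhammer_inversion_partial_sum:
  assumes A: "A > -1" and J: "J < p"
  shows "(\<Sum>j\<le>J. (-1) ^ j / (fact j * pochhammer (A + real j) j * fact (p - j) *
            pochhammer (A + 2 * real j + 1) (p - j))) =
         (-1) ^ J / (real p * fact J * fact (p - 1 - J) * pochhammer (A + real J + 1) p)"
  using J
proof (induction J)
  case 0
  then show ?case by (cases p) (simp_all add: algebra_simps)
next
  case (Suc J)
  obtain r where r: "p = J + 2 + r"
    using Suc.prems by (auto simp: less_iff_Suc_add)
  \<comment> \<open>All three Pochhammer products below are \<open>(B)\<^bsub>p+1\<^esub>\<close> divided by one linear factor.\<close>
  define B where "B = A + real J + 1"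
  have B: "B > 0" using A by (simp add: B_def)
  have "pochhammer B (Suc p) = pochhammer B (Suc J) * pochhammer (B + real (Suc J)) (Suc (Suc r))"
    using pochhammer_product'[of B "Suc J" "Suc (Suc r)"] by (simp add: r)
  also have "pochhammer (B + real (Suc J)) (Suc (Suc r)) =
      (B + real (Suc J)) * pochhammer (B + real (Suc J) + 1) (Suc r)"
    by (rule pochhammer_rec)
  also have "B + real (Suc J) + 1 = A + 2 * real (Suc J) + 1" by (simp add: B_def)
  also have "Suc r = p - Suc J" by (simp add: r)
  also have "pochhammer B (Suc J) = pochhammer (A + real (Suc J)) (Suc J)"
    by (simp add: B_def add_ac)
  finally have q1: "pochhammer (A + real (Suc J)) (Suc J) * pochhammer (A + 2 * real (Suc J) + 1) (p - Suc J) *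
      (B + real (Suc J)) = pochhammer B (Suc p)" by (simp only: mult_ac)
  have q2: "pochhammer B (Suc p) = pochhammer B p * (B + real p)" by (rule pochhammer_Suc)
  have q3: "pochhammer B (Suc p) = B * pochhammer (B + 1) p" by (rule pochhammer_rec)
  have P: "pochhammer B (Suc p) > 0" by (rule pochhammer_pos[OF B])
  have e1: "pochhammer (A + real (Suc J)) (Suc J) * pochhammer (A + 2 * real (Suc J) + 1) (p - Suc J) =
     pochhammer B (Suc p) / (B + real (Suc J))" using q1 B by (simp add: eq_divide_eq)
  have e2: "pochhammer (A + real J + 1) p = pochhammer B (Suc p) / (B + real p)"
    using q2 B by (simp add: B_def[symmetric] eq_divide_eq)
  have e3: "pochhammer (A + real (Suc J) + 1) p = pochhammer B (Suc p) / B"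
    using q3 B by (simp add: B_def eq_divide_eq add_ac mult_ac)
  have "(\<Sum>j\<le>Suc J. (-1) ^ j / (fact j * pochhammer (A + real j) j * fact (p - j) *
            pochhammer (A + 2 * real j + 1) (p - j))) =
     (-1) ^ J / (real p * fact J * fact (p - 1 - J) * pochhammer (A + real J + 1) p) +
     (-1) ^ Suc J / (fact (Suc J) * fact (p - Suc J) * (pochhammer (A + real (Suc J)) (Suc J) *
            pochhammer (A + 2 * real (Suc J) + 1) (p - Suc J)))"
    using Suc by (simp add: mult_ac)
  also have "\<dots> = (-1) ^ Suc J / (real p * fact (Suc J) * fact (p - 1 - Suc J) * 
      pochhammer (A + real (Suc J) + 1) p)"
  proof -
    have f: "(fact (p - 1 - J) :: real) = real (Suc r) * fact r" "(fact (p - Suc J) :: real) = real (Suc r) * fact r"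
      "p - 1 - Suc J = r"
      by (simp_all add: r del: of_nat_Suc)
    have "(-1) ^ J / (real p * F * (real (Suc r) * G) * (W / (B + real p))) +
        (-1) ^ Suc J / (real (Suc J) * F * (real (Suc r) * G) * (W / (B + real (Suc J)))) =
        (-1) ^ Suc J / (real p * (real (Suc J) * F) * G * (W / B))"
      if "F > 0" "G > 0" "W > 0" for F G W :: real
    proof -
      have "(B + real p) * real (Suc J) - (B + real (Suc J)) * real p = - (B * real (Suc r))"
        by (simp add: r algebra_simps)
      then have "(B + real p) / real p - (B + real (Suc J)) / real (Suc J) =
          - B * real (Suc r) / (real p * real (Suc J))"
        by (simp add: r field_simps)
      then have "(-1) ^ J / (F * G * W * real (Suc r)) * 
            ((B + real p) / real p - (B + real (Suc J)) / real (Suc J)) =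
          (-1) ^ J / (F * G * W * real (Suc r)) * (- B * real (Suc r) / (real p * real (Suc J)))"
        by (rule arg_cong)
      then show ?thesis using that B
        by (simp add: right_diff_distrib mult_ac del: of_nat_Suc)
    qed
    from this[of "fact J" "fact r" "pochhammer B (Suc p)"] show ?thesis
      unfolding e1 e2 e3 f using P by (simp only: fact_Suc fact_gt_zero mult_ac simp_thms True_implies_equals)
  qed
  finally show ?case .
qed

lemma pochhammer_inversion:
  assumes A: "A > -1"
  shows "(\<Sum>j\<le>p. (-1) ^ j / (fact j * pochhammer (A + real j) j * fact (p - j) *
            pochhammer (A + 2 * real j + 1) (p - j))) = (if p = 0 then 1 else 0)"
proof (cases p)
  case (Suc q)
  have 1: "pochhammer (A + real (Suc q)) (Suc q) > 0"
    using A by (intro pochhammer_pos) simp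
  show ?thesis
    using 1 pochhammer_inversion_partial_sum[OF A, of q p] Suc
    by (simp add: field_simps)
qed simp

text \<open>Inverts the triangular system \<open>E\<^sub>k = (\<Sum>n=k..N. T\<^sub>n / ((al + 2 k + 1)\<^bsub>n-k\<^esub> (n - k)!))\<close>. The form of the
  inverse in which \<open>i\<close> enters only through \<open>(-k)\<^sub>i (al + k)\<^sub>i\<close> is what produces a \<open>\<^sub>4F\<^sub>3\<close> when it is
  summed against a Jacobi polynomial.\<close>

lemma inversion_sum:
  fixes T :: "nat \<Rightarrow> real"
  assumes al: "al > -1" and iN: "i \<le> N"
  shows "T i = (\<Sum>k\<le>N. (-1) ^ k * pochhammer (- real k) i * pochhammer (al + real k) i /
      (fact k * pochhammer (al + real k) k) *
      (\<Sum>n\<in>{k..N}. T n / (pochhammer (al + 2 * real k + 1) (n - k) * fact (n - k))))"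
proof -
  define D where "D k n = T n / (pochhammer (al + 2 * real k + 1) (n - k) * fact (n - k))" for k n
  define w where "w k = (-1) ^ (k - i) / (fact (k - i) * pochhammer (al + real i + real k) (k - i))" for k
  have w: "(-1) ^ k * pochhammer (- real k) i * pochhammer (al + real k) i /
      (fact k * pochhammer (al + real k) k) = (if i \<le> k then w k else 0)" for k
  proof (cases "i \<le> k")
    case True
    have "pochhammer (al + real k) k = pochhammer (al + real k) i * pochhammer (al + real i + real k) (k - i)"
      using pochhammer_product[OF True, of "al + real k"] by (simp add: add_ac)
    moreover have "pochhammer (al + real k) i \<noteq> 0"
      using al True by (intro pochhammer_neq_0_if_pos) (cases k, auto)
    moreover have "(-1 :: real) ^ k * (-1) ^ i = (-1) ^ (k - i)"
      using True by (simp add: minus_one_power_iff)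
    ultimately show ?thesis
      using True by (simp add: w_def pochhammer_neg_of_nat flip: mult.assoc)
  qed (use pochhammer_of_nat_eq_0_lemma[of k i] in auto)
  have "(\<Sum>k\<le>N. (if i \<le> k then w k else 0) * (\<Sum>n\<in>{k..N}. D k n)) =
      (\<Sum>k\<le>N. \<Sum>n\<le>N. if i \<le> k \<and> k \<le> n then w k * D k n else 0)"
  proof (intro sum.cong refl)
    fix k
    have "(\<Sum>n\<in>{k..N}. D k n) = (\<Sum>n\<le>N. if k \<le> n then D k n else 0)"
      by (intro sum.mono_neutral_cong_left) auto
    then show "(if i \<le> k then w k else 0) * (\<Sum>n\<in>{k..N}. D k n) =
        (\<Sum>n\<le>N. if i \<le> k \<and> k \<le> n then w k * D k n else 0)"
      by (auto simp: sum_distrib_left intro!: sum.cong)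
  qed
  also have "\<dots> = (\<Sum>n\<le>N. \<Sum>k\<le>N. if i \<le> k \<and> k \<le> n then w k * D k n else 0)"
    by (rule sum.swap)
  also have "\<dots> = (\<Sum>n\<le>N. if n = i then T n else 0)"
  proof (intro sum.cong refl)
    fix n assume n: "n \<in> {..N}"
    have "(\<Sum>k\<le>N. if i \<le> k \<and> k \<le> n then w k * D k n else 0) = (\<Sum>k\<in>{i..n}. w k * D k n)"
      using n by (intro sum.mono_neutral_cong_right) auto
    also have "\<dots> = (if n = i then T n else 0)"
    proof (cases "i \<le> n")
      case True
      have "(\<Sum>k\<in>{i..n}. w k * D k n) = (\<Sum>j\<le>n - i. T n * ((-1) ^ j /
        (fact j * pochhammer (al + 2 * real i + real j) j * fact (n - i - j) *
            pochhammer (al + 2 * real i + 2 * real j + 1) (n - i - j))))"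
        by (rule sum.reindex_bij_witness[of _ "\<lambda>j. j + i" "\<lambda>k. k - i"])
           (use True in \<open>auto simp: w_def D_def of_nat_diff algebra_simps\<close>)
      also have "\<dots> = (if n = i then T n else 0)"
        using pochhammer_inversion[of "al + 2 * real i" "n - i"] al True
        unfolding sum_distrib_left[symmetric] by auto
      finally show ?thesis .
    qed auto
    finally show "(\<Sum>k\<le>N. if i \<le> k \<and> k \<le> n then w k * D k n else 0) = (if n = i then T n else 0)" .
  qed
  also have "\<dots> = T i" using iN by simp
  finally show ?thesis by (simp add: w D_def)
qed

text \<open>With \<open>T\<^sub>n = (-N)\<^sub>n (N + al + b + 1)\<^sub>n t\<^sup>n\<close>, the dependence of the \<open>n\<close>-th coefficient on \<open>k\<close> splits off
  except for \<open>(al + 2 k + 1)\<^bsub>n-k\<^esub> (n - k)!\<close>. So the functions on the left are the \<open>E\<^sub>k\<close> of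
  \<open>inversion_sum\<close>, up to constants.\<close>

lemma pow_times_hjac:
  assumes "al > -1" "k \<le> N"
    and nz: "pochhammer (real N + al + b + 1) N \<noteq> 0"
  shows "t ^ k * hjac (N - k) (al + 2 * real k) b t (1 - t) =
    (-1) ^ k * pochhammer (al + 2 * real k + 1) (N - k) / (fact N * pochhammer (real N + al + b + 1) k) *
    (\<Sum>n\<in>{k..N}. (pochhammer (- real N) n * pochhammer (real N + al + b + 1) n * t ^ n) /
       (pochhammer (al + 2 * real k + 1) (n - k) * fact (n - k)))"
proof -
  define P where "P = pochhammer (real N + al + b + 1)"
  have Pk: "P k \<noteq> 0" using nz assms(2) pochhammer_neq_0_mono unfolding P_def by blast
  have "(\<Sum>n\<in>{k..N}. (pochhammer (- real N) n * P n * t ^ n) /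
       (pochhammer (al + 2 * real k + 1) (n - k) * fact (n - k))) =
     (\<Sum>j\<le>N - k. (pochhammer (- real N) (k + j) * P (k + j) * t ^ (k + j)) /
       (pochhammer (al + 2 * real k + 1) j * fact j))"
    by (rule sum.reindex_bij_witness[of _ "\<lambda>j. j + k" "\<lambda>i. i - k"]) (use assms(2) in \<open>auto simp: add_ac\<close>)
  also have "\<dots> = pochhammer (- real N) k * P k * t ^ k *
     (\<Sum>j\<le>N - k. (pochhammer (- real (N - k)) j * pochhammer (real (N - k) + (al + 2 * real k) + b + 1) j) /
       (pochhammer (al + 2 * real k + 1) j * fact j) * t ^ j)"
    unfolding sum_distrib_left
  proof (intro sum.cong refl)
    fix j
    have "pochhammer (- real N) (k + j) = pochhammer (- real N) k * pochhammer (- real (N - k)) j"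
      using pochhammer_product'[of "- real N" k j] assms(2) by (simp add: of_nat_diff)
    moreover have "P (k + j) = P k * pochhammer (real (N - k) + (al + 2 * real k) + b + 1) j"
      using assms(2) unfolding P_def pochhammer_product' by (simp add: of_nat_diff algebra_simps)
    ultimately show "(pochhammer (- real N) (k + j) * P (k + j) * t ^ (k + j)) /
       (pochhammer (al + 2 * real k + 1) j * fact j) = pochhammer (- real N) k * P k * t ^ k * 
        (pochhammer (- real (N - k)) j * pochhammer (real (N - k) + (al + 2 * real k) + b + 1) j /
       (pochhammer (al + 2 * real k + 1) j * fact j) * t ^ j)"
      by (simp add: power_add)
  qed
  also have "(\<Sum>j\<le>N - k. (pochhammer (- real (N - k)) j * pochhammer (real (N - k) + (al + 2 * real k) + b + 1) j) /
       (pochhammer (al + 2 * real k + 1) j * fact j) * t ^ j) =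
     fact (N - k) / pochhammer (al + 2 * real k + 1) (N - k) * hjac (N - k) (al + 2 * real k) b t (1 - t)"
    using assms(1) pochhammer_neq_0_if_pos[of "al + 2 * real k + 1" "N - k"]
    by (simp add: hjac_eq_hypergeometric)
  finally show ?thesis
    using Pk assms pochhammer_neq_0_if_pos[of "al + 2 * real k + 1" "N - k"]
    by (simp add: P_def[symmetric] pochhammer_neg_of_nat flip: power_mult_distrib)
qed

text \<open>As a function of \<open>m\<close> and \<open>k\<close> this is the Racah polynomial; the exchange of \<open>(m, b)\<close> and \<open>(k, c)\<close> is its
  duality.\<close>

abbreviation racah_4F3 :: "nat \<Rightarrow> nat \<Rightarrow> nat \<Rightarrow> real \<Rightarrow> real \<Rightarrow> real \<Rightarrow> real" where
  "racah_4F3 N m k a b c \<equiv> hyp_4F3 m (real m + a + b + 1) (- real k) (real k + a + c + 1)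
     (- real N) (real N + a + b + c + 2) (a + 1)"

lemma pochhammer_top_neq_0:
  assumes "a > -1" "b > -1" "c > -1" "i \<le> N"
  shows "pochhammer (real N + a + b + c + 2) i \<noteq> 0"
  using assms by (intro pochhammer_neq_0_if_pos) (cases N, auto)

text \<open>The face \<open>z = 0\<close> of the three-variable identity: there \<open>P\<^sub>k(x, z)\<close> reduces to a multiple of \<open>x\<^sup>k\<close>,
  and the other side to a multiple of a single Jacobi polynomial, whose powers of \<open>t\<close> are replaced
  one by one using \<open>inversion_sum\<close>.\<close>

lemma hjac_face_expansion:
  assumes ab: "a > -1" "b > -1" "c > -1" and mN: "m \<le> N"
  shows "hjac m a b t (1 - t) = (\<Sum>k\<le>N. pochhammer (a + 1) m * fact N / fact m *
      pochhammer (real N + a + b + c + 2) k /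
      (fact k * pochhammer (a + c + 1 + real k) k * pochhammer (a + c + 2 * real k + 2) (N - k)) *
      racah_4F3 N m k a b c * (t ^ k * hjac (N - k) (a + c + 2 * real k + 1) b t (1 - t)))"
proof -
  define P where "P = pochhammer (real N + a + b + c + 2)"
  define T where "T n = pochhammer (- real N) n * P n * t ^ n" for n
  define E where "E k = (\<Sum>n\<in>{k..N}. T n / (pochhammer (a + c + 1 + 2 * real k + 1) (n - k) * fact (n - k)))" for k
  define G where "G k = t ^ k * hjac (N - k) (a + c + 2 * real k + 1) b t (1 - t)" for k
  define V where "V k = (-1) ^ k * fact N * P k / pochhammer (a + c + 2 * real k + 2) (N - k)" for k
  have Pnz: "P i \<noteq> 0" if "i \<le> N" for i
    using pochhammer_top_neq_0[OF ab that] by (simp add: P_def)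
  have E: "E k = V k * G k" if k: "k \<le> N" for k
    using pow_times_hjac[of "a + c + 1" k N b t] ab k Pnz[of N] Pnz[of k] 
      pochhammer_neq_0_if_pos[of "a + c + 2 * real k + 2" "N - k"]
    by (simp add: E_def T_def G_def V_def P_def add_ac flip: power_mult_distrib)
  have ti: "t ^ i = (\<Sum>k\<le>N. pochhammer (- real k) i * pochhammer (real k + a + c + 1) i /
        (pochhammer (- real N) i * P i) *
        ((-1) ^ k / (fact k * pochhammer (a + c + 1 + real k) k) * E k))" if i: "i \<le> N" for i
  proof -
    have "pochhammer (- real N) i \<noteq> 0" using i by (simp add: pochhammer_of_nat_eq_0_iff)
    then have "t ^ i = T i / (pochhammer (- real N) i * P i)"
      using Pnz[OF i] by (simp add: T_def)
    also have "\<dots> = (\<Sum>k\<le>N. (-1) ^ k * pochhammer (- real k) i * pochhammer (a + c + 1 + real k) i /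
      (fact k * pochhammer (a + c + 1 + real k) k) * E k) / (pochhammer (- real N) i * P i)"
      using inversion_sum[of "a + c + 1" i N T] ab i by (simp add: E_def)
    finally show ?thesis
      by (simp add: sum_divide_distrib add_ac mult_ac)
  qed
  define c0 where "c0 i = pochhammer (- real m) i * pochhammer (real m + a + b + 1) i /
       (pochhammer (a + 1) i * fact i)" for i
  have "hjac m a b t (1 - t) = pochhammer (a + 1) m / fact m * (\<Sum>i\<le>m. c0 i * t ^ i)"
    using ab by (simp add: hjac_eq_hypergeometric c0_def)
  also have "(\<Sum>i\<le>m. c0 i * t ^ i) = (\<Sum>i\<le>m. \<Sum>k\<le>N. c0 i *
        (pochhammer (- real k) i * pochhammer (real k + a + c + 1) i / (pochhammer (- real N) i * P i)) *
        ((-1) ^ k / (fact k * pochhammer (a + c + 1 + real k) k) * E k))"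
    using mN by (intro sum.cong refl) (subst ti, simp_all add: sum_distrib_left mult_ac)
  also have "\<dots> = (\<Sum>k\<le>N. \<Sum>i\<le>m. c0 i *
        (pochhammer (- real k) i * pochhammer (real k + a + c + 1) i / (pochhammer (- real N) i * P i)) *
        ((-1) ^ k / (fact k * pochhammer (a + c + 1 + real k) k) * E k))"
    by (rule sum.swap)
  also have "\<dots> = (\<Sum>k\<le>N. racah_4F3 N m k a b c * 
        ((-1) ^ k / (fact k * pochhammer (a + c + 1 + real k) k) * E k))"
    unfolding hyp_4F3_def sum_distrib_right by (intro sum.cong refl) (simp add: c0_def P_def mult_ac)
  finally show ?thesis
    unfolding sum_distrib_left
    by (simp add: E V_def G_def P_def mult_ac flip: power_mult_distrib)
qed

section \<open>Linear independence by order of vanishing\<close>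

text \<open>The \<open>k\<close>-th function vanishes at \<open>0\<close> to order exactly \<open>k\<close>: divide the relation by the lowest power that
  occurs and let \<open>t\<close> tend to \<open>0\<close>.\<close>

lemma powers_times_nonvanishing_independent:
  fixes q :: "nat \<Rightarrow> real \<Rightarrow> real"
  assumes cont: "\<And>k. k \<le> N \<Longrightarrow> continuous_on UNIV (q k)"
    and nz: "\<And>k. k \<le> N \<Longrightarrow> q k 0 \<noteq> 0"
    and zero: "\<And>t. 0 < t \<Longrightarrow> t < 1 \<Longrightarrow> (\<Sum>k\<le>N. c k * (t ^ k * q k t)) = 0"
    and "k \<le> N"
  shows "c k = 0"
  using \<open>k \<le> N\<close>
proof (induction k rule: less_induct)
  case (less k)
  define g where "g t = (\<Sum>j\<in>{k..N}. c j * (t ^ (j - k) * q j t))" for t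
  have "g t = 0" if t: "0 < t" "t < 1" for t
  proof -
    have "t ^ k * g t = (\<Sum>j\<in>{k..N}. c j * (t ^ j * q j t))"
      unfolding g_def sum_distrib_left
    proof (intro sum.cong refl)
      fix j assume "j \<in> {k..N}"
      then have "t ^ j = t ^ k * t ^ (j - k)" by (simp flip: power_add)
      then show "t ^ k * (c j * (t ^ (j - k) * q j t)) = c j * (t ^ j * q j t)" by simp
    qed
    also have "\<dots> = (\<Sum>j\<le>N. c j * (t ^ j * q j t))"
      using less by (intro sum.mono_neutral_left) auto
    finally show ?thesis using zero[OF t] t by simp
  qed
  then have "eventually (\<lambda>t. g t = 0) (at_right 0)"
    unfolding eventually_at_right_field by (intro exI[of _ 1]) auto
  then have "(g \<longlongrightarrow> 0) (at_right 0)" by (simp add: tendsto_eventually)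
  moreover have "continuous_on UNIV g"
    unfolding g_def using cont by (intro continuous_intros) auto
  then have "(g \<longlongrightarrow> g 0) (at_right 0)"
    by (meson UNIV_I continuous_on_def tendsto_within_subset subset_UNIV)
  ultimately have "g 0 = 0" using tendsto_unique trivial_limit_at_right_real by blast
  moreover have "g 0 = (\<Sum>j\<in>{k}. c j * (0 ^ (j - k) * q j 0))"
    unfolding g_def using less.prems by (intro sum.mono_neutral_right) auto
  ultimately show ?case using nz[OF less.prems] by simp
qed

section \<open>Harmonic polynomials in three variables\<close>

lemma jac_coeff_rec:
  assumes "i < n"
  shows "(real i + 1) * (real i + 1 + a) * jac_coeff n a b (Suc i) +
         (real n - real i) * (real n - real i + b) * jac_coeff n a b i = 0"
proof -
  obtain r where n: "n = Suc (i + r)" using assms less_iff_Suc_add by auto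
  have 1: "pochhammer (a + 1 + real i) (Suc r) = (a + 1 + real i) * pochhammer (a + 2 + real i) r"
    using pochhammer_rec[of "a + 1 + real i" r] by (simp add: add_ac)
  have 2: "pochhammer (b + 1 + real r) (Suc i) = (b + 1 + real r) * pochhammer (b + 2 + real r) i"
    using pochhammer_rec[of "b + 1 + real r" i] by (simp add: add_ac)
  have e: "n - i = Suc r" "n - Suc i = r" by (simp_all add: n)
  have l: "jac_coeff n a b (Suc i) = - ((-1) ^ i * pochhammer (a + 2 + real i) r * 
     ((b + 1 + real r) * pochhammer (b + 2 + real r) i) / ((real i + 1) * fact i * fact r))"
    unfolding jac_coeff_def e 2 by (simp add: add_ac)
  have r: "jac_coeff n a b i = (-1) ^ i * ((a + 1 + real i) * pochhammer (a + 2 + real i) r) * 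
     pochhammer (b + 2 + real r) i / (fact i * ((real r + 1) * fact r))"
    unfolding jac_coeff_def e 1 by (simp add: add_ac)
  have nr: "real n - real i = real r + 1" by (simp add: n)
  show ?thesis unfolding l r nr by (simp add: divide_simps) (simp add: algebra_simps)
qed

text \<open>Polynomials are represented by their arrays of coefficients. This is the operator
  \<open>x \<partial>\<^sub>x\<^sup>2 + (a + 1) \<partial>\<^sub>x + y \<partial>\<^sub>y\<^sup>2 + (b + 1) \<partial>\<^sub>y\<close>, and \<open>mult_sum2\<close> below is the multiplication by \<open>x + y\<close>.\<close>

definition lap2 :: "real \<Rightarrow> real \<Rightarrow> (nat \<Rightarrow> nat \<Rightarrow> real) \<Rightarrow> nat \<Rightarrow> nat \<Rightarrow> real" where
  "lap2 a b w i j = (real i + 1) * (real i + 1 + a) * w (Suc i) j + (real j + 1) * (real j + 1 + b) * w i (Suc j)"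

definition mult_sum2 :: "(nat \<Rightarrow> nat \<Rightarrow> real) \<Rightarrow> nat \<Rightarrow> nat \<Rightarrow> real" where
  "mult_sum2 w i j = (case i of 0 \<Rightarrow> 0 | Suc i' \<Rightarrow> w i' j) + (case j of 0 \<Rightarrow> 0 | Suc j' \<Rightarrow> w i j')"

text \<open>The array of \<open>hjac m a b x y * (x + y) ^ r\<close>.\<close>

primrec jac_pow :: "nat \<Rightarrow> real \<Rightarrow> real \<Rightarrow> nat \<Rightarrow> nat \<Rightarrow> nat \<Rightarrow> real" where
  "jac_pow m a b 0 = (\<lambda>i j. if i + j = m then jac_coeff m a b i else 0)"
| "jac_pow m a b (Suc r) = mult_sum2 (jac_pow m a b r)"

lemma jac_pow_support: "i + j \<noteq> m + r \<Longrightarrow> jac_pow m a b r i j = 0"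
  by (induction r arbitrary: i j) (auto simp: mult_sum2_def split: nat.split)

text \<open>The commutator of the two operators is \<open>2 (x \<partial>\<^sub>x + y \<partial>\<^sub>y) + a + b + 2\<close>, which is a scalar on
  homogeneous polynomials by Euler's formula.\<close>

lemma lap2_mult_sum2:
  assumes supp: "\<And>i j. i + j \<noteq> d \<Longrightarrow> w i j = 0"
  shows "lap2 a b (mult_sum2 w) i j =
    mult_sum2 (lap2 a b w) i j + (2 * real d + a + b + 2) * w i j"
proof -
  have "real (i + j) * w i j = real d * w i j" using supp[of i j] by (cases "i + j = d") auto
  then show ?thesis
    by (cases i; cases j) (simp_all add: lap2_def mult_sum2_def algebra_simps)
qed

lemma lap2_jac_pow_0: "lap2 a b (jac_pow m a b 0) i j = 0"
proof (cases "i + Suc j = m")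
  case True
  then have "real j + 1 = real m - real i" by simp
  then show ?thesis using True jac_coeff_rec[of i m a b] by (auto simp: lap2_def add_ac)
qed (simp add: lap2_def)

text \<open>On \<open>h(x, y) G(x + y)\<close>, with \<open>h\<close> a homogeneous Jacobi polynomial of degree \<open>m\<close>, the operator acts as
  \<open>u \<partial>\<^sub>u\<^sup>2 + (a + b + 2 m + 2) \<partial>\<^sub>u\<close> acts on \<open>G(u)\<close>. The pair thus behaves like one variable with
  exponent \<open>a + b + 2 m + 1\<close>, which is why this is the parameter of the next factor in a tree.\<close>

lemma lap2_jac_pow_Suc:
  "lap2 a b (jac_pow m a b (Suc r)) i j =
    (real r + 1) * (real r + 2 * real m + a + b + 2) * jac_pow m a b r i j"
proof (induction r arbitrary: i j)
  case 0
  have "mult_sum2 (lap2 a b (jac_pow m a b 0)) i j = 0"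
    by (simp add: mult_sum2_def lap2_jac_pow_0 split: nat.split del: jac_pow.simps)
  then show ?case
    using lap2_mult_sum2[of m "jac_pow m a b 0" a b i j] by simp
next
  case (Suc r)
  have "mult_sum2 (lap2 a b (jac_pow m a b (Suc r))) i j =
      (real r + 1) * (real r + 2 * real m + a + b + 2) * jac_pow m a b (Suc r) i j"
    by (subst (2) jac_pow.simps)
      (simp add: mult_sum2_def Suc.IH distrib_left split: nat.split del: jac_pow.simps)
  moreover have "lap2 a b (jac_pow m a b (Suc (Suc r))) i j =
      mult_sum2 (lap2 a b (jac_pow m a b (Suc r))) i j +
      (2 * real (m + Suc r) + a + b + 2) * jac_pow m a b (Suc r) i j"
    by (subst jac_pow.simps, rule lap2_mult_sum2) (rule jac_pow_support)
  ultimately show ?case by (simp add: algebra_simps del: jac_pow.simps)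
qed

lemma eval_mult_sum2:
  "(\<Sum>i\<le>Suc d. mult_sum2 w i (Suc d - i) * x ^ i * y ^ (Suc d - i)) =
   (x + y) * (\<Sum>i\<le>d. w i (d - i) * x ^ i * y ^ (d - i))"
proof -
  have "(\<Sum>i\<le>Suc d. (case i of 0 \<Rightarrow> 0 | Suc i' \<Rightarrow> w i' (Suc d - i)) * x ^ i * y ^ (Suc d - i)) =
      x * (\<Sum>i\<le>d. w i (d - i) * x ^ i * y ^ (d - i))"
    by (simp add: sum.atMost_Suc_shift sum_distrib_left mult_ac del: sum.atMost_Suc)
  moreover have "(\<Sum>i\<le>Suc d. (case Suc d - i of 0 \<Rightarrow> 0 | Suc j' \<Rightarrow> w i j') * x ^ i * y ^ (Suc d - i)) =
      y * (\<Sum>i\<le>d. w i (d - i) * x ^ i * y ^ (d - i))"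
    by (simp add: Suc_diff_le sum_distrib_left mult_ac)
  ultimately show ?thesis
    unfolding mult_sum2_def by (simp only: distrib_right sum.distrib)
qed

lemma eval_jac_pow:
  "(\<Sum>i\<le>m + r. jac_pow m a b r i (m + r - i) * x ^ i * y ^ (m + r - i)) = hjac m a b x y * (x + y) ^ r"
proof (induction r)
  case 0
  then show ?case by (simp add: hjac_def)
next
  case (Suc r)
  then show ?case
    using eval_mult_sum2[of "jac_pow m a b r" "m + r" x y] by (simp add: mult_ac)
qed

text \<open>Vanishing under \<open>x \<partial>\<^sub>x\<^sup>2 + (a + 1) \<partial>\<^sub>x + y \<partial>\<^sub>y\<^sup>2 + (b + 1) \<partial>\<^sub>y + z \<partial>\<^sub>z\<^sup>2 + (c + 1) \<partial>\<^sub>z\<close>, coefficient by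
  coefficient.\<close>

definition harmonic3 :: "real \<Rightarrow> real \<Rightarrow> real \<Rightarrow> (nat \<Rightarrow> nat \<Rightarrow> nat \<Rightarrow> real) \<Rightarrow> bool" where
  "harmonic3 a b c p \<longleftrightarrow> (\<forall>i j l.
     (real i + 1) * (real i + 1 + a) * p (Suc i) j l +
     (real j + 1) * (real j + 1 + b) * p i (Suc j) l +
     (real l + 1) * (real l + 1 + c) * p i j (Suc l) = 0)"

text \<open>The equation expresses the coefficients of \<open>z\<^bsup>l+1\<^esup>\<close> through those of \<open>z\<^sup>l\<close>; it can be solved because
  \<open>(l + 1) (l + 1 + c) \<noteq> 0\<close>.\<close>

lemma harmonic3_eq_0_if_face_eq_0:
  assumes "harmonic3 a b c p" "c > -1" "\<And>i j. p i j 0 = 0"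
  shows "p i j l = 0"
proof (induction l arbitrary: i j)
  case (Suc l)
  have "(real l + 1) * (real l + 1 + c) * p i j (Suc l) = 0"
    using assms(1) Suc.IH unfolding harmonic3_def by (metis add_0 mult_zero_right)
  then show ?case using assms(2) by simp
qed (use assms in simp)

definition eval3 :: "nat \<Rightarrow> (nat \<Rightarrow> nat \<Rightarrow> nat \<Rightarrow> real) \<Rightarrow> real \<Rightarrow> real \<Rightarrow> real \<Rightarrow> real" where
  "eval3 N p x y z = (\<Sum>l\<le>N. \<Sum>i\<le>N - l. p i (N - l - i) l * x ^ i * y ^ (N - l - i) * z ^ l)"

lemma eval3_swap: "eval3 N (\<lambda>i j l. p i l j) x y z = eval3 N p x z y"
  unfolding eval3_def sum.Sigma[OF finite_atMost ballI[OF finite_atMost]]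
  by (rule sum.reindex_bij_witness[of _ "\<lambda>(l, i). (N - l - i, i)" "\<lambda>(l, i). (N - l - i, i)"])
     (auto simp: mult_ac)

text \<open>The array of \<open>hjac m a b x y * hjac (N - m) (a + b + 2 m + 1) c (x + y) z\<close>.\<close>

definition tree_coeff :: "nat \<Rightarrow> nat \<Rightarrow> real \<Rightarrow> real \<Rightarrow> real \<Rightarrow> nat \<Rightarrow> nat \<Rightarrow> nat \<Rightarrow> real" where
  "tree_coeff N m a b c i j l = (if l \<le> N - m
     then jac_coeff (N - m) (a + b + 2 * real m + 1) c (N - m - l) * jac_pow m a b (N - m - l) i j else 0)"

lemma tree_coeff_support:
  assumes "m \<le> N" "i + j + l \<noteq> N"
  shows "tree_coeff N m a b c i j l = 0"
  using assms jac_pow_support[of i j m "N - m - l" a b] by (auto simp: tree_coeff_def)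

lemma eval_tree_coeff:
  assumes "m \<le> N"
  shows "eval3 N (tree_coeff N m a b c) x y z =
    hjac m a b x y * hjac (N - m) (a + b + 2 * real m + 1) c (x + y) z"
proof -
  define n where "n = N - m"
  define q where "q = jac_coeff n (a + b + 2 * real m + 1) c"
  have N: "N = m + n" using assms by (simp add: n_def)
  have "eval3 N (tree_coeff N m a b c) x y z =
      (\<Sum>l\<le>N. if l \<le> n then q (n - l) * z ^ l * 
        (\<Sum>i\<le>N - l. jac_pow m a b (n - l) i (N - l - i) * x ^ i * y ^ (N - l - i)) else 0)"
    unfolding eval3_def tree_coeff_def n_def[symmetric] q_def
    by (intro sum.cong refl) (simp add: sum_distrib_left mult_ac)
  also have "\<dots> = (\<Sum>l\<le>n. q (n - l) * z ^ l *
        (\<Sum>i\<le>N - l. jac_pow m a b (n - l) i (N - l - i) * x ^ i * y ^ (N - l - i)))"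
    by (intro sum.mono_neutral_cong_right) (auto simp: N)
  also have "\<dots> = (\<Sum>l\<le>n. q (n - l) * z ^ l * (hjac m a b x y * (x + y) ^ (n - l)))"
  proof (intro sum.cong refl)
    fix l assume "l \<in> {..n}"
    then have "N - l = m + (n - l)" by (simp add: N)
    then show "q (n - l) * z ^ l * (\<Sum>i\<le>N - l. jac_pow m a b (n - l) i (N - l - i) * x ^ i * y ^ (N - l - i)) =
      q (n - l) * z ^ l * (hjac m a b x y * (x + y) ^ (n - l))"
      using eval_jac_pow[of m a b "n - l" x y] by simp
  qed
  also have "\<dots> = (\<Sum>i\<le>n. q i * z ^ (n - i) * (hjac m a b x y * (x + y) ^ i))"
    by (rule sum.reindex_bij_witness[of _ "\<lambda>i. n - i" "\<lambda>i. n - i"]) auto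
  finally show ?thesis
    by (simp add: hjac_def[of n] q_def n_def[symmetric] sum_distrib_left mult_ac)
qed

text \<open>By \<open>lap2_jac_pow_Suc\<close> the equation for the product reduces to the one for the second factor, as a
  polynomial in \<open>x + y\<close> and \<open>z\<close>.\<close>

lemma harmonic3_tree_coeff:
  assumes "m \<le> N"
  shows "harmonic3 a b c (tree_coeff N m a b c)"
  unfolding harmonic3_def
proof (intro allI)
  fix i j l
  define n where "n = N - m"
  define q where "q = jac_coeff n (a + b + 2 * real m + 1) c"
  have t: "tree_coeff N m a b c i j l = (if l \<le> n then q (n - l) * jac_pow m a b (n - l) i j else 0)" for i j l
    by (simp add: tree_coeff_def n_def q_def)
  have lap: "(real i + 1) * (real i + 1 + a) * tree_coeff N m a b c (Suc i) j l +
     (real j + 1) * (real j + 1 + b) * tree_coeff N m a b c i (Suc j) l =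
     (if l \<le> n then q (n - l) * lap2 a b (jac_pow m a b (n - l)) i j else 0)"
    by (simp add: t lap2_def algebra_simps)
  consider "l > n" | "l = n" | "l < n" by linarith
  then show "(real i + 1) * (real i + 1 + a) * tree_coeff N m a b c (Suc i) j l +
     (real j + 1) * (real j + 1 + b) * tree_coeff N m a b c i (Suc j) l +
     (real l + 1) * (real l + 1 + c) * tree_coeff N m a b c i j (Suc l) = 0"
  proof cases
    case 3
    then obtain r where n: "n = Suc (l + r)" using less_iff_Suc_add by auto
    have "(real r + 1) * (real r + 2 * real m + a + b + 2) * q (Suc r) + (real l + 1) * (real l + 1 + c) * q r = 0"
      using jac_coeff_rec[of r n "a + b + 2 * real m + 1" c] by (simp add: q_def n algebra_simps)
    then have "jac_pow m a b r i j * ((real r + 1) * (real r + 2 * real m + a + b + 2) * q (Suc r) +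
        (real l + 1) * (real l + 1 + c) * q r) = 0" by simp
    moreover have "n - l = Suc r" "n - Suc l = r" by (simp_all add: n)
    ultimately show ?thesis
      using 3 unfolding lap by (simp add: t lap2_jac_pow_Suc algebra_simps del: jac_pow.simps)
  next
    case 2
    then show ?thesis unfolding lap by (simp add: lap2_jac_pow_0 t del: jac_pow.simps)
  next
    case 1
    then show ?thesis by (simp add: t)
  qed
qed

section \<open>Exchanging two branches of a tree\<close>

definition swap_coeff :: "nat \<Rightarrow> nat \<Rightarrow> nat \<Rightarrow> real \<Rightarrow> real \<Rightarrow> real \<Rightarrow> real" where
  "swap_coeff N m k a b c = (-1) ^ (N - m + k) * real (N choose m) * pochhammer (c + 1) (N - m) *
     pochhammer (a + 1) m * pochhammer (real N + a + b + c + 2) k /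
     (pochhammer (c + 1) k * pochhammer (a + c + 1 + real k) k *
      pochhammer (a + c + 2 * real k + 2) (N - k)) * racah_4F3 N m k a b c"

text \<open>Passes from the tree \<open>(x y) z\<close> to the tree \<open>(x z) y\<close>. The difference of the two sides is harmonic, so it
  is enough to compare them on the face \<open>z = 0\<close>, where the identity is \<open>hjac_face_expansion\<close>.\<close>

theorem hjac_tree_swap:
  assumes ab: "a > -1" "b > -1" "c > -1" and mN: "m \<le> N"
  shows "hjac m a b x y * hjac (N - m) (a + b + 2 * real m + 1) c (x + y) z =
    (\<Sum>k\<le>N. swap_coeff N m k a b c * (hjac k a c x z * hjac (N - k) (a + c + 2 * real k + 1) b (x + z) y))"
proof -
  define p where "p i j l = tree_coeff N m a b c i j l - (\<Sum>k\<le>N. swap_coeff N m k a b c * tree_coeff N k a c b i l j)" for i j l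
  have ev: "eval3 N p x y z = hjac m a b x y * hjac (N - m) (a + b + 2 * real m + 1) c (x + y) z -
    (\<Sum>k\<le>N. swap_coeff N m k a b c * (hjac k a c x z * hjac (N - k) (a + c + 2 * real k + 1) b (x + z) y))" for x y z
  proof -
    have "eval3 N p x y z = eval3 N (tree_coeff N m a b c) x y z - 
       (\<Sum>k\<le>N. swap_coeff N m k a b c * eval3 N (\<lambda>i j l. tree_coeff N k a c b i l j) x y z)"
    proof -
      have "eval3 N (\<lambda>i j l. \<Sum>k\<le>N. swap_coeff N m k a b c * tree_coeff N k a c b i l j) x y z =
        (\<Sum>k\<le>N. swap_coeff N m k a b c * eval3 N (\<lambda>i j l. tree_coeff N k a c b i l j) x y z)"
        unfolding eval3_def sum_distrib_left sum_distrib_right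
        by (subst sum.swap[of _ "{..N}" "{..N}"], subst (2) sum.swap)
           (simp add: mult_ac)
      then show ?thesis
        unfolding p_def by (simp add: eval3_def left_diff_distrib sum_subtractf)
    qed
    also have "eval3 N (tree_coeff N m a b c) x y z =
        hjac m a b x y * hjac (N - m) (a + b + 2 * real m + 1) c (x + y) z"
      by (rule eval_tree_coeff[OF mN])
    also have "(\<Sum>k\<le>N. swap_coeff N m k a b c * eval3 N (\<lambda>i j l. tree_coeff N k a c b i l j) x y z) =
        (\<Sum>k\<le>N. swap_coeff N m k a b c * (hjac k a c x z * hjac (N - k) (a + c + 2 * real k + 1) b (x + z) y))"
      by (intro sum.cong refl) (subst eval3_swap, subst eval_tree_coeff, simp_all)
    finally show ?thesis .
  qed
  have "harmonic3 a b c p"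
  proof -
    have h: "(real i + 1) * (real i + 1 + a) * tree_coeff N k a c b (Suc i) l j +
     (real j + 1) * (real j + 1 + b) * tree_coeff N k a c b i l (Suc j) +
     (real l + 1) * (real l + 1 + c) * tree_coeff N k a c b i (Suc l) j = 0" if "k \<le> N" for i j k l
      using harmonic3_tree_coeff[OF that, of a c b, unfolded harmonic3_def, rule_format, of i l j]
      by (simp only: add_ac)
    have s: "(real i + 1) * (real i + 1 + a) * (\<Sum>k\<le>N. swap_coeff N m k a b c * tree_coeff N k a c b (Suc i) l j) +
     (real j + 1) * (real j + 1 + b) * (\<Sum>k\<le>N. swap_coeff N m k a b c * tree_coeff N k a c b i l (Suc j)) +
     (real l + 1) * (real l + 1 + c) * (\<Sum>k\<le>N. swap_coeff N m k a b c * tree_coeff N k a c b i (Suc l) j) = 0" for i j l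
    proof -
      have "(\<Sum>k\<le>N. swap_coeff N m k a b c * ((real i + 1) * (real i + 1 + a) * tree_coeff N k a c b (Suc i) l j +
         (real j + 1) * (real j + 1 + b) * tree_coeff N k a c b i l (Suc j) +
         (real l + 1) * (real l + 1 + c) * tree_coeff N k a c b i (Suc l) j)) = 0"
        using h by simp
      then show ?thesis by (simp add: sum_distrib_left distrib_left sum.distrib mult_ac)
    qed
    show ?thesis
      unfolding harmonic3_def
    proof (intro allI)
      fix i j l
      show "(real i + 1) * (real i + 1 + a) * p (Suc i) j l +
         (real j + 1) * (real j + 1 + b) * p i (Suc j) l +
         (real l + 1) * (real l + 1 + c) * p i j (Suc l) = 0"
      proof -
        have "A * (u1 - v1) + B * (u2 - v2) + C * (u3 - v3) = 0"
          if "A * u1 + B * u2 + C * u3 = 0" "A * v1 + B * v2 + C * v3 = 0" for A B C u1 u2 u3 v1 v2 v3 :: real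
          using that by (simp add: right_diff_distrib)
        then show ?thesis
          unfolding p_def
          using harmonic3_tree_coeff[OF mN, of a b c, unfolded harmonic3_def, rule_format, of i j l] s[of i l j] .
      qed
    qed
  qed
  moreover have "p i j 0 = 0" for i j
  proof (cases "i + j = N")
    case False
    then show ?thesis
      using mN by (simp add: p_def tree_coeff_support)
  next
    case True
    have z: "(\<Sum>i\<le>N. p i (N - i) 0 * (t ^ i * (1 - t) ^ (N - i))) = 0" for t
    proof -
      have "eval3 N p t (1 - t) 0 = (\<Sum>l\<in>{0}. \<Sum>i\<le>N - l. p i (N - l - i) l * t ^ i * (1 - t) ^ (N - l - i) * 0 ^ l)"
        unfolding eval3_def
        by (intro sum.mono_neutral_right ballI sum.neutral) (auto simp: power_0_left)
      then have "(\<Sum>i\<le>N. p i (N - i) 0 * (t ^ i * (1 - t) ^ (N - i))) = eval3 N p t (1 - t) 0"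
        by (simp add: mult_ac)
      also have "\<dots> = hjac m a b t (1 - t) * ((-1) ^ (N - m) * pochhammer (c + 1) (N - m) / fact (N - m)) -
        (\<Sum>k\<le>N. swap_coeff N m k a b c * ((-1) ^ k * pochhammer (c + 1) k / fact k * t ^ k * hjac (N - k) (a + c + 2 * real k + 1) b t (1 - t)))"
        by (simp add: ev hjac_0_right)
      also have "\<dots> = 0"
      proof -
        define K where "K = (-1) ^ (N - m) * pochhammer (c + 1) (N - m) / fact (N - m)"
        define L where "L k = pochhammer (a + 1) m * fact N / fact m *
            pochhammer (real N + a + b + c + 2) k /
            (fact k * pochhammer (a + c + 1 + real k) k * pochhammer (a + c + 2 * real k + 2) (N - k)) *
            racah_4F3 N m k a b c" for k
        define G where "G k = t ^ k * hjac (N - k) (a + c + 2 * real k + 1) b t (1 - t)" for k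
        have conn: "swap_coeff N m k a b c * ((-1) ^ k * pochhammer (c + 1) k / fact k) = K * L k" for k
          using pochhammer_neq_0_if_pos[of "c + 1" k] ab mN unfolding swap_coeff_def power_add K_def L_def
          by (cases "even k") (simp_all add: binomial_fact mult_ac)
        have "hjac m a b t (1 - t) = (\<Sum>k\<le>N. L k * G k)"
          unfolding L_def G_def by (rule hjac_face_expansion[OF ab mN])
        moreover have "(\<Sum>k\<le>N. swap_coeff N m k a b c * ((-1) ^ k * pochhammer (c + 1) k / fact k * t ^ k *
            hjac (N - k) (a + c + 2 * real k + 1) b t (1 - t))) = (\<Sum>k\<le>N. (K * L k) * G k)"
          unfolding conn[symmetric] G_def by (simp add: mult_ac)
        ultimately show ?thesis
          by (simp add: K_def[symmetric] sum_distrib_left mult_ac)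
      qed
      finally show ?thesis .
    qed
    have "p i (N - i) 0 = 0"
      by (rule powers_times_nonvanishing_independent[where N = N and q = "\<lambda>i t. (1 - t) ^ (N - i)"
           and c = "\<lambda>i. p i (N - i) 0"])
         (use True z in \<open>auto intro!: continuous_intros\<close>)
    moreover have "N - i = j" using True by auto
    ultimately show ?thesis by simp
  qed
  ultimately have "p i j l = 0" for i j l
    using harmonic3_eq_0_if_face_eq_0 ab(3) by blast
  then have "eval3 N p x y z = 0" by (simp add: eval3_def)
  then show ?thesis using ev by simp
qed

section \<open>Orthogonality of the exchange coefficients\<close>

text \<open>The square of the norm of a Jacobi polynomial for the weight \<open>t\<^sup>b (1 - t)\<^sup>a\<close> on the unit interval, see
  \<open>hjac_norm_integral\<close>. The customary \<open>(2 n + a + b + 1) \<Gamma>(n + a + b + 1)\<close> in the denominator is written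
  as \<open>\<Gamma>(2 n + a + b + 2) / (n + a + b + 1)\<^sub>n\<close>, which stays regular for \<open>n = 0\<close>, \<open>a + b = -1\<close>.\<close>

definition jac_norm2 :: "nat \<Rightarrow> real \<Rightarrow> real \<Rightarrow> real" where
  "jac_norm2 n a b = Gamma (a + 1 + real n) * Gamma (b + 1 + real n) * pochhammer (real n + a + b + 1) n /
     (fact n * Gamma (2 * real n + a + b + 2))"

lemma jac_norm2_pos:
  assumes "a > -1" "b > -1"
  shows "jac_norm2 n a b > 0"
proof -
  have "pochhammer (real n + a + b + 1) n > 0"
    using assms by (cases n) (auto intro!: pochhammer_pos)
  then show ?thesis
    using assms unfolding jac_norm2_def
    by (intro divide_pos_pos mult_pos_pos Gamma_real_pos) auto
qed

definition tree_norm2 :: "nat \<Rightarrow> nat \<Rightarrow> real \<Rightarrow> real \<Rightarrow> real \<Rightarrow> real" where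
  "tree_norm2 N m a b c = jac_norm2 m a b * jac_norm2 (N - m) (a + b + 2 * real m + 1) c"

lemma tree_norm2_pos: "a > -1 \<Longrightarrow> b > -1 \<Longrightarrow> c > -1 \<Longrightarrow> tree_norm2 N m a b c > 0"
  unfolding tree_norm2_def by (intro mult_pos_pos jac_norm2_pos) auto

text \<open>Both sums may be extended to \<open>i \<le> N\<close>, since their terms vanish for \<open>i > m\<close> and for \<open>i > k\<close>.\<close>

lemma racah_4F3_dual:
  assumes "m \<le> N" "k \<le> N"
  shows "racah_4F3 N m k a b c = racah_4F3 N k m a c b"
proof -
  have "(\<Sum>i\<le>m. pochhammer (- real m) i * X i * pochhammer (- real k) i * Y i / Z i) =
      (\<Sum>i\<le>N. pochhammer (- real m) i * X i * pochhammer (- real k) i * Y i / Z i)"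
    if "m \<le> N" for X Y Z :: "nat \<Rightarrow> real" and m k
    using that by (intro sum.mono_neutral_left) (auto simp: pochhammer_of_nat_eq_0_lemma)
  note * = this
  show ?thesis
    unfolding hyp_4F3_def *[OF assms(1)] *[OF assms(2)]
    by (intro sum.cong refl) (simp add: add_ac mult_ac)
qed

lemma Gamma_plus_nat:
  fixes x :: real
  assumes "x > 0"
  shows "Gamma (x + real n) = pochhammer x n * Gamma x"
proof -
  have "x \<notin> \<int>\<^sub>\<le>\<^sub>0" using assms by (auto elim!: nonpos_Ints_cases)
  then show ?thesis using pochhammer_Gamma[of x n] Gamma_real_pos[OF assms] by (simp add: field_simps)
qed

text \<open>This product is the inner product of the two tree polynomials. The Pochhammer symbols in the
  denominator of the coefficient cancel against the norm, and the remaining expression is unchanged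
  under the exchange of \<open>(m, b)\<close> and \<open>(k, c)\<close>.\<close>

lemma swap_coeff_times_norm:
  assumes ab: "a > -1" "b > -1" "c > -1" and mk: "m \<le> N" "k \<le> N"
  shows "swap_coeff N m k a b c * tree_norm2 N k a c b =
    (-1) ^ (N - m + k) * (real (N choose m) * real (N choose k) *
     pochhammer (a + 1) m * pochhammer (a + 1) k * pochhammer (c + 1) (N - m) * pochhammer (b + 1) (N - k)) *
    (pochhammer (real N + a + b + c + 2) N * Gamma (a + 1) * Gamma (b + 1) * Gamma (c + 1) /
     (fact N * Gamma (2 * real N + a + b + c + 3))) * racah_4F3 N m k a b c"
proof -
  define P where "P = pochhammer (real N + a + b + c + 2)"
  define Pk where "Pk = pochhammer (a + c + 1 + real k) k"
  define G1 where "G1 = Gamma (2 * real k + a + c + 2)"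
  define Q where "Q = pochhammer (a + c + 2 * real k + 2) (N - k)"
  have nz: "pochhammer (c + 1) k \<noteq> 0" "Pk \<noteq> 0" "Q \<noteq> 0" "G1 \<noteq> 0"
  proof -
    show "pochhammer (c + 1) k \<noteq> 0" "Q \<noteq> 0"
      using ab unfolding Q_def by (auto intro!: pochhammer_neq_0_if_pos)
    show "Pk \<noteq> 0"
      using ab unfolding Pk_def by (intro pochhammer_neq_0_if_pos) (cases k, auto)
    have "G1 > 0" using ab unfolding G1_def by (intro Gamma_real_pos) auto
    then show "G1 \<noteq> 0" by simp
  qed
  have Ga: "Gamma (a + 1 + real k) = pochhammer (a + 1) k * Gamma (a + 1)"
    using ab by (intro Gamma_plus_nat) auto
  have Gc: "Gamma (c + 1 + real k) = pochhammer (c + 1) k * Gamma (c + 1)"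
    using ab by (intro Gamma_plus_nat) auto
  have Gb: "Gamma (b + 1 + real (N - k)) = pochhammer (b + 1) (N - k) * Gamma (b + 1)"
    using ab by (intro Gamma_plus_nat) auto
  have G2: "Gamma (a + c + 2 * real k + 1 + 1 + real (N - k)) = Q * G1"
  proof -
    have "a + c + 2 * real k + 1 + 1 + real (N - k) = (a + c + 2 * real k + 2) + real (N - k)" by simp
    then show ?thesis
      using Gamma_plus_nat[of "a + c + 2 * real k + 2" "N - k"] ab unfolding Q_def G1_def
      by (simp add: add_ac)
  qed
  have P2: "P k * pochhammer (real (N - k) + (a + c + 2 * real k + 1) + b + 1) (N - k) = P N"
    using pochhammer_product[of k N "real N + a + b + c + 2"] mk unfolding P_def
    by (simp add: of_nat_diff algebra_simps)
  define P3 where "P3 = pochhammer (real (N - k) + (a + c + 2 * real k + 1) + b + 1) (N - k)"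
  have Pk': "pochhammer (real k + a + c + 1) k = Pk" by (simp add: Pk_def add_ac)
  have GN: "Gamma (2 * real (N - k) + (a + c + 2 * real k + 1) + b + 2) = Gamma (2 * real N + a + b + c + 3)"
    using mk by (simp add: of_nat_diff algebra_simps)
  have fact: "real (N choose m) / (fact k * fact (N - k)) = real (N choose m) * real (N choose k) / fact N"
    using mk by (simp add: binomial_fact)
  have "swap_coeff N m k a b c * tree_norm2 N k a c b =
     (-1) ^ (N - m + k) * (real (N choose m) / (fact k * fact (N - k))) * pochhammer (c + 1) (N - m) *
     pochhammer (a + 1) m * pochhammer (a + 1) k * Gamma (a + 1) * Gamma (c + 1) * 
     pochhammer (b + 1) (N - k) * Gamma (b + 1) * (P k * P3) / Gamma (2 * real N + a + b + c + 3) * racah_4F3 N m k a b c"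
    unfolding swap_coeff_def tree_norm2_def jac_norm2_def Ga Gb Gc G2 GN Pk' P_def[symmetric] Q_def[symmetric]
       P3_def[symmetric] G1_def[symmetric] Pk_def[symmetric]
    using nz by (simp add: mult_ac)
  also have "P k * P3 = P N" using P2 by (simp add: P3_def)
  finally show ?thesis
    unfolding fact P_def by (simp add: mult_ac)
qed

lemma swap_coeff_symmetric:
  assumes ab: "a > -1" "b > -1" "c > -1" and mk: "m \<le> N" "k \<le> N"
  shows "swap_coeff N m k a b c * tree_norm2 N k a c b = swap_coeff N k m a c b * tree_norm2 N m a b c"
proof -
  have "(-1 :: real) ^ (N - m + k) = (-1) ^ (N - k + m)"
    using mk by (cases "even N"; cases "even m"; cases "even k") (simp_all add: minus_one_power_iff)
  then show ?thesis
    unfolding swap_coeff_times_norm[OF ab mk] swap_coeff_times_norm[OF ab(1) ab(3) ab(2) mk(2) mk(1)]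
      racah_4F3_dual[OF mk, of a b c]
    by (simp add: mult_ac add_ac)
qed

text \<open>On the face \<open>z = 0\<close> the \<open>k\<close>-th polynomial is \<open>t\<^sup>k\<close> times a function that does not vanish at \<open>0\<close>.\<close>

lemma tree_independent:
  assumes ab: "a > -1" "c > -1" and
    zero: "\<And>t. 0 < t \<Longrightarrow> t < 1 \<Longrightarrow>
      (\<Sum>k\<le>N. e k * (hjac k a c t 0 * hjac (N - k) (a + c + 2 * real k + 1) b t (1 - t))) = 0"
    and "k \<le> N"
  shows "e k = 0"
proof (rule powers_times_nonvanishing_independent[where k = k and N = N and c = e and q =
      "\<lambda>k t. (-1) ^ k * pochhammer (c + 1) k / fact k * hjac (N - k) (a + c + 2 * real k + 1) b t (1 - t)"])
  show "continuous_on UNIV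
     (\<lambda>t. (-1) ^ k * pochhammer (c + 1) k / fact k * hjac (N - k) (a + c + 2 * real k + 1) b t (1 - t))" for k
    unfolding hjac_def by (intro continuous_intros) auto
  show "(-1) ^ k * pochhammer (c + 1) k / fact k * hjac (N - k) (a + c + 2 * real k + 1) b 0 (1 - 0) \<noteq> 0" for k
    using ab by (simp add: hjac_0_left pochhammer_neq_0_if_pos)
  show "(\<Sum>k\<le>N. e k * (t ^ k * ((-1) ^ k * pochhammer (c + 1) k / fact k *
      hjac (N - k) (a + c + 2 * real k + 1) b t (1 - t)))) = 0" if "0 < t" "t < 1" for t
    using zero[OF that] by (simp add: hjac_0_right mult_ac)
qed fact

text \<open>Exchanging twice returns to the original tree, whose polynomials are linearly independent.\<close>

lemma swap_coeff_inverse: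
  assumes ab: "a > -1" "b > -1" "c > -1" and k: "k \<le> N"
  shows "(\<Sum>m\<le>N. swap_coeff N m k a b c * swap_coeff N k m a c b) = 1"
proof -
  define e where "e j = (\<Sum>m\<le>N. swap_coeff N k m a c b * swap_coeff N m j a b c) - (if j = k then 1 else 0)" for j
  define f where "f m x y z = hjac m a b x y * hjac (N - m) (a + b + 2 * real m + 1) c (x + y) z" for m x y z
  define g where "g m x y z = hjac m a c x z * hjac (N - m) (a + c + 2 * real m + 1) b (x + z) y" for m x y z
  have f: "f m x y z = (\<Sum>j\<le>N. swap_coeff N m j a b c * g j x y z)" if "m \<le> N" for m x y z
    unfolding f_def g_def by (rule hjac_tree_swap[OF ab that])
  have g: "g k x y z = (\<Sum>m\<le>N. swap_coeff N k m a c b * f m x y z)" for x y z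
    unfolding f_def g_def by (rule hjac_tree_swap[OF ab(1) ab(3) ab(2) k])
  have "(\<Sum>j\<le>N. e j * g j x y z) = 0" for x y z
  proof -
    have "g k x y z = (\<Sum>m\<le>N. \<Sum>j\<le>N. swap_coeff N k m a c b * swap_coeff N m j a b c * g j x y z)"
      by (subst g) (simp add: f sum_distrib_left mult_ac)
    also have "\<dots> = (\<Sum>j\<le>N. (\<Sum>m\<le>N. swap_coeff N k m a c b * swap_coeff N m j a b c) * g j x y z)"
      by (subst sum.swap) (simp add: sum_distrib_right)
    finally have "(\<Sum>j\<le>N. (\<Sum>m\<le>N. swap_coeff N k m a c b * swap_coeff N m j a b c) * g j x y z) - g k x y z = 0"
      by simp
    moreover have "(\<Sum>j\<le>N. (if j = k then 1 else 0) * g j x y z) = g k x y z"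
      using k by (simp add: if_distrib[where f = "\<lambda>u. u * _"] cong: if_cong)
    ultimately show ?thesis by (simp add: e_def left_diff_distrib sum_subtractf)
  qed
  from this[of t "1 - t" 0 for t] have "e k = 0"
    by (intro tree_independent[OF ab(1) ab(3) _ k, of e b]) (simp add: g_def)
  then show ?thesis by (simp add: e_def mult.commute)
qed

text \<open>The normalized coefficients \<open>swap_coeff N m k a b c * sqrt (H\<^sub>k / H\<^sub>m)\<close> form an orthogonal matrix, where
  \<open>H\<^sub>k\<close> and \<open>H\<^sub>m\<close> are the squared norms: by symmetry the inverse of this matrix is its transpose.\<close>

lemma swap_coeff_orthonormal:
  assumes ab: "a > -1" "b > -1" "c > -1" and k: "k \<le> N"
  shows "(\<Sum>m\<le>N. (swap_coeff N m k a b c)\<^sup>2 * tree_norm2 N k a c b / tree_norm2 N m a b c) = 1"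
proof -
  have "(swap_coeff N m k a b c)\<^sup>2 * tree_norm2 N k a c b / tree_norm2 N m a b c =
      swap_coeff N m k a b c * swap_coeff N k m a c b" if "m \<le> N" for m
    using swap_coeff_symmetric[OF ab that k] tree_norm2_pos[OF ab, of N m]
    by (simp add: power2_eq_square mult.assoc)
  then show ?thesis using swap_coeff_inverse[OF ab k] by simp
qed

section \<open>The connection coefficients of the transposition\<close>

text \<open>The polynomial of the tree \<open>((x y) z) w\<close>; the exponents \<open>a, b, c, d\<close> belong to \<open>x, y, z, w\<close>.\<close>

definition tree3 :: "real \<Rightarrow> real \<Rightarrow> real \<Rightarrow> real \<Rightarrow> nat \<Rightarrow> nat \<Rightarrow> nat \<Rightarrow> real \<Rightarrow> real \<Rightarrow> real \<Rightarrow> real \<Rightarrow> real" where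
  "tree3 a b c d m p q x y z w = hjac m a b x y * hjac p (a + b + 2 * real m + 1) c (x + y) z *
     hjac q (a + b + c + 2 * real m + 2 * real p + 2) d (x + y + z) w"

text \<open>The coefficients of the two exchanges \<open>((x y) w) z \<rightarrow> ((x w) y) z \<rightarrow> ((x w) z) y\<close>. The source has degrees
  \<open>y1, y2 - y1, n - y2\<close> and the target \<open>k, j, n - k - j\<close>. In the intermediate tree the degrees are
  \<open>k, y2 - k, n - y2\<close>, so it is the only one that contributes, and only if \<open>k \<le> y2\<close>.\<close>

definition swap_pair_coeff :: "nat \<Rightarrow> nat \<Rightarrow> nat \<Rightarrow> nat \<Rightarrow> nat \<Rightarrow> real \<Rightarrow> real \<Rightarrow> real \<Rightarrow> real \<Rightarrow> real" where
  "swap_pair_coeff n y1 y2 k j a b c d = (if k \<le> y2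
     then swap_coeff y2 y1 k a b d * swap_coeff (n - k) (y2 - k) j (a + d + 2 * real k + 1) b c else 0)"

text \<open>The exchange \<open>((x y) z) w \<rightarrow> ((x y) w) z\<close> followed by the two exchanges of \<open>swap_pair_coeff\<close>.\<close>

definition reverse_coeff :: "nat \<Rightarrow> nat \<Rightarrow> nat \<Rightarrow> nat \<Rightarrow> nat \<Rightarrow> real \<Rightarrow> real \<Rightarrow> real \<Rightarrow> real \<Rightarrow> real" where
  "reverse_coeff n m p k j a b c d = (\<Sum>l\<le>n - m. swap_coeff (n - m) p l (a + b + 2 * real m + 1) c d *
     swap_pair_coeff n m (m + l) k j a b c d)"

lemma tree_pair_swap:
  assumes ab: "a > -1" "b > -1" "c > -1" "d > -1" and y: "y1 \<le> y2" "y2 \<le> n"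
  shows "tree3 a b d c y1 (y2 - y1) (n - y2) x y w z = (\<Sum>k\<le>n. \<Sum>j\<le>n - k.
    swap_pair_coeff n y1 y2 k j a b c d * tree3 a d c b k j (n - k - j) x w z y)"
proof -
  define f where "f k j = swap_coeff y2 y1 k a b d * swap_coeff (n - k) (y2 - k) j (a + d + 2 * real k + 1) b c *
      tree3 a d c b k j (n - k - j) x w z y" for k j
  have "tree3 a b d c y1 (y2 - y1) (n - y2) x y w z =
      (hjac y1 a b x y * hjac (y2 - y1) (a + b + 2 * real y1 + 1) d (x + y) w) *
       hjac (n - y2) (a + b + d + 2 * real y2 + 2) c (x + y + w) z"
    using y by (simp add: tree3_def of_nat_diff algebra_simps)
  also have "\<dots> = (\<Sum>k\<le>y2. swap_coeff y2 y1 k a b d * hjac k a d x w *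
       (hjac (y2 - k) (a + d + 2 * real k + 1) b (x + w) y *
        hjac (n - y2) (a + b + d + 2 * real y2 + 2) c (x + y + w) z))"
    unfolding hjac_tree_swap[OF ab(1,2,4) y(1)] sum_distrib_right by (simp add: mult_ac)
  also have "\<dots> = (\<Sum>k\<le>y2. \<Sum>j\<le>n - k. f k j)"
  proof (intro sum.cong refl)
    fix k assume "k \<in> {..y2}"
    then have k: "k \<le> y2" by simp
    define B where "B = a + d + 2 * real k + 1"
    have B: "B > -1" using ab by (simp add: B_def)
    have le: "y2 - k \<le> n - k" using y by simp
    have "hjac (y2 - k) B b (x + w) y * hjac (n - y2) (a + b + d + 2 * real y2 + 2) c (x + y + w) z =
        hjac (y2 - k) B b (x + w) y * hjac (n - k - (y2 - k)) (B + b + 2 * real (y2 - k) + 1) c (x + w + y) z"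
      using k y by (simp add: B_def of_nat_diff algebra_simps)
    also have "\<dots> = (\<Sum>j\<le>n - k. swap_coeff (n - k) (y2 - k) j B b c * (hjac j B c (x + w) z *
        hjac (n - k - j) (B + c + 2 * real j + 1) b (x + w + z) y))"
      by (rule hjac_tree_swap[OF B ab(2,3) le])
    finally have *: "hjac (y2 - k) B b (x + w) y * hjac (n - y2) (a + b + d + 2 * real y2 + 2) c (x + y + w) z =
      (\<Sum>j\<le>n - k. swap_coeff (n - k) (y2 - k) j B b c * (hjac j B c (x + w) z *
        hjac (n - k - j) (B + c + 2 * real j + 1) b (x + w + z) y))" .
    have f: "f k j = swap_coeff y2 y1 k a b d * hjac k a d x w * (swap_coeff (n - k) (y2 - k) j B b c *
       (hjac j B c (x + w) z * hjac (n - k - j) (B + c + 2 * real j + 1) b (x + w + z) y))" for j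
    proof -
      have e: "a + d + c + 2 * real k + 2 * real j + 2 = B + c + 2 * real j + 1" by (simp add: B_def)
      show ?thesis unfolding f_def tree3_def e B_def[symmetric] by (simp add: mult_ac)
    qed
    show "swap_coeff y2 y1 k a b d * hjac k a d x w *
       (hjac (y2 - k) (a + d + 2 * real k + 1) b (x + w) y *
        hjac (n - y2) (a + b + d + 2 * real y2 + 2) c (x + y + w) z) = (\<Sum>j\<le>n - k. f k j)"
      unfolding f sum_distrib_left[symmetric] B_def[symmetric] * ..
  qed
  also have "\<dots> = (\<Sum>k\<le>n. if k \<le> y2 then \<Sum>j\<le>n - k. f k j else 0)"
    using y by (intro sum.mono_neutral_cong_left) auto
  also have "\<dots> = (\<Sum>k\<le>n. \<Sum>j\<le>n - k.
    swap_pair_coeff n y1 y2 k j a b c d * tree3 a d c b k j (n - k - j) x w z y)"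
    by (intro sum.cong refl) (simp add: swap_pair_coeff_def f_def)
  finally show ?thesis .
qed

lemma tree3_reverse:
  assumes ab: "a > -1" "b > -1" "c > -1" "d > -1" and n: "n = m + p + q"
  shows "tree3 a b c d m p q x y z w = (\<Sum>k\<le>n. \<Sum>j\<le>n - k.
    reverse_coeff n m p k j a b c d * tree3 a d c b k j (n - k - j) x w z y)"
proof -
  define A where "A = a + b + 2 * real m + 1"
  have A: "A > -1" using ab by (simp add: A_def)
  have p: "p \<le> n - m" by (simp add: n)
  have "tree3 a b c d m p q x y z w = hjac m a b x y *
     (hjac p A c (x + y) z * hjac (n - m - p) (A + c + 2 * real p + 1) d (x + y + z) w)"
    by (simp add: tree3_def A_def n algebra_simps)
  also have "\<dots> = (\<Sum>l\<le>n - m. swap_coeff (n - m) p l A c d *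
      (hjac m a b x y * (hjac l A d (x + y) w * hjac (n - m - l) (A + d + 2 * real l + 1) c (x + y + w) z)))"
    unfolding hjac_tree_swap[OF A ab(3,4) p] by (simp add: sum_distrib_left mult_ac)
  also have "\<dots> = (\<Sum>l\<le>n - m. swap_coeff (n - m) p l A c d *
      (\<Sum>k\<le>n. \<Sum>j\<le>n - k. swap_pair_coeff n m (m + l) k j a b c d * tree3 a d c b k j (n - k - j) x w z y))"
  proof (intro sum.cong refl)
    fix l assume "l \<in> {..n - m}"
    then have l: "m \<le> m + l" "m + l \<le> n" using n by auto
    have "hjac m a b x y * (hjac l A d (x + y) w * hjac (n - m - l) (A + d + 2 * real l + 1) c (x + y + w) z)
       = tree3 a b d c m (m + l - m) (n - (m + l)) x y w z"
      by (simp add: tree3_def A_def algebra_simps)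
    also note tree_pair_swap[OF ab l]
    finally show "swap_coeff (n - m) p l A c d * (hjac m a b x y *
        (hjac l A d (x + y) w * hjac (n - m - l) (A + d + 2 * real l + 1) c (x + y + w) z)) =
      swap_coeff (n - m) p l A c d * (\<Sum>k\<le>n. \<Sum>j\<le>n - k. swap_pair_coeff n m (m + l) k j a b c d * tree3 a d c b k j (n - k - j) x w z y)"
      by simp
  qed
  also have "\<dots> = (\<Sum>l\<le>n - m. \<Sum>k\<le>n. \<Sum>j\<le>n - k. swap_coeff (n - m) p l A c d * swap_pair_coeff n m (m + l) k j a b c d *
      tree3 a d c b k j (n - k - j) x w z y)"
    by (simp add: sum_distrib_left mult_ac)
  also have "\<dots> = (\<Sum>k\<le>n. \<Sum>j\<le>n - k. \<Sum>l\<le>n - m. swap_coeff (n - m) p l A c d * swap_pair_coeff n m (m + l) k j a b c d *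
      tree3 a d c b k j (n - k - j) x w z y)"
    by (subst sum.swap, rule sum.cong[OF refl], rule sum.swap)
  finally show ?thesis by (simp add: reverse_coeff_def A_def sum_distrib_right)
qed

lemma sum_triangle:
  "(\<Sum>k\<le>n. \<Sum>j\<le>n - k. f k j) = (\<Sum>s\<le>n. \<Sum>k\<le>s. f k (s - k))" for f :: "nat \<Rightarrow> nat \<Rightarrow> real"
proof -
  have "(\<Sum>k\<le>n. \<Sum>j\<le>n - k. f k j) = (\<Sum>(k, j)\<in>(SIGMA k:{..n}. {..n - k}). f k j)"
    by (rule sum.Sigma) auto
  also have "(SIGMA k:{..n}. {..n - k}) = {(k, j). k + j \<le> n}" by auto
  also have "(\<Sum>(k, j)\<in>{(k, j). k + j \<le> n}. f k j) = (\<Sum>s\<le>n. \<Sum>k\<le>s. f k (s - k))"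
    by (rule sum.triangle_reindex_eq)
  finally show ?thesis .
qed

text \<open>On the face \<open>y = 0\<close>, with \<open>x = r t\<close> and \<open>z = r (1 - t)\<close>, the polynomial with indices \<open>k, j\<close> vanishes in
  \<open>r\<close> to order exactly \<open>k + j\<close>, and its factor of that order vanishes in \<open>t\<close> to order exactly \<open>k\<close>.\<close>

lemma tree3_independent:
  assumes ab: "a > -1" "b > -1" "c > -1" and
    zero: "\<And>x y z w. 0 \<le> x \<Longrightarrow> 0 \<le> y \<Longrightarrow> 0 \<le> z \<Longrightarrow> 0 \<le> w \<Longrightarrow> x + y + z + w = 1 \<Longrightarrow>
       (\<Sum>k\<le>n. \<Sum>j\<le>n - k. e k j * tree3 a b c d k j (n - k - j) x y z w) = 0"
    and kj: "k + j \<le> n"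
  shows "e k j = 0"
proof -
  define h where "h s t = (\<Sum>k\<le>s. e k (s - k) * (hjac k a b t 0 *
      hjac (s - k) (a + b + 2 * real k + 1) c t (1 - t)))" for s t
  have "h s t = 0" if t: "0 < t" "t < 1" and s: "s \<le> n" for s t
  proof (rule powers_times_nonvanishing_independent[where N = n and c = "\<lambda>s. h s t" and k = s and
        q = "\<lambda>s r. hjac (n - s) (a + b + c + 2 * real s + 2) d r (1 - r)"])
    show "continuous_on UNIV (\<lambda>r. hjac (n - s) (a + b + c + 2 * real s + 2) d r (1 - r))" for s
      unfolding hjac_def by (intro continuous_intros)
    show "hjac (n - s) (a + b + c + 2 * real s + 2) d 0 (1 - 0) \<noteq> 0" for s
      using ab by (simp add: hjac_0_left pochhammer_neq_0_if_pos)
    show "(\<Sum>s\<le>n. h s t * (r ^ s * hjac (n - s) (a + b + c + 2 * real s + 2) d r (1 - r))) = 0"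
      if r: "0 < r" "r < 1" for r
    proof -
      have "0 = (\<Sum>k\<le>n. \<Sum>j\<le>n - k. e k j * tree3 a b c d k j (n - k - j) (r * t) 0 (r * (1 - t)) (1 - r))"
        using r t by (intro zero[symmetric]) (auto simp: algebra_simps)
      also have "\<dots> = (\<Sum>s\<le>n. \<Sum>k\<le>s. e k (s - k) * tree3 a b c d k (s - k) (n - k - (s - k)) (r * t) 0 (r * (1 - t)) (1 - r))"
        by (rule sum_triangle)
      also have "\<dots> = (\<Sum>s\<le>n. h s t * (r ^ s * hjac (n - s) (a + b + c + 2 * real s + 2) d r (1 - r)))"
      proof (intro sum.cong refl)
        fix s
        have *: "e k (s - k) * tree3 a b c d k (s - k) (n - k - (s - k)) (r * t) 0 (r * (1 - t)) (1 - r) =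
           e k (s - k) * (hjac k a b t 0 * hjac (s - k) (a + b + 2 * real k + 1) c t (1 - t)) *
           (r ^ s * hjac (n - s) (a + b + c + 2 * real s + 2) d r (1 - r))" if "k \<le> s" for k
        proof -
          have e1: "hjac k a b (r * t) 0 = r ^ k * hjac k a b t 0"
            using hjac_scale[of k a b r t 0] by simp
          have e2: "hjac (s - k) (a + b + 2 * real k + 1) c (r * t + 0) (r * (1 - t)) =
              r ^ (s - k) * hjac (s - k) (a + b + 2 * real k + 1) c t (1 - t)"
            using hjac_scale by simp
          have e3: "r * t + 0 + r * (1 - t) = r" by (simp add: algebra_simps)
          have e4: "a + b + c + 2 * real k + 2 * real (s - k) + 2 = a + b + c + 2 * real s + 2"
            using that by (simp add: of_nat_diff)
          have e5: "r ^ s = r ^ k * r ^ (s - k)" using that by (simp flip: power_add)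
          show ?thesis
            unfolding tree3_def e1 e2 e3 e4 e5 using that by simp
        qed
        show "(\<Sum>k\<le>s. e k (s - k) * tree3 a b c d k (s - k) (n - k - (s - k)) (r * t) 0 (r * (1 - t)) (1 - r)) =
          h s t * (r ^ s * hjac (n - s) (a + b + c + 2 * real s + 2) d r (1 - r))"
          unfolding h_def sum_distrib_right by (rule sum.cong[OF refl], rule *) simp
      qed
      finally show ?thesis by simp
    qed
  qed (use s in auto)
  then have "e k (k + j - k) = 0"
    using kj unfolding h_def
    by (intro tree_independent[where e = "\<lambda>k'. e k' (k + j - k')" and N = "k + j" and k = k, OF ab(1,2)]) auto
  then show ?thesis by simp
qed

lemma atLeastAtMost_3: "{1..3::nat} = {1, 2, 3}" "{Suc 0..3} = {1, 2, 3}" by auto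

text \<open>With the barycentric coordinate \<open>x\<^sub>4 = 1 - |x|\<close> the simplex polynomial belongs to the tree
  \<open>((4 3) 2) 1\<close>.\<close>

lemma simplex_jacobi_3:
  assumes \<kappa>: "\<forall>i\<in>{1..4}. \<kappa> i > -1" and x: "x \<in> simplex_dom 3"
  shows "simplex_jacobi 3 \<kappa> \<nu> x =
    tree3 (\<kappa> 4) (\<kappa> 3) (\<kappa> 2) (\<kappa> 1) (\<nu> 3) (\<nu> 2) (\<nu> 1) (1 - x 1 - x 2 - x 3) (x 3) (x 2) (x 1)"
proof -
  have k: "\<kappa> 1 > -1" "\<kappa> 2 > -1" "\<kappa> 3 > -1" "\<kappa> 4 > -1" using \<kappa> by auto
  have pos: "x 1 \<ge> 0" "x 2 \<ge> 0" "x 3 \<ge> 0" "x 1 + x 2 + x 3 \<le> 1"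
    using x by (auto simp: simplex_dom_def atLeastAtMost_3)
  have s: "{1..<1::nat} = {}" "{1..<2::nat} = {1}" "{1..<3::nat} = {1, 2}"
    "{2..4::nat} = {2, 3, 4}" "{3..4::nat} = {3, 4}" "{4..4::nat} = {4}"
    "{2..3::nat} = {2, 3}" "{3..3::nat} = {3}" "{4..3::nat} = {}"
    by auto
  have 1: "1 ^ \<nu> 1 * jacobi_poly (\<nu> 1) (\<kappa> 2 + (\<kappa> 3 + \<kappa> 4) + 2 * (real (\<nu> 2) + real (\<nu> 3)) + 2) (\<kappa> 1) (2 * x 1 / 1 - 1) =
     hjac (\<nu> 1) (\<kappa> 2 + (\<kappa> 3 + \<kappa> 4) + 2 * (real (\<nu> 2) + real (\<nu> 3)) + 2) (\<kappa> 1) (1 - x 1) (x 1)"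
    using k by (intro jacobi_poly_homogeneous) auto
  have 2: "(1 - x 1) ^ \<nu> 2 * jacobi_poly (\<nu> 2) (\<kappa> 3 + \<kappa> 4 + 2 * real (\<nu> 3) + 1) (\<kappa> 2) (2 * x 2 / (1 - x 1) - 1) =
     hjac (\<nu> 2) (\<kappa> 3 + \<kappa> 4 + 2 * real (\<nu> 3) + 1) (\<kappa> 2) (1 - x 1 - x 2) (x 2)"
    using k pos by (intro jacobi_poly_homogeneous) auto
  have 3: "(1 - (x 1 + x 2)) ^ \<nu> 3 * jacobi_poly (\<nu> 3) (\<kappa> 4) (\<kappa> 3) (2 * x 3 / (1 - (x 1 + x 2)) - 1) =
     hjac (\<nu> 3) (\<kappa> 4) (\<kappa> 3) (1 - (x 1 + x 2) - x 3) (x 3)"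
    using k pos by (intro jacobi_poly_homogeneous) auto
  have "simplex_jacobi 3 \<kappa> \<nu> x =
     (1 ^ \<nu> 1 * jacobi_poly (\<nu> 1) (\<kappa> 2 + (\<kappa> 3 + \<kappa> 4) + 2 * (real (\<nu> 2) + real (\<nu> 3)) + 2) (\<kappa> 1) (2 * x 1 / 1 - 1)) *
     ((1 - x 1) ^ \<nu> 2 * jacobi_poly (\<nu> 2) (\<kappa> 3 + \<kappa> 4 + 2 * real (\<nu> 3) + 1) (\<kappa> 2) (2 * x 2 / (1 - x 1) - 1)) *
     ((1 - (x 1 + x 2)) ^ \<nu> 3 * jacobi_poly (\<nu> 3) (\<kappa> 4) (\<kappa> 3) (2 * x 3 / (1 - (x 1 + x 2)) - 1))"
    unfolding simplex_jacobi_def atLeastAtMost_3 by (simp add: s numeral_eq_Suc add_ac)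
  then show ?thesis
    unfolding 1 2 3 tree3_def by (simp add: algebra_simps)
qed

definition multi_index_3 :: "nat \<Rightarrow> nat \<Rightarrow> nat \<Rightarrow> nat \<Rightarrow> nat" where
  "multi_index_3 n k j = (\<lambda>i\<in>{1..3}. if i = 1 then n - k - j else if i = 2 then j else k)"

lemma multi_index_3_simps [simp]:
  "multi_index_3 n k j 1 = n - k - j" "multi_index_3 n k j (Suc 0) = n - k - j"
  "multi_index_3 n k j 2 = j" "multi_index_3 n k j 3 = k"
  by (auto simp: multi_index_3_def)

lemma multi_indices_3:
  "multi_indices 3 n = {\<nu> \<in> {1..3} \<rightarrow>\<^sub>E UNIV. \<nu> 1 + \<nu> 2 + \<nu> 3 = n}"
  unfolding multi_indices_def by (simp add: atLeastAtMost_3 add_ac)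

lemma multi_index_3_in: "k + j \<le> n \<Longrightarrow> multi_index_3 n k j \<in> multi_indices 3 n"
  unfolding multi_indices_3 by (simp add: multi_index_3_def)

lemma multi_index_3_eq:
  assumes "\<mu> \<in> multi_indices 3 n"
  shows "multi_index_3 n (\<mu> 3) (\<mu> 2) = \<mu>"
proof
  fix i :: nat
  have \<mu>: "\<mu> \<in> {1..3} \<rightarrow>\<^sub>E UNIV" "\<mu> 1 + \<mu> 2 + \<mu> 3 = n"
    using assms by (simp_all only: multi_indices_3 mem_Collect_eq)
  consider "i = 1" | "i = 2" | "i = 3" | "i \<notin> {1..3}"
    unfolding atLeastAtMost_3 by blast
  then show "multi_index_3 n (\<mu> 3) (\<mu> 2) i = \<mu> i"
  proof cases
    case 4
    then show ?thesis using PiE_arb[OF \<mu>(1) 4] by (simp only: multi_index_3_def restrict_def if_False)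
  qed (use \<mu>(2) in auto)
qed

lemma sum_multi_indices_3:
  fixes f :: "(nat \<Rightarrow> nat) \<Rightarrow> real"
  shows "(\<Sum>\<mu>\<in>multi_indices 3 n. f \<mu>) = (\<Sum>k\<le>n. \<Sum>j\<le>n - k. f (multi_index_3 n k j))"
  unfolding sum.Sigma[OF finite_atMost ballI[OF finite_atMost]]
proof (rule sum.reindex_bij_witness[of _ "\<lambda>(k, j). multi_index_3 n k j" "\<lambda>\<mu>. (\<mu> 3, \<mu> 2)"])
  fix \<mu> assume \<mu>: "\<mu> \<in> multi_indices 3 n"
  then show "(\<mu> 3, \<mu> 2) \<in> (SIGMA k:{..n}. {..n - k})" by (auto simp: multi_indices_3)
  show "(case (\<mu> 3, \<mu> 2) of (k, j) \<Rightarrow> multi_index_3 n k j) = \<mu>"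
    and "(case (\<mu> 3, \<mu> 2) of (k, j) \<Rightarrow> f (multi_index_3 n k j)) = f \<mu>"
    using multi_index_3_eq[OF \<mu>] by auto
next
  fix kj assume "kj \<in> (SIGMA k:{..n}. {..n - k})"
  then show "(case kj of (k, j) \<Rightarrow> multi_index_3 n k j) \<in> multi_indices 3 n"
    by (auto intro: multi_index_3_in)
qed auto

abbreviation swap13 :: "nat \<Rightarrow> nat" where
  "swap13 \<equiv> Transposition.transpose 1 3"

lemma simplex_perm_13:
  assumes "x \<in> simplex_dom 3"
  shows "simplex_perm 3 swap13 x \<in> simplex_dom 3" "simplex_perm 3 swap13 x 1 = x 3"
    "simplex_perm 3 swap13 x 2 = x 2" "simplex_perm 3 swap13 x 3 = x 1"
  using assms by (auto simp: simplex_perm_def simplex_dom_def atLeastAtMost_3 Transposition.transpose_def)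

text \<open>The transposition turns the tree \<open>((4 3) 2) 1\<close> into \<open>((4 1) 2) 3\<close>, so \<open>tree3_reverse\<close> gives the expansion
  and \<open>tree3_independent\<close> its uniqueness.\<close>

lemma conn_coeff_13:
  assumes \<kappa>: "\<forall>i\<in>{1..4}. \<kappa> i > -1" and \<nu>: "\<nu> \<in> multi_indices 3 n" and \<mu>: "\<mu> \<in> multi_indices 3 n"
  shows "conn_coeff 3 swap13 \<kappa> \<nu> \<mu> =
    reverse_coeff n (\<nu> 3) (\<nu> 2) (\<mu> 3) (\<mu> 2) (\<kappa> 4) (\<kappa> 1) (\<kappa> 2) (\<kappa> 3)"
proof -
  define c where "c \<mu> = (if \<mu> \<in> multi_indices 3 n
     then reverse_coeff n (\<nu> 3) (\<nu> 2) (\<mu> 3) (\<mu> 2) (\<kappa> 4) (\<kappa> 1) (\<kappa> 2) (\<kappa> 3) else 0)" for \<mu>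
  have k: "\<kappa> 1 > -1" "\<kappa> 2 > -1" "\<kappa> 3 > -1" "\<kappa> 4 > -1" using \<kappa> by auto
  have n: "(\<Sum>i=1..3. \<nu> i) = n" using \<nu> by (simp add: multi_indices_def)
  have n': "n = \<nu> 3 + \<nu> 2 + \<nu> 1" using \<nu> by (simp add: multi_indices_3)
  have \<kappa>': "\<forall>i\<in>{1..4}. (\<kappa> \<circ> swap13) i > -1" using \<kappa> by (auto simp: Transposition.transpose_def)
  have sum_eq: "(\<Sum>\<mu>\<in>multi_indices 3 n. e \<mu> * simplex_jacobi 3 \<kappa> \<mu> x) =
      (\<Sum>k\<le>n. \<Sum>j\<le>n - k. e (multi_index_3 n k j) *
       tree3 (\<kappa> 4) (\<kappa> 3) (\<kappa> 2) (\<kappa> 1) k j (n - k - j) (1 - x 1 - x 2 - x 3) (x 3) (x 2) (x 1))"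
    if "x \<in> simplex_dom 3" for e x
    unfolding sum_multi_indices_3 by (simp add: simplex_jacobi_3[OF \<kappa> that])
  have expansion: "simplex_jacobi 3 (\<kappa> \<circ> swap13) \<nu> (simplex_perm 3 swap13 x) =
     (\<Sum>\<mu>\<in>multi_indices 3 n. c \<mu> * simplex_jacobi 3 \<kappa> \<mu> x)" if x: "x \<in> simplex_dom 3" for x
  proof -
    have "simplex_jacobi 3 (\<kappa> \<circ> swap13) \<nu> (simplex_perm 3 swap13 x) =
      tree3 (\<kappa> 4) (\<kappa> 1) (\<kappa> 2) (\<kappa> 3) (\<nu> 3) (\<nu> 2) (\<nu> 1) (1 - x 1 - x 2 - x 3) (x 1) (x 2) (x 3)"
    proof -
      have t: "(\<kappa> \<circ> swap13) 1 = \<kappa> 3" "(\<kappa> \<circ> swap13) 2 = \<kappa> 2" "(\<kappa> \<circ> swap13) 3 = \<kappa> 1" "(\<kappa> \<circ> swap13) 4 = \<kappa> 4"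
        by (auto simp: Transposition.transpose_def)
      have e: "1 - x 3 - x 2 - x 1 = 1 - x 1 - x 2 - x 3" by simp
      show ?thesis
        unfolding simplex_jacobi_3[OF \<kappa>' simplex_perm_13(1)[OF x]] t simplex_perm_13(2-4)[OF x] e ..
    qed
    also have "\<dots> = (\<Sum>k\<le>n. \<Sum>j\<le>n - k. reverse_coeff n (\<nu> 3) (\<nu> 2) k j (\<kappa> 4) (\<kappa> 1) (\<kappa> 2) (\<kappa> 3) *
       tree3 (\<kappa> 4) (\<kappa> 3) (\<kappa> 2) (\<kappa> 1) k j (n - k - j) (1 - x 1 - x 2 - x 3) (x 3) (x 2) (x 1))"
      using k by (intro tree3_reverse n') auto
    also have "\<dots> = (\<Sum>\<mu>\<in>multi_indices 3 n. c \<mu> * simplex_jacobi 3 \<kappa> \<mu> x)"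
      unfolding sum_eq[OF x] by (intro sum.cong refl) (simp add: c_def multi_index_3_in)
    finally show ?thesis .
  qed
  have "conn_coeff 3 swap13 \<kappa> \<nu> = c"
    unfolding conn_coeff_def n
  proof (rule the_equality)
    show "(\<forall>\<mu>. \<mu> \<notin> multi_indices 3 n \<longrightarrow> c \<mu> = 0) \<and> (\<forall>x\<in>simplex_dom 3.
        simplex_jacobi 3 (\<kappa> \<circ> swap13) \<nu> (simplex_perm 3 swap13 x) =
        (\<Sum>\<mu>\<in>multi_indices 3 n. c \<mu> * simplex_jacobi 3 \<kappa> \<mu> x))"
      using expansion by (auto simp: c_def)
  next
    fix c'
    assume c': "(\<forall>\<mu>. \<mu> \<notin> multi_indices 3 n \<longrightarrow> c' \<mu> = 0) \<and> (\<forall>x\<in>simplex_dom 3.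
        simplex_jacobi 3 (\<kappa> \<circ> swap13) \<nu> (simplex_perm 3 swap13 x) =
        (\<Sum>\<mu>\<in>multi_indices 3 n. c' \<mu> * simplex_jacobi 3 \<kappa> \<mu> x))"
    define e where "e k j = c' (multi_index_3 n k j) - c (multi_index_3 n k j)" for k j
    have "(\<Sum>k\<le>n. \<Sum>j\<le>n - k. e k j * tree3 (\<kappa> 4) (\<kappa> 3) (\<kappa> 2) (\<kappa> 1) k j (n - k - j) x y z w) = 0"
      if pos: "0 \<le> x" "0 \<le> y" "0 \<le> z" "0 \<le> w" "x + y + z + w = 1" for x y z w
    proof -
      define v where "v = (\<lambda>i\<in>{1..3::nat}. if i = 1 then w else if i = 2 then z else y)"
      have v: "v 1 = w" "v 2 = z" "v 3 = y" by (auto simp: v_def)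
      have dom: "v \<in> simplex_dom 3"
        using pos by (auto simp: simplex_dom_def v_def atLeastAtMost_3)
      have x: "1 - w - z - y = x" using pos(5) by linarith
      have "(\<Sum>\<mu>\<in>multi_indices 3 n. c' \<mu> * simplex_jacobi 3 \<kappa> \<mu> v) =
          (\<Sum>\<mu>\<in>multi_indices 3 n. c \<mu> * simplex_jacobi 3 \<kappa> \<mu> v)"
        using c' expansion[OF dom] dom by simp
      then show ?thesis
        unfolding sum_eq[OF dom] e_def left_diff_distrib sum_subtractf v x by simp
    qed
    then have e: "e k j = 0" if "k + j \<le> n" for k j
      using tree3_independent[where a = "\<kappa> 4" and b = "\<kappa> 3" and c = "\<kappa> 2" and d = "\<kappa> 1" and e = e, OF _ _ _ _ that] k
      by blast
    show "c' = c"
    proof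
      fix \<mu>
      show "c' \<mu> = c \<mu>"
      proof (cases "\<mu> \<in> multi_indices 3 n")
        case True
        then have "\<mu> 3 + \<mu> 2 \<le> n" by (auto simp: multi_indices_3)
        from e[OF this] show ?thesis by (simp add: e_def multi_index_3_eq[OF True])
      next
        case False
        then show ?thesis using c' by (simp add: c_def)
      qed
    qed
  qed
  then show ?thesis using \<mu> by (simp add: c_def)
qed

section \<open>Norms on the simplex\<close>

lemma beta_moment:
  assumes "a > -1" "b > -1"
  shows "((\<lambda>t. t ^ j * (1 - t) ^ k * (t powr b * (1 - t) powr a)) has_integral
    Gamma (b + 1) * pochhammer (b + 1) j * Gamma (a + 1 + real k) /
    (Gamma (a + b + 2 + real k) * pochhammer (a + b + 2 + real k) j)) {0..1}"
proof -
  have pw: "t ^ j * t powr b = t powr (b + real j)" if "t \<ge> 0" for t b :: real and j :: nat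
    using that by (cases "t = 0") (auto simp: powr_add powr_realpow)
  have "Beta (b + real j + 1) (a + real k + 1) = Gamma (b + 1) * pochhammer (b + 1) j * Gamma (a + 1 + real k) /
    (Gamma (a + b + 2 + real k) * pochhammer (a + b + 2 + real k) j)"
    using Gamma_plus_nat[of "b + 1" j] Gamma_plus_nat[of "a + b + 2 + real k" j] assms
    by (simp add: Beta_def add_ac mult_ac)
  moreover have "((\<lambda>t. t powr (b + real j + 1 - 1) * (1 - t) powr (a + real k + 1 - 1)) has_integral
      Beta (b + real j + 1) (a + real k + 1)) {0..1}"
    using assms by (intro has_integral_Beta_real) auto
  moreover have "t ^ j * (1 - t) ^ k * (t powr b * (1 - t) powr a) =
      t powr (b + real j + 1 - 1) * (1 - t) powr (a + real k + 1 - 1)" if "t \<in> {0..1}" for t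
  proof -
    have "t ^ j * (1 - t) ^ k * (t powr b * (1 - t) powr a) =
        (t ^ j * t powr b) * ((1 - t) ^ k * (1 - t) powr a)"
      by (simp add: mult_ac)
    also have "\<dots> = t powr (b + real j) * (1 - t) powr (a + real k)"
      using that by (simp only: pw atLeastAtMost_iff diff_ge_0_iff_ge)
    finally show ?thesis by simp
  qed
  ultimately show ?thesis
    by (subst has_integral_cong) auto
qed

text \<open>Expanded in powers of \<open>t\<close>, the integral becomes a Chu--Vandermonde sum with value
  \<open>(k + 1 - n)\<^sub>n\<close> up to constants, which vanishes for \<open>k < n\<close>.\<close>

lemma hjac_moment:
  assumes ab: "a > -1" "b > -1" and k: "k \<le> n"
  shows "((\<lambda>t. hjac n a b (1 - t) t * (1 - t) ^ k * (t powr b * (1 - t) powr a)) has_integral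
    (if k = n then (-1) ^ n * Gamma (a + 1 + real n) * Gamma (b + 1 + real n) / Gamma (2 * real n + a + b + 2) else 0)) {0..1}"
proof -
  define c where "c j = pochhammer (- real n) j * pochhammer (real n + a + b + 1) j /
      (pochhammer (b + 1) j * fact j)" for j
  define G where "G = (-1) ^ n * pochhammer (b + 1) n / fact n"
  have h: "hjac n a b (1 - t) t = G * (\<Sum>j\<le>n. c j * t ^ j)" for t
    using ab by (subst hjac_swap) (simp add: hjac_eq_hypergeometric G_def c_def add_ac)
  have "((\<lambda>t. \<Sum>j\<le>n. G * c j * (t ^ j * (1 - t) ^ k * (t powr b * (1 - t) powr a))) has_integral
     (\<Sum>j\<le>n. G * c j * (Gamma (b + 1) * pochhammer (b + 1) j * Gamma (a + 1 + real k) /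
    (Gamma (a + b + 2 + real k) * pochhammer (a + b + 2 + real k) j)))) {0..1}"
    by (intro has_integral_sum has_integral_mult_right beta_moment ab) auto
  moreover have "(\<Sum>j\<le>n. G * c j * (t ^ j * (1 - t) ^ k * (t powr b * (1 - t) powr a))) =
      hjac n a b (1 - t) t * (1 - t) ^ k * (t powr b * (1 - t) powr a)" for t
    by (simp add: h sum_distrib_left sum_distrib_right mult_ac)
  moreover have "(\<Sum>j\<le>n. G * c j * (Gamma (b + 1) * pochhammer (b + 1) j * Gamma (a + 1 + real k) /
    (Gamma (a + b + 2 + real k) * pochhammer (a + b + 2 + real k) j))) =
    (if k = n then (-1) ^ n * Gamma (a + 1 + real n) * Gamma (b + 1 + real n) / Gamma (2 * real n + a + b + 2) else 0)"
    (is "?S = _")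
  proof -
    define X where "X = a + b + 2 + real k"
    have X: "X > 0" using ab by (simp add: X_def)
    have "?S = (\<Sum>j\<le>n. G * Gamma (b + 1) * Gamma (a + 1 + real k) / Gamma X *
       (pochhammer (- real n) j * pochhammer (real n + a + b + 1) j / (pochhammer X j * fact j)))"
      using pochhammer_neq_0_if_pos[of "b + 1"] ab
      by (intro sum.cong refl) (simp add: c_def X_def mult_ac)
    also have "\<dots> = G * Gamma (b + 1) * Gamma (a + 1 + real k) / Gamma X *
       (pochhammer (X - (real n + a + b + 1)) n / pochhammer X n)"
      unfolding sum_distrib_left[symmetric]
      by (subst chu_vandermonde) (use X in \<open>auto simp: pochhammer_neq_0_if_pos\<close>)
    also have "X - (real n + a + b + 1) = 1 + real k - real n" by (simp add: X_def)
    finally have S: "?S = G * Gamma (b + 1) * Gamma (a + 1 + real k) / Gamma X *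
       (pochhammer (1 + real k - real n) n / pochhammer X n)" .
    show ?thesis
    proof (cases "k = n")
      case True
      have "Gamma (2 * real n + a + b + 2) = pochhammer X n * Gamma X"
        using Gamma_plus_nat[OF X, of n] True by (simp add: X_def add_ac)
      moreover have "Gamma (b + 1 + real n) = pochhammer (b + 1) n * Gamma (b + 1)"
        using ab by (intro Gamma_plus_nat) auto
      moreover have "pochhammer (1 + real k - real n) n = fact n" using True by (simp add: pochhammer_fact)
      ultimately show ?thesis unfolding S using True by (simp add: G_def mult_ac)
    next
      case False
      then have e: "1 + real k - real n = - real (n - 1 - k)" and lt: "n - 1 - k < n"
        using k by (auto simp: of_nat_diff)
      have z: "pochhammer (1 + real k - real n) n = 0"
        unfolding e by (rule pochhammer_of_nat_eq_0_lemma[OF lt])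
      show ?thesis unfolding S z using False by simp
    qed
  qed
  ultimately show ?thesis by simp
qed

text \<open>Only the power \<open>(1 - t)\<^sup>n\<close> of one of the two factors contributes, by \<open>hjac_moment\<close>.\<close>

lemma hjac_norm_integral:
  assumes ab: "a > -1" "b > -1"
  shows "((\<lambda>t. (hjac n a b (1 - t) t)\<^sup>2 * (t powr b * (1 - t) powr a)) has_integral jac_norm2 n a b) {0..1}"
proof -
  define c where "c k = pochhammer (a + 1) n / fact n * (pochhammer (- real n) k * pochhammer (real n + a + b + 1) k /
      (pochhammer (a + 1) k * fact k))" for k
  define I where "I k = (if k = n then (-1) ^ n * Gamma (a + 1 + real n) * Gamma (b + 1 + real n) / Gamma (2 * real n + a + b + 2) else 0)" for k
  have h: "hjac n a b (1 - t) t = (\<Sum>k\<le>n. c k * (1 - t) ^ k)" for t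
    using ab by (simp add: hjac_eq_hypergeometric c_def sum_distrib_left mult_ac)
  have "((\<lambda>t. \<Sum>k\<le>n. c k * (hjac n a b (1 - t) t * (1 - t) ^ k * (t powr b * (1 - t) powr a))) has_integral
     (\<Sum>k\<le>n. c k * I k)) {0..1}"
    unfolding I_def by (intro has_integral_sum has_integral_mult_right hjac_moment ab) auto
  moreover have "(\<Sum>k\<le>n. c k * (hjac n a b (1 - t) t * (1 - t) ^ k * (t powr b * (1 - t) powr a))) =
     (hjac n a b (1 - t) t)\<^sup>2 * (t powr b * (1 - t) powr a)" for t
    unfolding power2_eq_square by (subst (3) h) (simp add: sum_distrib_left sum_distrib_right mult_ac)
  moreover have "(\<Sum>k\<le>n. c k * I k) = jac_norm2 n a b"
  proof -
    have "(\<Sum>k\<le>n. c k * I k) = c n * I n"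
      by (subst sum.mono_neutral_right[of _ "{n}"]) (auto simp: I_def)
    also have "c n = (-1) ^ n * pochhammer (real n + a + b + 1) n / fact n"
      using ab by (simp add: c_def pochhammer_neg_of_nat pochhammer_neq_0_if_pos)
    finally show ?thesis by (simp add: I_def jac_norm2_def flip: power_mult_distrib)
  qed
  ultimately show ?thesis by simp
qed

lemma hjac_measurable [measurable]:
  assumes [measurable]: "f \<in> borel_measurable M" "g \<in> borel_measurable M"
  shows "(\<lambda>x. hjac n a b (f x) (g x)) \<in> borel_measurable M"
  unfolding hjac_def by measurable

text \<open>The weight left after the integration is again a power of \<open>s\<close>, with the exponent that the next
  factor in the tree has as its parameter. This makes the integral over the simplex iterate.\<close>

lemma hjac_norm_nn_integral:
  assumes ab: "a > -1" "b > -1"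
  shows "(\<integral>\<^sup>+x. ennreal (indicator {0..s} x * ((hjac n a b (s - x) x)\<^sup>2 * (x powr b * (s - x) powr a))) \<partial>lborel) =
    ennreal (indicator {0..} s * (s powr (2 * real n + a + b + 1) * jac_norm2 n a b))"
proof -
  consider "s < 0" | "s = 0" | "s > 0" by linarith
  then show ?thesis
  proof cases
    case 1
    then show ?thesis by simp
  next
    case 2
    then have z: "indicator {0..s} x * ((hjac n a b (s - x) x)\<^sup>2 * (x powr b * (s - x) powr a)) = 0" for x
      by (cases "x = 0") (auto simp: indicator_def)
    show ?thesis unfolding z using 2 by simp
  next
    case 3
    let ?f = "\<lambda>t. (hjac n a b (1 - t) t)\<^sup>2 * (t powr b * (1 - t) powr a)"
    have I: "(\<integral>\<^sup>+t. ennreal (?f t) * indicator {0..1} t \<partial>lborel) = ennreal (jac_norm2 n a b)"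
      by (rule nn_integral_has_integral_lebesgue'[OF _ hjac_norm_integral[OF ab]]) simp
    have "(\<integral>\<^sup>+x. ennreal (indicator {0..s} x * ((hjac n a b (s - x) x)\<^sup>2 * (x powr b * (s - x) powr a))) \<partial>lborel) =
      ennreal \<bar>s\<bar> * (\<integral>\<^sup>+t. ennreal (indicator {0..s} (0 + s * t) * ((hjac n a b (s - (0 + s * t)) (0 + s * t))\<^sup>2 *
        ((0 + s * t) powr b * (s - (0 + s * t)) powr a))) \<partial>lborel)"
      using 3 by (intro nn_integral_real_affine) auto
    also have "(\<integral>\<^sup>+t. ennreal (indicator {0..s} (0 + s * t) * ((hjac n a b (s - (0 + s * t)) (0 + s * t))\<^sup>2 *
        ((0 + s * t) powr b * (s - (0 + s * t)) powr a))) \<partial>lborel) =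
      (\<integral>\<^sup>+t. ennreal (s ^ (2 * n) * (s powr b * s powr a)) * (ennreal (?f t) * indicator {0..1} t) \<partial>lborel)"
    proof (rule nn_integral_cong)
      fix t :: real
      show "ennreal (indicator {0..s} (0 + s * t) * ((hjac n a b (s - (0 + s * t)) (0 + s * t))\<^sup>2 *
        ((0 + s * t) powr b * (s - (0 + s * t)) powr a))) =
        ennreal (s ^ (2 * n) * (s powr b * s powr a)) * (ennreal (?f t) * indicator {0..1} t)"
      proof (cases "t \<in> {0..1}")
        case True
        have e: "0 + s * t = s * t" "s - s * t = s * (1 - t)" by (simp_all add: algebra_simps)
        have "(hjac n a b (s * (1 - t)) (s * t))\<^sup>2 * ((s * t) powr b * (s * (1 - t)) powr a) =
          s ^ (2 * n) * (s powr b * s powr a) * ?f t"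
          using 3 True by (simp add: hjac_scale powr_mult power_mult_distrib power_mult mult_ac power2_eq_square)
        moreover have "s * t \<in> {0..s}" using 3 True by (auto simp: mult_left_le)
        moreover have "ennreal (s ^ (2 * n) * (s powr b * s powr a)) * ennreal (?f t) =
            ennreal (s ^ (2 * n) * (s powr b * s powr a) * ?f t)"
          using 3 by (intro ennreal_mult[symmetric]) auto
        ultimately show ?thesis
          using True unfolding e by (simp only: indicator_simps(1) mult_1_left mult_1_right)
      next
        case False
        then have "0 + s * t \<notin> {0..s}" using 3
          by (auto simp: zero_le_mult_iff mult_le_cancel_left1)
        then show ?thesis
          using False by (simp only: indicator_simps(2) not_False_eq_True mult_zero_left mult_zero_right ennreal_0)
      qed
    qed
    also have "\<dots> = ennreal (s ^ (2 * n) * (s powr b * s powr a)) * ennreal (jac_norm2 n a b)"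
    proof -
      have m: "(\<lambda>t. ennreal (?f t) * indicator {0..1} t) \<in> borel_measurable lborel" by measurable
      show ?thesis by (simp only: nn_integral_cmult[OF m] I)
    qed
    also have "ennreal \<bar>s\<bar> * \<dots> = ennreal (s * (s ^ (2 * n) * (s powr b * s powr a) * jac_norm2 n a b))"
    proof -
      have "ennreal \<bar>s\<bar> * (ennreal u * ennreal v) = ennreal (s * (u * v))" if "u \<ge> 0" "v \<ge> 0" for u v
        using 3 that by (simp add: ennreal_mult)
      then show ?thesis using 3 jac_norm2_pos[OF ab, of n] by (simp add: less_imp_le)
    qed
    also have "s * (s ^ (2 * n) * (s powr b * s powr a) * jac_norm2 n a b) =
        s powr (2 * real n + a + b + 1) * jac_norm2 n a b"
    proof -
      have "s powr (2 * real n + a + b + 1) = s powr real (2 * n) * s powr a * s powr b * s"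
        using 3 by (simp add: powr_add)
      then show ?thesis unfolding powr_realpow[OF 3] by (simp add: mult_ac)
    qed
    finally show ?thesis using 3 by simp
  qed
qed

text \<open>Measurability of the inner integrals is assumed rather than derived, because they are known in
  closed form where the lemma is applied.\<close>

lemma nn_integral_PiM_3:
  assumes G: "(\<lambda>x. G (x 1) (x 2) (x 3)) \<in> borel_measurable (\<Pi>\<^sub>M i\<in>{1..3::nat}. lborel :: real measure)"
    and G2: "(\<lambda>x. \<integral>\<^sup>+z. G (x 1) (x 2) z \<partial>lborel) \<in> borel_measurable (\<Pi>\<^sub>M i\<in>{1,2::nat}. lborel :: real measure)"
    and G1: "(\<lambda>x. \<integral>\<^sup>+y. \<integral>\<^sup>+z. G x y z \<partial>lborel \<partial>lborel) \<in> borel_measurable lborel"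
  shows "(\<integral>\<^sup>+x. G (x 1) (x 2) (x 3) \<partial>(\<Pi>\<^sub>M i\<in>{1..3::nat}. lborel)) =
    (\<integral>\<^sup>+x. \<integral>\<^sup>+y. \<integral>\<^sup>+z. G x y z \<partial>lborel \<partial>lborel \<partial>lborel)"
proof -
  interpret product_sigma_finite "\<lambda>_::nat. lborel :: real measure" by standard
  have e3: "{1..3::nat} = insert 3 {1, 2}" by auto
  have e2: "{1, 2::nat} = insert 2 {1}" by auto
  have "(\<integral>\<^sup>+x. G (x 1) (x 2) (x 3) \<partial>(\<Pi>\<^sub>M i\<in>{1..3::nat}. lborel)) =
     (\<integral>\<^sup>+x. \<integral>\<^sup>+z. G (x 1) (x 2) z \<partial>lborel \<partial>(\<Pi>\<^sub>M i\<in>{1,2::nat}. lborel))"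
    using product_nn_integral_insert[OF _ _ G[unfolded e3]] unfolding e3 by simp
  also have "\<dots> = (\<integral>\<^sup>+x. \<integral>\<^sup>+y. \<integral>\<^sup>+z. G (x 1) y z \<partial>lborel \<partial>lborel \<partial>(\<Pi>\<^sub>M i\<in>{1::nat}. lborel))"
    using product_nn_integral_insert[OF _ _ G2[unfolded e2]] unfolding e2 by simp
  also have "\<dots> = (\<integral>\<^sup>+x. \<integral>\<^sup>+y. \<integral>\<^sup>+z. G x y z \<partial>lborel \<partial>lborel \<partial>lborel)"
    by (rule product_nn_integral_singleton[OF G1])
  finally show ?thesis .
qed

lemma indicator_atLeastAtMost_eq_if:
  "indicator {l..u} z = (if l \<le> z \<and> z \<le> u then 1 else 0 :: real)" for l u z :: real
  by (simp add: indicator_def)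

lemma measurable_of_coordinates_3:
  assumes "(\<lambda>p. g (fst p) (fst (snd p)) (snd (snd p))) \<in> borel_measurable (borel \<Otimes>\<^sub>M borel \<Otimes>\<^sub>M borel)"
  shows "(\<lambda>x. g (x 1) (x 2) (x 3)) \<in> borel_measurable (\<Pi>\<^sub>M i\<in>{1..3::nat}. lborel :: real measure)"
proof -
  have c: "(\<lambda>x. x i) \<in> (\<Pi>\<^sub>M i\<in>{1..3::nat}. lborel :: real measure) \<rightarrow>\<^sub>M borel" if "i \<in> {1..3}" for i
    using measurable_component_singleton[OF that, of "\<lambda>_. lborel :: real measure"] by simp
  have "(\<lambda>x. (x 1, x 2, x 3)) \<in> (\<Pi>\<^sub>M i\<in>{1..3::nat}. lborel :: real measure) \<rightarrow>\<^sub>M borel \<Otimes>\<^sub>M borel \<Otimes>\<^sub>M borel"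
    by (intro measurable_Pair c) auto
  from measurable_compose[OF this assms] show ?thesis by simp
qed

lemma measurable_of_coordinates_2:
  assumes "(\<lambda>p. g (fst p) (snd p)) \<in> borel_measurable (borel \<Otimes>\<^sub>M borel)"
  shows "(\<lambda>x. g (x 1) (x 2)) \<in> borel_measurable (\<Pi>\<^sub>M i\<in>{1, 2::nat}. lborel :: real measure)"
proof -
  have c: "(\<lambda>x. x i) \<in> (\<Pi>\<^sub>M i\<in>{1, 2::nat}. lborel :: real measure) \<rightarrow>\<^sub>M borel" if "i \<in> {1, 2}" for i
    using measurable_component_singleton[OF that, of "\<lambda>_. lborel :: real measure"] by simp
  have "(\<lambda>x. (x 1, x 2)) \<in> (\<Pi>\<^sub>M i\<in>{1, 2::nat}. lborel :: real measure) \<rightarrow>\<^sub>M borel \<Otimes>\<^sub>M borel"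
    by (intro measurable_Pair c) auto
  from measurable_compose[OF this assms] show ?thesis by simp
qed

definition tree3_norm2 :: "nat \<Rightarrow> nat \<Rightarrow> nat \<Rightarrow> real \<Rightarrow> real \<Rightarrow> real \<Rightarrow> real \<Rightarrow> real" where
  "tree3_norm2 m p q a b c d = jac_norm2 m a b * jac_norm2 p (a + b + 2 * real m + 1) c *
     jac_norm2 q (a + b + c + 2 * real m + 2 * real p + 2) d"

text \<open>The indicators describe the simplex as an iterated domain; integrating over \<open>x\<^sub>3\<close>, \<open>x\<^sub>2\<close> and \<open>x\<^sub>1\<close> in
  this order removes the factors of the tree from the inside to the outside.\<close>

lemma tree3_norm_integral:
  assumes ab: "a > -1" "b > -1" "c > -1" "d > -1"
  shows "(\<integral>\<^sup>+v. ennreal (indicator {0..1} (v 1) * indicator {0..1 - v 1} (v 2) * indicator {0..1 - v 1 - v 2} (v 3) *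
     ((tree3 a b c d m p q (1 - v 1 - v 2 - v 3) (v 3) (v 2) (v 1))\<^sup>2 *
      (v 1 powr d * v 2 powr c * v 3 powr b * (1 - v 1 - v 2 - v 3) powr a))) \<partial>(\<Pi>\<^sub>M i\<in>{1..3::nat}. lborel)) =
    ennreal (tree3_norm2 m p q a b c d)"
proof -
  define A where "A = a + b + 2 * real m + 1"
  define B where "B = a + b + c + 2 * real m + 2 * real p + 2"
  have A: "A > -1" and B: "B > -1" using ab by (simp_all add: A_def B_def)
  define f1 where "f1 w = indicator {0..1} w * ((hjac q B d (1 - w) w)\<^sup>2 * w powr d)" for w :: real
  define f2 where "f2 w z = indicator {0..1 - w} z * ((hjac p A c (1 - w - z) z)\<^sup>2 * z powr c)" for w z :: real
  define f3 where "f3 w z y = indicator {0..1 - w - z} y * ((hjac m a b (1 - w - z - y) y)\<^sup>2 *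
     (y powr b * (1 - w - z - y) powr a))" for w z y :: real
  define G where "G w z y = ennreal (f1 w * f2 w z) * ennreal (f3 w z y)" for w z y
  have nn: "f1 w \<ge> 0" "f2 w z \<ge> 0" "f3 w z y \<ge> 0" for w z y
    by (simp_all add: f1_def f2_def f3_def)
  have G3: "(\<integral>\<^sup>+y. G w z y \<partial>lborel) = ennreal (f1 w) * ennreal (jac_norm2 m a b *
     (indicator {0..1 - w} z * ((hjac p A c (1 - w - z) z)\<^sup>2 * (z powr c * (1 - w - z) powr A))))" for w z
  proof -
    have "(\<integral>\<^sup>+y. G w z y \<partial>lborel) = ennreal (f1 w * f2 w z) * (\<integral>\<^sup>+y. ennreal (f3 w z y) \<partial>lborel)"
      unfolding G_def by (subst nn_integral_cmult) (auto simp: f3_def)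
    also have "(\<integral>\<^sup>+y. ennreal (f3 w z y) \<partial>lborel) =
        ennreal (indicator {0..} (1 - w - z) * ((1 - w - z) powr A * jac_norm2 m a b))"
      unfolding f3_def using hjac_norm_nn_integral[OF ab(1,2), of "1 - w - z" m] by (simp add: A_def add_ac)
    also have "ennreal (f1 w * f2 w z) * \<dots> = ennreal (f1 w * f2 w z * (indicator {0..} (1 - w - z) * ((1 - w - z) powr A * jac_norm2 m a b)))"
      using nn jac_norm2_pos[OF ab(1,2), of m] by (subst ennreal_mult) (auto simp: less_imp_le)
    also have "f1 w * f2 w z * (indicator {0..} (1 - w - z) * ((1 - w - z) powr A * jac_norm2 m a b)) =
       f1 w * (jac_norm2 m a b * (indicator {0..1 - w} z * ((hjac p A c (1 - w - z) z)\<^sup>2 * (z powr c * (1 - w - z) powr A))))"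
      by (auto simp: f2_def indicator_def)
    also have "ennreal \<dots> = ennreal (f1 w) * ennreal (jac_norm2 m a b *
     (indicator {0..1 - w} z * ((hjac p A c (1 - w - z) z)\<^sup>2 * (z powr c * (1 - w - z) powr A))))"
      using nn jac_norm2_pos[OF ab(1,2), of m] by (subst ennreal_mult) (auto simp: less_imp_le)
    finally show ?thesis .
  qed
  have G2: "(\<integral>\<^sup>+z. \<integral>\<^sup>+y. G w z y \<partial>lborel \<partial>lborel) = ennreal (jac_norm2 m a b * jac_norm2 p A c) *
     ennreal (indicator {0..1} w * ((hjac q B d (1 - w) w)\<^sup>2 * (w powr d * (1 - w) powr B)))" for w
  proof -
    have "(\<integral>\<^sup>+z. \<integral>\<^sup>+y. G w z y \<partial>lborel \<partial>lborel) = (\<integral>\<^sup>+z. ennreal (f1 w * jac_norm2 m a b) *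
       ennreal (indicator {0..1 - w} z * ((hjac p A c (1 - w - z) z)\<^sup>2 * (z powr c * (1 - w - z) powr A))) \<partial>lborel)"
      unfolding G3 using nn jac_norm2_pos[OF ab(1,2), of m]
      by (intro nn_integral_cong) (simp add: ennreal_mult less_imp_le mult_ac)
    also have "\<dots> = ennreal (f1 w * jac_norm2 m a b) *
       ennreal (indicator {0..} (1 - w) * ((1 - w) powr (2 * real p + A + c + 1) * jac_norm2 p A c))"
      by (subst nn_integral_cmult) (auto simp: hjac_norm_nn_integral[OF A ab(3)])
    also have "2 * real p + A + c + 1 = B" by (simp add: A_def B_def)
    also have "ennreal (f1 w * jac_norm2 m a b) * ennreal (indicator {0..} (1 - w) * ((1 - w) powr B * jac_norm2 p A c)) =
      ennreal (f1 w * jac_norm2 m a b * (indicator {0..} (1 - w) * ((1 - w) powr B * jac_norm2 p A c)))"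
      using nn jac_norm2_pos[OF ab(1,2), of m] jac_norm2_pos[OF A ab(3), of p]
      by (subst ennreal_mult) (auto simp: less_imp_le)
    also have "f1 w * jac_norm2 m a b * (indicator {0..} (1 - w) * ((1 - w) powr B * jac_norm2 p A c)) =
      jac_norm2 m a b * jac_norm2 p A c * (indicator {0..1} w * ((hjac q B d (1 - w) w)\<^sup>2 * (w powr d * (1 - w) powr B)))"
      by (auto simp: f1_def indicator_def)
    also have "ennreal \<dots> = ennreal (jac_norm2 m a b * jac_norm2 p A c) *
     ennreal (indicator {0..1} w * ((hjac q B d (1 - w) w)\<^sup>2 * (w powr d * (1 - w) powr B)))"
      using jac_norm2_pos[OF ab(1,2), of m] jac_norm2_pos[OF A ab(3), of p]
      by (subst ennreal_mult) (auto simp: less_imp_le)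
    finally show ?thesis .
  qed
  have "(\<integral>\<^sup>+v. ennreal (indicator {0..1} (v 1) * indicator {0..1 - v 1} (v 2) * indicator {0..1 - v 1 - v 2} (v 3) *
     ((tree3 a b c d m p q (1 - v 1 - v 2 - v 3) (v 3) (v 2) (v 1))\<^sup>2 *
      (v 1 powr d * v 2 powr c * v 3 powr b * (1 - v 1 - v 2 - v 3) powr a))) \<partial>(\<Pi>\<^sub>M i\<in>{1..3::nat}. lborel)) =
     (\<integral>\<^sup>+v. G (v 1) (v 2) (v 3) \<partial>(\<Pi>\<^sub>M i\<in>{1..3::nat}. lborel))"
  proof (intro nn_integral_cong)
    fix v :: "nat \<Rightarrow> real"
    have e: "1 - v 1 - v 2 - v 3 + v 3 = 1 - v 1 - v 2" "1 - v 1 - v 2 - v 3 + v 3 + v 2 = 1 - v 1" by simp_all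
    have "indicator {0..1} (v 1) * indicator {0..1 - v 1} (v 2) * indicator {0..1 - v 1 - v 2} (v 3) *
     ((tree3 a b c d m p q (1 - v 1 - v 2 - v 3) (v 3) (v 2) (v 1))\<^sup>2 *
      (v 1 powr d * v 2 powr c * v 3 powr b * (1 - v 1 - v 2 - v 3) powr a)) = f1 (v 1) * f2 (v 1) (v 2) * f3 (v 1) (v 2) (v 3)"
      unfolding tree3_def e f1_def f2_def f3_def A_def[symmetric] B_def[symmetric] by (simp add: power_mult_distrib mult_ac)
    then show "ennreal (indicator {0..1} (v 1) * indicator {0..1 - v 1} (v 2) * indicator {0..1 - v 1 - v 2} (v 3) *
     ((tree3 a b c d m p q (1 - v 1 - v 2 - v 3) (v 3) (v 2) (v 1))\<^sup>2 *
      (v 1 powr d * v 2 powr c * v 3 powr b * (1 - v 1 - v 2 - v 3) powr a))) = G (v 1) (v 2) (v 3)"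
      using nn by (simp add: G_def ennreal_mult)
  qed
  also have "\<dots> = (\<integral>\<^sup>+w. \<integral>\<^sup>+z. \<integral>\<^sup>+y. G w z y \<partial>lborel \<partial>lborel \<partial>lborel)"
  proof (rule nn_integral_PiM_3)
    show "(\<lambda>x. G (x 1) (x 2) (x 3)) \<in> borel_measurable (\<Pi>\<^sub>M i\<in>{1..3::nat}. lborel)"
      unfolding G_def f1_def f2_def f3_def indicator_atLeastAtMost_eq_if
      by (rule measurable_of_coordinates_3) measurable
    show "(\<lambda>x. \<integral>\<^sup>+y. G (x 1) (x 2) y \<partial>lborel) \<in> borel_measurable (\<Pi>\<^sub>M i\<in>{1,2::nat}. lborel)"
      unfolding G3 f1_def indicator_atLeastAtMost_eq_if
      by (rule measurable_of_coordinates_2) measurable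
    show "(\<lambda>w. \<integral>\<^sup>+z. \<integral>\<^sup>+y. G w z y \<partial>lborel \<partial>lborel) \<in> borel_measurable lborel"
      unfolding G2 indicator_atLeastAtMost_eq_if by measurable
  qed
  also have "\<dots> = ennreal (jac_norm2 m a b * jac_norm2 p A c) *
      ennreal (indicator {0..} (1::real) * (1 powr (2 * real q + B + d + 1) * jac_norm2 q B d))"
    unfolding G2 by (subst nn_integral_cmult) (auto simp: hjac_norm_nn_integral[OF B ab(4)])
  also have "\<dots> = ennreal (tree3_norm2 m p q a b c d)"
    using jac_norm2_pos[OF ab(1,2), of m] jac_norm2_pos[OF A ab(3), of p] jac_norm2_pos[OF B ab(4), of q]
    by (simp add: tree3_norm2_def A_def[symmetric] B_def[symmetric] ennreal_mult less_imp_le)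
  finally show ?thesis .
qed

lemma tree3_norm2_pos: "a > -1 \<Longrightarrow> b > -1 \<Longrightarrow> c > -1 \<Longrightarrow> d > -1 \<Longrightarrow> tree3_norm2 m p q a b c d > 0"
  unfolding tree3_norm2_def by (intro mult_pos_pos jac_norm2_pos) auto

lemma simplex_jacobi_norm2_3:
  assumes \<kappa>: "\<forall>i\<in>{1..4}. \<kappa> i > -1"
  shows "simplex_jacobi_norm2 3 \<kappa> \<nu> = Gamma (\<kappa> 1 + \<kappa> 2 + \<kappa> 3 + \<kappa> 4 + 4) /
     (Gamma (\<kappa> 1 + 1) * Gamma (\<kappa> 2 + 1) * Gamma (\<kappa> 3 + 1) * Gamma (\<kappa> 4 + 1)) *
     tree3_norm2 (\<nu> 3) (\<nu> 2) (\<nu> 1) (\<kappa> 4) (\<kappa> 3) (\<kappa> 2) (\<kappa> 1)"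
proof -
  have k: "\<kappa> 1 > -1" "\<kappa> 2 > -1" "\<kappa> 3 > -1" "\<kappa> 4 > -1" using \<kappa> by auto
  have e4: "{1..3 + 1::nat} = {1, 2, 3, 4}" by auto
  define F where "F v = indicator {0..1} (v 1) * indicator {0..1 - v 1} (v 2) * indicator {0..1 - v 1 - v 2} (v 3) *
     ((tree3 (\<kappa> 4) (\<kappa> 3) (\<kappa> 2) (\<kappa> 1) (\<nu> 3) (\<nu> 2) (\<nu> 1) (1 - v 1 - v 2 - v 3) (v 3) (v 2) (v 1))\<^sup>2 *
      (v 1 powr \<kappa> 1 * v 2 powr \<kappa> 2 * v 3 powr \<kappa> 3 * (1 - v 1 - v 2 - v 3) powr \<kappa> 4))" for v :: "nat \<Rightarrow> real"
  have F_meas: "F \<in> borel_measurable (\<Pi>\<^sub>M i\<in>{1..3::nat}. lborel)"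
    unfolding F_def tree3_def indicator_atLeastAtMost_eq_if
    by (rule measurable_of_coordinates_3) measurable
  have "(LINT x:simplex_dom 3|(\<Pi>\<^sub>M i\<in>{1..3}. lborel). simplex_jacobi 3 \<kappa> \<nu> x * simplex_jacobi 3 \<kappa> \<nu> x * simplex_weight 3 \<kappa> x) =
      (LINT x|(\<Pi>\<^sub>M i\<in>{1..3}. lborel). F x)"
    unfolding set_lebesgue_integral_def
  proof (intro Bochner_Integration.integral_cong refl)
    fix x :: "nat \<Rightarrow> real" assume "x \<in> space (\<Pi>\<^sub>M i\<in>{1..3}. lborel)"
    then have x: "x \<in> {1..3} \<rightarrow>\<^sub>E UNIV" by (simp add: space_PiM)
    have dom: "x \<in> simplex_dom 3 \<longleftrightarrow> x 1 \<in> {0..1} \<and> x 2 \<in> {0..1 - x 1} \<and> x 3 \<in> {0..1 - x 1 - x 2}"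
    proof -
      have "x \<in> simplex_dom 3 \<longleftrightarrow> 0 \<le> x 1 \<and> 0 \<le> x 2 \<and> 0 \<le> x 3 \<and> x 1 + x 2 + x 3 \<le> 1"
        using x unfolding simplex_dom_def mem_Collect_eq by (simp add: atLeastAtMost_3 add_ac)
      then show ?thesis by auto
    qed
    show "indicat_real (simplex_dom 3) x *\<^sub>R
        (simplex_jacobi 3 \<kappa> \<nu> x * simplex_jacobi 3 \<kappa> \<nu> x * simplex_weight 3 \<kappa> x) = F x"
    proof (cases "x \<in> simplex_dom 3")
      case True
      have "simplex_weight 3 \<kappa> x = x 1 powr \<kappa> 1 * x 2 powr \<kappa> 2 * x 3 powr \<kappa> 3 * (1 - x 1 - x 2 - x 3) powr \<kappa> 4"
        unfolding simplex_weight_def atLeastAtMost_3 by (simp add: diff_diff_eq add_ac mult_ac)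
      then show ?thesis
        using True dom by (simp add: F_def simplex_jacobi_3[OF \<kappa> True] power2_eq_square)
    next
      case False
      then show ?thesis unfolding F_def using dom by (auto simp: indicator_def)
    qed
  qed
  also have "\<dots> = enn2real (\<integral>\<^sup>+ x. ennreal (F x) \<partial>(\<Pi>\<^sub>M i\<in>{1..3}. lborel))"
    by (rule integral_eq_nn_integral[OF F_meas]) (simp add: F_def)
  also have "\<dots> = tree3_norm2 (\<nu> 3) (\<nu> 2) (\<nu> 1) (\<kappa> 4) (\<kappa> 3) (\<kappa> 2) (\<kappa> 1)"
    unfolding F_def using tree3_norm2_pos[OF k(4,3,2,1), of "\<nu> 3" "\<nu> 2" "\<nu> 1"]
    by (subst tree3_norm_integral[OF k(4,3,2,1)]) simp
  finally show ?thesis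
    unfolding simplex_jacobi_norm2_def simplex_inner_def e4 by (simp add: add_ac mult_ac)
qed

section \<open>Normalized weights and continuous extension\<close>

text \<open>\<open>C\<close> is a column of connection coefficients from an orthogonal family with squared norms \<open>H\<close> to a
  polynomial with squared norm \<open>Hm\<close>, and \<open>e\<close> are signs. If \<open>C\<close> is proportional to \<open>p R\<close> and the weight to \<open>p\<^sup>2 / H\<close>, then
  \<open>w R\<^sup>2\<close> is proportional to \<open>C\<^sup>2 / H\<close>, so the normalization of \<open>C\<close> determines the norm of \<open>R\<close>.\<close>

lemma normalized_weight:
  fixes w R C H p e :: "'a \<Rightarrow> real"
  assumes "finite Y"
    and pos: "\<And>y. y \<in> Y \<Longrightarrow> H y > 0" "Hm > 0" "q > 0" "g > 0" "\<And>y. y \<in> Y \<Longrightarrow> p y > 0"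
    and w: "\<And>y. y \<in> Y \<Longrightarrow> w y * H y = q * (p y)\<^sup>2"
    and C: "\<And>y. y \<in> Y \<Longrightarrow> C y = e y * g * p y * R y"
    and e: "\<And>y. y \<in> Y \<Longrightarrow> (e y)\<^sup>2 = 1"
    and one: "(\<Sum>y\<in>Y. (C y)\<^sup>2 * Hm / H y) = 1"
  shows "(\<Sum>y\<in>Y. w y * (R y)\<^sup>2) > 0"
    and "x \<in> Y \<Longrightarrow> R x * sqrt (w x / (\<Sum>y\<in>Y. w y * (R y)\<^sup>2)) = e x * C x * sqrt (Hm / H x)"
proof -
  have w': "w y = q * (p y)\<^sup>2 / H y" if "y \<in> Y" for y
    using w[OF that] pos(1)[OF that] by (simp add: field_simps)
  have "w y * (R y)\<^sup>2 = q / (g\<^sup>2 * Hm) * ((C y)\<^sup>2 * Hm / H y)" if "y \<in> Y" for y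
    unfolding w'[OF that] C[OF that] power_mult_distrib e[OF that] using pos(2-4) by simp
  then have "(\<Sum>y\<in>Y. w y * (R y)\<^sup>2) = q / (g\<^sup>2 * Hm) * (\<Sum>y\<in>Y. (C y)\<^sup>2 * Hm / H y)"
    by (simp add: sum_distrib_left)
  then have S: "(\<Sum>y\<in>Y. w y * (R y)\<^sup>2) = q / (g\<^sup>2 * Hm)" by (simp add: one)
  then show "(\<Sum>y\<in>Y. w y * (R y)\<^sup>2) > 0" using pos(2-4) by simp
  show "R x * sqrt (w x / (\<Sum>y\<in>Y. w y * (R y)\<^sup>2)) = e x * C x * sqrt (Hm / H x)" if x: "x \<in> Y"
  proof -
    have "w x / (\<Sum>y\<in>Y. w y * (R y)\<^sup>2) = (g * p x)\<^sup>2 * (Hm / H x)"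
      unfolding S w'[OF x] using pos(2-4) by (simp add: power_mult_distrib)
    then have "sqrt (w x / (\<Sum>y\<in>Y. w y * (R y)\<^sup>2)) = sqrt ((g * p x)\<^sup>2) * sqrt (Hm / H x)"
      by (simp only: real_sqrt_mult)
    then have "sqrt (w x / (\<Sum>y\<in>Y. w y * (R y)\<^sup>2)) = g * p x * sqrt (Hm / H x)"
      using pos(4) pos(5)[OF x] by simp
    moreover have "e x * C x = g * p x * R x"
      using C[OF x] e[OF x] by (simp add: power2_eq_square)
    ultimately show ?thesis by simp
  qed
qed

text \<open>The path \<open>s\<close> shows that \<open>p\<close> is not isolated from \<open>D\<close>, so that the limit defining the extension is
  meaningful.\<close>

lemma cont_ext_eq:
  fixes f g :: "'a::t2_space \<Rightarrow> real" and s :: "real \<Rightarrow> 'a"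
  assumes eq: "\<And>q. q \<in> D \<Longrightarrow> f q = g q"
    and cont: "isCont g p"
    and lim: "(s \<longlongrightarrow> p) (at_right 0)"
    and ev: "\<forall>\<^sub>F t in at_right 0. s t \<in> D \<and> s t \<noteq> p"
  shows "cont_ext D f p = g p"
proof (cases "p \<in> D")
  case False
  have "filterlim s (at p within D) (at_right 0)"
    using lim ev by (simp add: filterlim_at)
  then have nontrivial: "at p within D \<noteq> bot"
    unfolding filterlim_def by (metis filtermap_bot_iff le_bot trivial_limit_at_right_real)
  have "(g \<longlongrightarrow> g p) (at p within D)"
    using cont unfolding isCont_def by (rule tendsto_within_subset) simp
  then have "(f \<longlongrightarrow> g p) (at p within D)"
    by (rule Lim_transform_eventually) (auto simp: eventually_at_filter eq)
  then have "Lim (at p within D) f = g p"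
    using nontrivial by (intro tendsto_Lim)
  then show ?thesis using False by (simp add: cont_ext_def)
qed (simp add: cont_ext_def eq)

lemma isCont_pochhammer [continuous_intros]:
  fixes f :: "'a::t2_space \<Rightarrow> real"
  shows "isCont f p \<Longrightarrow> isCont (\<lambda>z. pochhammer (f z) n) p"
  unfolding pochhammer_prod by (intro continuous_intros)

text \<open>The continuous version of \<open>(s)\<^bsub>y+z\<^esub> (s/2 + 1)\<^sub>y / (s/2)\<^sub>y\<close>, in which the zero of the denominator at
  \<open>s = 0\<close> has been cancelled.\<close>

definition well_poised_factor :: "real \<Rightarrow> nat \<Rightarrow> nat \<Rightarrow> real" where
  "well_poised_factor s y z = (if y = 0 then 1 else (s + 2 * real y) * pochhammer (s + 1) (y + z - 1))"

lemma well_poised_factor_eq: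
  assumes "pochhammer (s / 2) y \<noteq> 0" "y = 0 \<Longrightarrow> z = 0"
  shows "pochhammer s (y + z) * pochhammer (s / 2 + 1) y = well_poised_factor s y z * pochhammer (s / 2) y"
proof (cases y)
  case (Suc r)
  have "pochhammer (s / 2) y * (s / 2 + real y) = s / 2 * pochhammer (s / 2 + 1) y"
    using pochhammer_rec[of "s / 2" y] pochhammer_Suc[of "s / 2" y] by simp
  then have "s * pochhammer (s / 2 + 1) y = (s + 2 * real y) * pochhammer (s / 2) y"
    by (simp add: algebra_simps)
  moreover have "pochhammer s (y + z) = s * pochhammer (s + 1) (y + z - 1)"
    using Suc pochhammer_rec[of s "r + z"] by simp
  ultimately show ?thesis using Suc by (simp add: well_poised_factor_def mult_ac)
qed (use assms in \<open>simp add: well_poised_factor_def\<close>)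

text \<open>The second factor on the left occurs in \<open>jac_norm2\<close>, and the right-hand side cancels against the
  Gamma function in its denominator. This is how the very-well-poised part of the Racah weights
  disappears against the norms.\<close>

lemma well_poised_factor_times_pochhammer:
  assumes "z \<le> y"
  shows "well_poised_factor s y z * pochhammer (s + real y + real z) (y - z) = pochhammer (s + 1) (2 * y)"
proof (cases y)
  case (Suc r)
  have e: "r + z + (y - z) = 2 * r + 1" using assms Suc by simp
  have "pochhammer (s + 1) (2 * y) = pochhammer (s + 1) (2 * r + 1) * (s + 2 * real y)"
    using Suc pochhammer_Suc[of "s + 1" "2 * r + 1"] by (simp add: algebra_simps)
  also have "pochhammer (s + 1) (2 * r + 1) = pochhammer (s + 1) (r + z) * pochhammer (s + 1 + real (r + z)) (y - z)"
    using pochhammer_product'[of "s + 1" "r + z" "y - z"] unfolding e .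
  also have "s + 1 + real (r + z) = s + real y + real z" by (simp add: Suc)
  finally show ?thesis by (simp add: well_poised_factor_def Suc)
qed (use assms in \<open>simp add: well_poised_factor_def\<close>)

lemma isCont_well_poised_factor [continuous_intros]:
  fixes f :: "'a::t2_space \<Rightarrow> real"
  shows "isCont f p \<Longrightarrow> isCont (\<lambda>q. well_poised_factor (f q) y z) p"
  unfolding well_poised_factor_def by (cases "y = 0") (auto intro!: continuous_intros)

lemma pochhammer_half_neq_0:
  fixes s :: real
  assumes "s > -1" "s \<noteq> 0"
  shows "pochhammer (s / 2) y \<noteq> 0"
  using assms by (auto simp: pochhammer_eq_0_iff)

section \<open>Racah polynomials of one variable\<close>

definition racah1_weight_reg_den :: "nat \<Rightarrow> real \<times> real \<times> real \<times> real \<Rightarrow> real" where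
  "racah1_weight_reg_den x = (\<lambda>(\<alpha>, \<beta>, \<gamma>, \<delta>).
     fact x * pochhammer (\<gamma> + \<delta> - \<alpha> + 1) x * pochhammer (\<gamma> - \<beta> + 1) x * pochhammer (\<delta> + 1) x)"

text \<open>The Racah weight without its removable singularity at \<open>\<gamma> + \<delta> + 1 = 0\<close>.\<close>

definition racah1_weight_reg :: "nat \<Rightarrow> real \<times> real \<times> real \<times> real \<Rightarrow> real" where
  "racah1_weight_reg x = (\<lambda>(\<alpha>, \<beta>, \<gamma>, \<delta>). well_poised_factor (\<gamma> + \<delta> + 1) x 0 * pochhammer (\<alpha> + 1) x * pochhammer (\<beta> + \<delta> + 1) x *
     pochhammer (\<gamma> + 1) x / racah1_weight_reg_den x (\<alpha>, \<beta>, \<gamma>, \<delta>))"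

lemma racah1_weight_eq:
  assumes "racah1_weight_den x \<sigma> \<noteq> 0"
  shows "racah1_weight x \<sigma> = racah1_weight_reg x \<sigma>"
proof -
  obtain \<alpha> \<beta> \<gamma> \<delta> where \<sigma>: "\<sigma> = (\<alpha>, \<beta>, \<gamma>, \<delta>)" by (cases \<sigma>)
  have e: "(\<gamma> + \<delta> + 3) / 2 = (\<gamma> + \<delta> + 1) / 2 + 1" by simp
  have nz: "pochhammer ((\<gamma> + \<delta> + 1) / 2) x \<noteq> 0"
    using assms by (simp add: \<sigma> racah1_weight_den_def)
  have v: "pochhammer (\<gamma> + \<delta> + 1) x * pochhammer ((\<gamma> + \<delta> + 1) / 2 + 1) x =
      well_poised_factor (\<gamma> + \<delta> + 1) x 0 * pochhammer ((\<gamma> + \<delta> + 1) / 2) x"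
    using well_poised_factor_eq[OF nz, of 0] by simp
  show ?thesis
    using nz unfolding \<sigma> racah1_weight_def racah1_weight_num_def racah1_weight_den_def racah1_weight_reg_def racah1_weight_reg_den_def
      prod.case e v by (simp add: mult_ac)
qed

lemma isCont_racah1_poly:
  assumes "\<And>k. k \<le> m \<Longrightarrow> pochhammer (\<alpha> + 1) k \<noteq> 0 \<and> pochhammer (\<beta> + \<delta> + 1) k \<noteq> 0 \<and> pochhammer (\<gamma> + 1) k \<noteq> 0"
  shows "isCont (racah1_poly m x) (\<alpha>, \<beta>, \<gamma>, \<delta>)"
  unfolding racah1_poly_def hyp_4F3_def split_beta
  by (intro continuous_intros) (use assms in auto)

lemma isCont_racah1_weight_reg:
  assumes "racah1_weight_reg_den x (\<alpha>, \<beta>, \<gamma>, \<delta>) \<noteq> 0"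
  shows "isCont (racah1_weight_reg x) (\<alpha>, \<beta>, \<gamma>, \<delta>)"
  using assms unfolding racah1_weight_reg_def racah1_weight_reg_den_def split_beta
  by (intro continuous_intros) auto

lemma isCont_racah1_weight_reg_den: "isCont (racah1_weight_reg_den x) \<sigma>"
  unfolding racah1_weight_reg_den_def split_beta by (intro continuous_intros)

text \<open>The column \<open>m\<close> of \<open>swap_coeff N x m a c b\<close> is used, for which the Racah weight is proportional to
  \<open>p\<^sup>2\<close> divided by the squared norm of the source; the symmetry of the coefficients then gives the row. The
  only singular case for exponents above \<open>-1\<close> is \<open>a + c + 1 = 0\<close>, and it is left by increasing \<open>c\<close>.\<close>

theorem racah1_fun_eq:
  fixes N m x :: nat and a b c :: real
  assumes ab: "a > -1" "b > -1" "c > -1" and mx: "m \<le> N" "x \<le> N"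
  shows "racah1_fun N m x (- real N - 1, real N + a + b + 1, a, c) =
    (-1) ^ (N - x + m) * swap_coeff N m x a b c * sqrt (tree_norm2 N x a c b / tree_norm2 N m a b c)"
proof -
  define \<sigma> where "\<sigma> = (- real N - 1, real N + a + b + 1, a, c)"
  define S where "S = a + b + c + 2"
  define s where "s = a + c + 1"
  define p where "p x = real (N choose x) * pochhammer (a + 1) x * pochhammer (b + 1) (N - x)" for x
  define norm2 where "norm2 \<sigma> = (\<Sum>x\<le>N. racah1_weight_reg x \<sigma> * (racah1_poly m x \<sigma>)\<^sup>2)" for \<sigma>
  define q where "q = Gamma (a + 1) * Gamma (c + 1) * Gamma (b + 1) * Gamma (s + 1 + real N) * pochhammer (real N + S) N /
     (fact N * pochhammer (b + 1) N * Gamma (s + 1) * Gamma (2 * real N + S + 1))"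
  define g where "g = pochhammer (real N + S) m /
     (pochhammer (b + 1) m * pochhammer (a + b + 1 + real m) m * pochhammer (a + b + 2 * real m + 2) (N - m))"
  have top_pos: "pochhammer (real N + S) i > 0" if "i \<le> N" for i
    using ab that unfolding S_def by (cases N) (auto intro!: pochhammer_pos)
  have poly: "racah1_poly m x \<sigma> = racah_4F3 N x m a c b" if "x \<le> N" for x
    using racah_4F3_dual[OF mx(1) that, of a b c]
    by (simp add: racah1_poly_def \<sigma>_def algebra_simps)
  have bN: "pochhammer (- b - real N) x = (-1) ^ x * pochhammer (b + 1 + real (N - x)) x" if "x \<le> N" for x
    using pochhammer_minus[of "b + real N" x] that by (simp add: of_nat_diff algebra_simps)
  have den: "racah1_weight_reg_den x \<sigma> = fact x * pochhammer (s + 1 + real N) x *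
      ((-1) ^ x * pochhammer (b + 1 + real (N - x)) x) * pochhammer (c + 1) x" if "x \<le> N" for x
    unfolding bN[OF that, symmetric] by (simp add: racah1_weight_reg_den_def \<sigma>_def s_def algebra_simps)
  have s: "s > -1" using ab by (simp add: s_def)
  have nz: "pochhammer (s + 1 + real N) x \<noteq> 0" "pochhammer (b + 1 + real (N - x)) x \<noteq> 0" "pochhammer (c + 1) x \<noteq> 0" for x
    using ab s by (auto intro!: pochhammer_neq_0_if_pos)
  have den_nz: "racah1_weight_reg_den x \<sigma> \<noteq> 0" if "x \<le> N" for x
    using nz unfolding den[OF that] by simp
  have weight: "racah1_weight_reg x \<sigma> * tree_norm2 N x a c b = q * (p x)\<^sup>2" if x: "x \<le> N" for x
  proof -
    have w: "racah1_weight_reg x \<sigma> = well_poised_factor s x 0 * pochhammer (- real N) x * pochhammer (real N + S) x * pochhammer (a + 1) x /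
       (fact x * pochhammer (s + 1 + real N) x * ((-1) ^ x * pochhammer (b + 1 + real (N - x)) x) * pochhammer (c + 1) x)"
      unfolding den[OF x, symmetric] by (simp add: racah1_weight_reg_def \<sigma>_def s_def S_def algebra_simps)
    have g1: "Gamma (a + 1 + real x) = pochhammer (a + 1) x * Gamma (a + 1)"
      "Gamma (c + 1 + real x) = pochhammer (c + 1) x * Gamma (c + 1)"
      "Gamma (b + 1 + real (N - x)) = pochhammer (b + 1) (N - x) * Gamma (b + 1)"
      using ab by (auto intro!: Gamma_plus_nat)
    have g2: "Gamma (2 * real x + a + c + 2) = pochhammer (s + 1) (2 * x) * Gamma (s + 1)"
      using Gamma_plus_nat[of "s + 1" "2 * x"] s by (simp add: s_def algebra_simps)
    have g3: "Gamma (a + c + 2 * real x + 1 + 1 + real (N - x)) = pochhammer (s + 1 + real N) x * Gamma (s + 1 + real N)"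
      using Gamma_plus_nat[of "s + 1 + real N" x] s x by (simp add: s_def of_nat_diff algebra_simps)
    have g4: "Gamma (2 * real (N - x) + (a + c + 2 * real x + 1) + b + 2) = Gamma (2 * real N + S + 1)"
      using x by (simp add: S_def of_nat_diff algebra_simps)
    have p1: "pochhammer (real (N - x) + (a + c + 2 * real x + 1) + b + 1) (N - x) = pochhammer (real N + S + real x) (N - x)"
      using x by (simp add: S_def of_nat_diff algebra_simps)
    have p2: "pochhammer (real N + S) N = pochhammer (real N + S) x * pochhammer (real N + S + real x) (N - x)"
      by (rule pochhammer_product[OF x])
    have p3: "pochhammer (b + 1) N = pochhammer (b + 1) (N - x) * pochhammer (b + 1 + real (N - x)) x"
      using pochhammer_product[of "N - x" N "b + 1"] x by simp
    have p4: "pochhammer (real x + a + c + 1) x = pochhammer (s + real x) x" by (simp add: s_def add_ac)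
    have p5: "pochhammer (s + 1) (2 * x) = well_poised_factor s x 0 * pochhammer (s + real x) x"
      using well_poised_factor_times_pochhammer[of 0 x s] by simp
    have nz2: "pochhammer (s + 1) (2 * x) \<noteq> 0" "pochhammer (b + 1) (N - x) \<noteq> 0" "Gamma (s + 1) > 0"
      using s ab by (auto intro!: pochhammer_neq_0_if_pos Gamma_real_pos)
    have nz3: "well_poised_factor s x 0 \<noteq> 0" "pochhammer (s + real x) x \<noteq> 0" using nz2(1) unfolding p5 by auto
    show ?thesis
      unfolding w tree_norm2_def jac_norm2_def g1 g2 g3 g4 p1 p4 q_def p_def p2 p3 p5
        pochhammer_neg_of_nat[OF x] binomial_fact[OF x]
      using nz[of x] nz2 nz3 by (simp add: field_simps power2_eq_square)
  qed
  have conn: "swap_coeff N x m a c b = (-1) ^ (N - x + m) * g * p x * racah1_poly m x \<sigma>" if "x \<le> N" for x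
    unfolding swap_coeff_def poly[OF that] by (simp add: g_def p_def S_def add_ac mult_ac)
  have orth: "(\<Sum>x\<le>N. (swap_coeff N x m a c b)\<^sup>2 * tree_norm2 N m a b c / tree_norm2 N x a c b) = 1"
    by (rule swap_coeff_orthonormal[OF ab(1) ab(3) ab(2) mx(1)])
  have bN_pos: "pochhammer (b + 1) N > 0" using ab by (intro pochhammer_pos) auto
  have q_pos: "q > 0" unfolding q_def
    using ab s by (intro divide_pos_pos mult_pos_pos Gamma_real_pos top_pos bN_pos) (auto simp: S_def)
  have g_pos: "g > 0" unfolding g_def
  proof (intro divide_pos_pos mult_pos_pos top_pos mx)
    show "pochhammer (a + b + 1 + real m) m > 0" using ab by (cases m) (auto intro!: pochhammer_pos)
  qed (use ab in \<open>auto intro!: pochhammer_pos\<close>)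
  have p_pos: "p x > 0" if "x \<in> {..N}" for x
    using ab that unfolding p_def by (intro mult_pos_pos pochhammer_pos) auto
  have H_pos: "tree_norm2 N x a c b > 0" "tree_norm2 N m a b c > 0" for x
    using ab by (auto intro: tree_norm2_pos)
  have sign: "((-1) ^ (N - x + m) :: real)\<^sup>2 = 1" for x by (simp flip: power_mult)
  have norm2_pos: "norm2 \<sigma> > 0"
    unfolding norm2_def
    by (intro normalized_weight(1)[where H = "\<lambda>x. tree_norm2 N x a c b" and Hm = "tree_norm2 N m a b c" and q = q and
          g = g and p = p and C = "\<lambda>x. swap_coeff N x m a c b" and e = "\<lambda>x. (-1) ^ (N - x + m)"]
        finite_atMost H_pos q_pos g_pos p_pos weight conn sign orth) auto
  have main: "racah1_poly m x \<sigma> * sqrt (racah1_weight_reg x \<sigma> / norm2 \<sigma>) =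
     (-1) ^ (N - x + m) * swap_coeff N x m a c b * sqrt (tree_norm2 N m a b c / tree_norm2 N x a c b)"
    unfolding norm2_def
    by (intro normalized_weight(2)[where H = "\<lambda>x. tree_norm2 N x a c b" and Hm = "tree_norm2 N m a b c" and q = q and
          g = g and p = p and C = "\<lambda>x. swap_coeff N x m a c b" and e = "\<lambda>x. (-1) ^ (N - x + m)"]
        finite_atMost H_pos q_pos g_pos p_pos weight conn sign orth) (use mx in auto)
  have norm2_eq: "racah1_norm2 N m \<tau> = norm2 \<tau>" if "\<forall>x\<le>N. racah1_weight_den x \<tau> \<noteq> 0" for \<tau>
    using that by (auto simp: racah1_norm2_def norm2_def racah1_weight_eq atMost_atLeast0 intro!: sum.cong)
  have poly_nz: "pochhammer (- real N) k \<noteq> 0 \<and> pochhammer (real N + a + b + 1 + c + 1) k \<noteq> 0 \<and> pochhammer (a + 1) k \<noteq> 0"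
    if "k \<le> m" for k
    using that mx pochhammer_top_neq_0[OF ab, of k N] ab
    by (auto simp: pochhammer_of_nat_eq_0_iff pochhammer_neq_0_if_pos add_ac)
  have cont_poly: "isCont (racah1_poly m x) \<sigma>" for x
    unfolding \<sigma>_def by (rule isCont_racah1_poly) (use poly_nz in auto)
  have cont_weight: "isCont (racah1_weight_reg x) \<sigma>" if "x \<le> N" for x
    using den_nz[OF that] unfolding \<sigma>_def by (rule isCont_racah1_weight_reg)
  have cont_norm: "isCont norm2 \<sigma>"
    unfolding norm2_def by (intro continuous_intros cont_poly cont_weight) auto
  \<comment> \<open>The first parameter has to stay fixed, since the regular parameters lie in a hyperplane.\<close>
  define path where "path t = (- real N - 1, real N + a + b + 1, a, c + t)" for t
  have lim: "(path \<longlongrightarrow> \<sigma>) (at_right 0)"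
    unfolding path_def \<sigma>_def by (auto intro!: tendsto_eq_intros)
  have "racah1_fun N m x \<sigma> = racah1_poly m x \<sigma> * sqrt (racah1_weight_reg x \<sigma> / norm2 \<sigma>)"
    unfolding racah1_fun_def
  proof (rule cont_ext_eq[OF _ _ lim])
    fix \<tau> assume "\<tau> \<in> racah1_regular N m"
    then have "\<forall>x\<le>N. racah1_weight_den x \<tau> \<noteq> 0" by (cases \<tau>) (auto simp: racah1_regular_def)
    then show "racah1_poly m x \<tau> * sqrt (racah1_weight x \<tau> / racah1_norm2 N m \<tau>) =
        racah1_poly m x \<tau> * sqrt (racah1_weight_reg x \<tau> / norm2 \<tau>)"
      using mx by (simp add: racah1_weight_eq norm2_eq)
  next
    show "isCont (\<lambda>\<tau>. racah1_poly m x \<tau> * sqrt (racah1_weight_reg x \<tau> / norm2 \<tau>)) \<sigma>"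
      using norm2_pos mx by (intro continuous_intros cont_poly cont_weight cont_norm) auto
  next
    have along: "\<forall>\<^sub>F t in at_right 0. F (path t) \<noteq> 0" if "isCont F \<sigma>" "F \<sigma> \<noteq> 0" for F :: "_ \<Rightarrow> real"
      using isCont_tendsto_compose[OF that(1) lim] that(2) by (rule tendsto_imp_eventually_ne)
    have "\<forall>\<^sub>F t in at_right 0. \<forall>x\<in>{..N}. racah1_weight_reg_den x (path t) \<noteq> 0"
      using along[OF isCont_racah1_weight_reg_den den_nz] by (intro eventually_ball_finite) auto
    moreover have "\<forall>\<^sub>F t in at_right 0. norm2 (path t) \<noteq> 0"
      using along[OF cont_norm] norm2_pos by simp
    moreover have "\<forall>\<^sub>F t in at_right 0. t > (0::real) \<and> s + t \<noteq> 0"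
      using eventually_at_right_less[of "0::real"] eventually_neq_at_within[of "- s" 0 "{0<..}"]
      by eventually_elim auto
    ultimately show "\<forall>\<^sub>F t in at_right 0. path t \<in> racah1_regular N m \<and> path t \<noteq> \<sigma>"
    proof eventually_elim
      case (elim t)
      then have t: "t > 0" "s + t \<noteq> 0" by auto
      have half: "pochhammer ((s + t) / 2) x \<noteq> 0" for x
        using t s by (intro pochhammer_half_neq_0) auto
      have "racah1_weight_den x (path t) = pochhammer ((s + t) / 2) x * racah1_weight_reg_den x (path t)" for x
        by (simp add: racah1_weight_den_def racah1_weight_reg_den_def path_def s_def add_ac)
      then have d: "\<forall>x\<le>N. racah1_weight_den x (path t) \<noteq> 0"
        using elim half by auto
      have "pochhammer (real N + a + b + 1 + (c + t) + 1) k \<noteq> 0" if "k \<le> m" for k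
        using pochhammer_top_neq_0[of a b "c + t" k N] ab t that mx by (simp add: add_ac)
      then show ?case
        using d elim t poly_nz norm2_eq[OF d]
        by (auto simp: racah1_regular_def path_def \<sigma>_def)
    qed
  qed
  also note main
  also have "swap_coeff N x m a c b = swap_coeff N m x a b c * tree_norm2 N x a c b / tree_norm2 N m a b c"
    using swap_coeff_symmetric[OF ab mx] tree_norm2_pos[OF ab, of N m] by (simp add: field_simps)
  also have "(-1) ^ (N - x + m) * (swap_coeff N m x a b c * tree_norm2 N x a c b / tree_norm2 N m a b c) *
      sqrt (tree_norm2 N m a b c / tree_norm2 N x a c b) =
    (-1) ^ (N - x + m) * swap_coeff N m x a b c * sqrt (tree_norm2 N x a c b / tree_norm2 N m a b c)"
  proof -
    have "u / v * sqrt (v / u) = sqrt (u / v)" if "u > 0" "v > 0" for u v :: real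
      using that by (simp add: real_sqrt_divide field_simps) (simp flip: real_sqrt_mult power2_eq_square)?
    from this[of "tree_norm2 N x a c b" "tree_norm2 N m a b c"]
    have "(-1) ^ (N - x + m) * swap_coeff N m x a b c * (tree_norm2 N x a c b / tree_norm2 N m a b c *
        sqrt (tree_norm2 N m a b c / tree_norm2 N x a c b)) =
      (-1) ^ (N - x + m) * swap_coeff N m x a b c * sqrt (tree_norm2 N x a c b / tree_norm2 N m a b c)"
      using tree_norm2_pos ab by (intro arg_cong2[where f = "(*)"] refl) auto
    then show ?thesis by (simp only: times_divide_eq_right times_divide_eq_left mult.assoc)
  qed
  finally show ?thesis unfolding \<sigma>_def .
qed

section \<open>Racah polynomials of two variables\<close>

lemma hyp_4F3_reg_eq:
  assumes "pochhammer u m \<noteq> 0" "pochhammer v m \<noteq> 0" "pochhammer t m \<noteq> 0"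
  shows "hyp_4F3_reg m a b c u v t =
    pochhammer u m * pochhammer v m * pochhammer t m * hyp_4F3 m a b c u v t"
  unfolding hyp_4F3_reg_def hyp_4F3_def sum_distrib_left
proof (intro sum.cong refl)
  fix k assume "k \<in> {..m}"
  then have k: "k \<le> m" by simp
  have "pochhammer z (m :: nat) = pochhammer z k * pochhammer (z + real k) (m - k)" for z
    by (rule pochhammer_product[OF k])
  moreover from this have "pochhammer u k \<noteq> 0" "pochhammer v k \<noteq> 0" "pochhammer t k \<noteq> 0"
    using assms by (metis mult_zero_left)+
  ultimately show "pochhammer (- real m) k * pochhammer a k * pochhammer b k * pochhammer c k / fact k *
      pochhammer (u + real k) (m - k) * pochhammer (v + real k) (m - k) * pochhammer (t + real k) (m - k) =
    pochhammer u m * pochhammer v m * pochhammer t m * (pochhammer (- real m) k * pochhammer a k * pochhammer b k *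
      pochhammer c k / (pochhammer u k * pochhammer v k * pochhammer t k * fact k))"
    by simp
qed

text \<open>Either a numerator or a cancelled denominator vanishes in every term. It matches the vanishing of
  the connection coefficient for \<open>k > y2\<close>.\<close>

lemma hyp_4F3_reg_eq_0:
  assumes "y1 \<le> y2" "y2 < m"
  shows "hyp_4F3_reg m a (- real y1) c u v (- real y2) = 0"
  unfolding hyp_4F3_reg_def
proof (intro sum.neutral ballI)
  fix k assume k: "k \<in> {..m}"
  have "pochhammer (- real y1) k = 0 \<or> pochhammer (- real y2 + real k) (m - k) = 0"
  proof (cases "k > y1")
    case True
    then show ?thesis by (simp add: pochhammer_of_nat_eq_0_iff)
  next
    case False
    then have e: "- real y2 + real k = - real (y2 - k)" and lt: "y2 - k < m - k"
      using assms k by (auto simp: of_nat_diff)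
    then show ?thesis unfolding e using pochhammer_of_nat_eq_0_lemma[OF lt] by blast
  qed
  then show "pochhammer (- real m) k * pochhammer a k * pochhammer (- real y1) k * pochhammer c k / fact k *
      pochhammer (u + real k) (m - k) * pochhammer (v + real k) (m - k) * pochhammer (- real y2 + real k) (m - k) = 0"
    by auto
qed

definition racah2_weight_reg_den :: "nat \<Rightarrow> nat \<Rightarrow> nat \<Rightarrow> (nat \<Rightarrow> real) \<Rightarrow> real" where
  "racah2_weight_reg_den N y1 y2 \<beta> = fact y1 * fact (y2 - y1) * fact (N - y2) * pochhammer (\<beta> 0 + 1) y1 *
     pochhammer (\<beta> 1 + 1) (y2 + y1) * pochhammer (\<beta> 2 + 1) (N + y2)"

text \<open>The weight without its removable singularities at \<open>\<beta>\<^sub>1 = 0\<close> and \<open>\<beta>\<^sub>2 = 0\<close>, and without the factor \<open>\<beta>\<^sub>3\<close>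
  that all weights share if \<open>N > 0\<close>.\<close>

definition racah2_weight_reg :: "nat \<Rightarrow> nat \<Rightarrow> nat \<Rightarrow> (nat \<Rightarrow> real) \<Rightarrow> real" where
  "racah2_weight_reg N y1 y2 \<beta> = pochhammer (\<beta> 1 - \<beta> 0) y1 * pochhammer (\<beta> 2 - \<beta> 1) (y2 - y1) *
     pochhammer (\<beta> 3 - \<beta> 2) (N - y2) * well_poised_factor (\<beta> 1) y1 0 * well_poised_factor (\<beta> 2) y2 y1 * pochhammer (\<beta> 3 + 1) (N + y2 - 1) /
     racah2_weight_reg_den N y1 y2 \<beta>"

lemma atLeastAtMost_0_2: "{0..2::nat} = {0, 1, 2}" and atLeastAtMost_1_2: "{1..2::nat} = {1, 2}"
  by auto

lemma racah_weight_den_2: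
  "racah_weight_den 2 N x \<beta> =
    racah2_weight_reg_den N (x 1) (x 2) \<beta> * (pochhammer (\<beta> 1 / 2) (x 1) * pochhammer (\<beta> 2 / 2) (x 2))"
  unfolding racah_weight_den_def racah2_weight_reg_den_def atLeastAtMost_0_2 atLeastAtMost_1_2 Let_def
  by (simp add: racah_pad_def numeral_eq_Suc mult_ac)

lemma racah_weight_2:
  assumes "racah_weight_den 2 N x \<beta> \<noteq> 0" "x 1 \<le> x 2" "x 2 \<le> N"
  shows "racah_weight 2 N x \<beta> = (if N = 0 then 1 else \<beta> 3) * racah2_weight_reg N (x 1) (x 2) \<beta>"
proof -
  have nz: "pochhammer (\<beta> 1 / 2) (x 1) \<noteq> 0" "pochhammer (\<beta> 2 / 2) (x 2) \<noteq> 0"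
    using assms(1) unfolding racah_weight_den_2 by auto
  have v1: "pochhammer (\<beta> 1) (x 1) * pochhammer (\<beta> 1 / 2 + 1) (x 1) = well_poised_factor (\<beta> 1) (x 1) 0 * pochhammer (\<beta> 1 / 2) (x 1)"
    using well_poised_factor_eq[OF nz(1), of 0] by simp
  have v2: "pochhammer (\<beta> 2) (x 2 + x 1) * pochhammer (\<beta> 2 / 2 + 1) (x 2) =
      well_poised_factor (\<beta> 2) (x 2) (x 1) * pochhammer (\<beta> 2 / 2) (x 2)"
    using well_poised_factor_eq[OF nz(2), of "x 1"] assms(2) by simp
  have v3: "pochhammer (\<beta> 3) (N + x 2) = (if N = 0 then 1 else \<beta> 3) * pochhammer (\<beta> 3 + 1) (N + x 2 - 1)"
    using assms(3) pochhammer_rec[of "\<beta> 3" "N + x 2 - 1"] by (cases N) auto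
  have num: "racah_weight_num 2 N x \<beta> = pochhammer (\<beta> 1 - \<beta> 0) (x 1) * pochhammer (\<beta> 2 - \<beta> 1) (x 2 - x 1) *
     pochhammer (\<beta> 3 - \<beta> 2) (N - x 2) * (pochhammer (\<beta> 1) (x 1) * pochhammer (\<beta> 1 / 2 + 1) (x 1)) *
     (pochhammer (\<beta> 2) (x 2 + x 1) * pochhammer (\<beta> 2 / 2 + 1) (x 2)) * pochhammer (\<beta> 3) (N + x 2)"
  proof -
    have h: "(\<beta> j + 2) / 2 = \<beta> j / 2 + 1" for j by simp
    show ?thesis
      unfolding racah_weight_num_def atLeastAtMost_0_2 atLeastAtMost_1_2 Let_def h
      by (simp add: racah_pad_def numeral_eq_Suc mult_ac)
  qed
  show ?thesis
    unfolding racah_weight_def num racah_weight_den_2 v1 v2 v3 racah2_weight_reg_def using nz by simp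
qed

definition racah2_poly :: "nat \<Rightarrow> nat \<Rightarrow> nat \<Rightarrow> nat \<Rightarrow> nat \<Rightarrow> (nat \<Rightarrow> real) \<Rightarrow> real" where
  "racah2_poly N k j y1 y2 \<beta> =
     hyp_4F3_reg k (real k + \<beta> 2 - \<beta> 0 - 1) (- real y1) (\<beta> 1 + real y1) (\<beta> 1 - \<beta> 0) (\<beta> 2 + real y2) (- real y2) *
     hyp_4F3_reg j (real j + 2 * real k + \<beta> 3 - \<beta> 0 - 1) (real k - real y2) (real k + \<beta> 2 + real y2)
       (2 * real k + \<beta> 2 - \<beta> 0) (real k + \<beta> 3 + real N) (real k - real N)"

lemma racah_poly_2:
  "racah_poly 2 N \<nu> x \<beta> = racah2_poly N (\<nu> 1) (\<nu> 2) (x 1) (x 2) \<beta>"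
proof -
  have e: "{1..<1::nat} = {}" "{1..<2::nat} = {1}" by auto
  show ?thesis
    unfolding racah_poly_def atLeastAtMost_1_2 Let_def racah2_poly_def
    by (simp add: racah_pad_def numeral_eq_Suc e)
qed

lemma racah_dom_2: "racah_dom 2 N = {y \<in> {1..2} \<rightarrow>\<^sub>E UNIV. y 1 \<le> y 2 \<and> y 2 \<le> N}"
  unfolding racah_dom_def atLeastAtMost_0_2 by (auto simp: racah_pad_def numeral_eq_Suc)

definition chain_2 :: "nat \<Rightarrow> nat \<Rightarrow> nat \<Rightarrow> nat" where
  "chain_2 y1 y2 = (\<lambda>i\<in>{1..2}. if i = 1 then y1 else y2)"

lemma chain_2_simps [simp]: "chain_2 y1 y2 1 = y1" "chain_2 y1 y2 (Suc 0) = y1" "chain_2 y1 y2 2 = y2"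
  by (auto simp: chain_2_def)

lemma chain_2_in: "y1 \<le> y2 \<Longrightarrow> y2 \<le> N \<Longrightarrow> chain_2 y1 y2 \<in> racah_dom 2 N"
  by (simp add: racah_dom_2) (simp add: chain_2_def)

lemma chain_2_eq:
  assumes "y \<in> {1..2} \<rightarrow>\<^sub>E UNIV"
  shows "chain_2 (y 1) (y 2) = y"
proof
  fix i :: nat
  consider "i = 1" | "i = 2" | "i \<notin> {1..2}" unfolding atLeastAtMost_1_2 by blast
  then show "chain_2 (y 1) (y 2) i = y i"
  proof cases
    case 3
    then show ?thesis using PiE_arb[OF assms 3] by (simp only: chain_2_def restrict_def if_False)
  qed auto
qed

lemma sum_racah_dom_2:
  fixes f :: "nat \<Rightarrow> nat \<Rightarrow> real"
  shows "(\<Sum>y\<in>racah_dom 2 N. f (y 1) (y 2)) = (\<Sum>y2\<le>N. \<Sum>y1\<le>y2. f y1 y2)"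
  unfolding sum.Sigma[OF finite_atMost ballI[OF finite_atMost]]
proof (rule sum.reindex_bij_witness[of _ "\<lambda>(y2, y1). chain_2 y1 y2" "\<lambda>y. (y 2, y 1)"])
  fix y assume "y \<in> racah_dom 2 N"
  then have y: "y \<in> {1..2} \<rightarrow>\<^sub>E UNIV" "y 1 \<le> y 2" "y 2 \<le> N" unfolding racah_dom_2 by auto
  then show "(y 2, y 1) \<in> (SIGMA y2:{..N}. {..y2})" by simp
  show "(case (y 2, y 1) of (y2, y1) \<Rightarrow> chain_2 y1 y2) = y" using chain_2_eq[OF y(1)] by simp
next
  fix p assume "p \<in> (SIGMA y2:{..N}. {..y2})"
  then show "(case p of (y2, y1) \<Rightarrow> chain_2 y1 y2) \<in> racah_dom 2 N"
    by (auto intro!: chain_2_in)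
qed auto

lemma finite_racah_dom_2: "finite (racah_dom 2 N)"
proof (rule finite_subset)
  show "racah_dom 2 N \<subseteq> (\<lambda>(y2, y1). chain_2 y1 y2) ` (SIGMA y2:{..N}. {..y2})"
  proof
    fix y assume "y \<in> racah_dom 2 N"
    then have y: "y \<in> {1..2} \<rightarrow>\<^sub>E UNIV" "y 1 \<le> y 2" "y 2 \<le> N" unfolding racah_dom_2 by auto
    then show "y \<in> (\<lambda>(y2, y1). chain_2 y1 y2) ` (SIGMA y2:{..N}. {..y2})"
      by (intro image_eqI[of _ _ "(y 2, y 1)"]) (use chain_2_eq[OF y(1)] in auto)
  qed
qed auto

text \<open>The sum over \<open>y1\<close> concerns the first of the two exchanges and the sum over \<open>y2\<close> the second; each is
  an instance of \<open>swap_coeff_orthonormal\<close>.\<close>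

lemma swap_pair_coeff_orthonormal:
  assumes ab: "a > -1" "b > -1" "c > -1" "d > -1" and kj: "k + j \<le> n"
  shows "(\<Sum>y2\<le>n. \<Sum>y1\<le>y2. (swap_pair_coeff n y1 y2 k j a b c d)\<^sup>2 * tree3_norm2 k j (n - k - j) a d c b /
    tree3_norm2 y1 (y2 - y1) (n - y2) a b d c) = 1"
proof -
  define B where "B = a + d + 2 * real k + 1"
  have B: "B > -1" using ab by (simp add: B_def)
  define f where "f m = (swap_coeff (n - k) m j B b c)\<^sup>2 * tree_norm2 (n - k) j B c b / tree_norm2 (n - k) m B b c" for m
  have "(\<Sum>y1\<le>y2. (swap_pair_coeff n y1 y2 k j a b c d)\<^sup>2 * tree3_norm2 k j (n - k - j) a d c b /
    tree3_norm2 y1 (y2 - y1) (n - y2) a b d c) = (if k \<le> y2 then f (y2 - k) else 0)" if y2: "y2 \<le> n" for y2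
  proof (cases "k \<le> y2")
    case True
    have "(swap_pair_coeff n y1 y2 k j a b c d)\<^sup>2 * tree3_norm2 k j (n - k - j) a d c b /
        tree3_norm2 y1 (y2 - y1) (n - y2) a b d c =
      f (y2 - k) * ((swap_coeff y2 y1 k a b d)\<^sup>2 * tree_norm2 y2 k a d b / tree_norm2 y2 y1 a b d)" if y1: "y1 \<le> y2" for y1
    proof -
      define J where "J = jac_norm2 (n - y2) (a + b + d + 2 * real y2 + 2) c"
      have J: "J > 0" unfolding J_def using ab by (intro jac_norm2_pos) auto
      have JB: "jac_norm2 (n - k - (y2 - k)) (B + b + 2 * real (y2 - k) + 1) c = J"
        using True by (simp add: J_def B_def of_nat_diff algebra_simps)
      have 1: "tree3_norm2 y1 (y2 - y1) (n - y2) a b d c = tree_norm2 y2 y1 a b d * J"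
        using y1 by (simp add: tree3_norm2_def tree_norm2_def J_def of_nat_diff algebra_simps)
      have 2: "tree_norm2 y2 k a d b * J = jac_norm2 k a d * tree_norm2 (n - k) (y2 - k) B b c"
        unfolding tree_norm2_def JB by (simp add: B_def)
      have 3: "tree3_norm2 k j (n - k - j) a d c b = jac_norm2 k a d * tree_norm2 (n - k) j B c b"
        by (simp add: tree3_norm2_def tree_norm2_def B_def algebra_simps)
      have nz: "jac_norm2 k a d > 0" "tree_norm2 y2 y1 a b d > 0" "tree_norm2 (n - k) (y2 - k) B b c > 0"
        "tree_norm2 y2 k a d b > 0"
        using ab B by (auto intro!: jac_norm2_pos tree_norm2_pos)
      have "tree_norm2 y2 k a d b = jac_norm2 k a d * tree_norm2 (n - k) (y2 - k) B b c / J"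
        using 2 J by (simp add: field_simps)
      then show ?thesis
        unfolding 1 3 swap_pair_coeff_def f_def B_def[symmetric]
        using True nz J by (simp add: field_simps power2_eq_square)
    qed
    then have "(\<Sum>y1\<le>y2. (swap_pair_coeff n y1 y2 k j a b c d)\<^sup>2 * tree3_norm2 k j (n - k - j) a d c b /
        tree3_norm2 y1 (y2 - y1) (n - y2) a b d c) =
      f (y2 - k) * (\<Sum>y1\<le>y2. (swap_coeff y2 y1 k a b d)\<^sup>2 * tree_norm2 y2 k a d b / tree_norm2 y2 y1 a b d)"
      by (simp add: sum_distrib_left)
    then show ?thesis using swap_coeff_orthonormal[OF ab(1,2,4) True] True by simp
  qed (simp add: swap_pair_coeff_def)
  then have "(\<Sum>y2\<le>n. \<Sum>y1\<le>y2. (swap_pair_coeff n y1 y2 k j a b c d)\<^sup>2 * tree3_norm2 k j (n - k - j) a d c b /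
      tree3_norm2 y1 (y2 - y1) (n - y2) a b d c) = (\<Sum>y2\<le>n. if k \<le> y2 then f (y2 - k) else 0)"
    by simp
  also have "\<dots> = (\<Sum>y2\<in>{k..n}. f (y2 - k))"
    by (intro sum.mono_neutral_cong_right) auto
  also have "\<dots> = (\<Sum>m\<le>n - k. f m)"
    by (rule sum.reindex_bij_witness[of _ "\<lambda>m. m + k" "\<lambda>y. y - k"]) (use kj in auto)
  also have "\<dots> = 1"
    unfolding f_def using kj by (intro swap_coeff_orthonormal[OF B ab(2,3)]) auto
  finally show ?thesis .
qed

text \<open>The \<open>y\<close>-dependence of the weight apart from the squared factor on the right is the inverse of the
  squared norm of the tree \<open>((x y) w) z\<close> with degrees \<open>y1, y2 - y1, n - y2\<close>.\<close>

lemma racah2_weight_reg_times_norm: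
  assumes ab: "a > -1" "b > -1" "c > -1" "d > -1" and y: "y1 \<le> y2" "y2 \<le> n"
    and \<beta>: "\<beta> 0 = b" "\<beta> 1 = a + b + 1" "\<beta> 2 = a + b + d + 2" "\<beta> 3 = a + b + c + d + 3"
  shows "racah2_weight_reg n y1 y2 \<beta> * tree3_norm2 y1 (y2 - y1) (n - y2) a b d c =
    Gamma (a + 1) * Gamma (b + 1) * Gamma (c + 1) * Gamma (d + 1) * pochhammer (\<beta> 3 + 1) (2 * n - 1) / Gamma (\<beta> 3 + 1 + 2 * real n) *
    (pochhammer (a + 1) y1 * pochhammer (d + 1) (y2 - y1) * pochhammer (c + 1) (n - y2) /
     (fact y1 * fact (y2 - y1) * fact (n - y2)))\<^sup>2"
proof -
  define B1 B2 B3 where "B1 = a + b + 1" and "B2 = a + b + d + 2" and "B3 = a + b + c + d + 3"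
  have B: "B1 > -1" "B2 > -1" "B3 > -1" using ab by (simp_all add: B1_def B2_def B3_def)
  have w: "racah2_weight_reg n y1 y2 \<beta> = pochhammer (a + 1) y1 * pochhammer (d + 1) (y2 - y1) *
     pochhammer (c + 1) (n - y2) * well_poised_factor B1 y1 0 * well_poised_factor B2 y2 y1 * pochhammer (B3 + 1) (n + y2 - 1) /
     (fact y1 * fact (y2 - y1) * fact (n - y2) * pochhammer (b + 1) y1 *
     pochhammer (B1 + 1) (y2 + y1) * pochhammer (B2 + 1) (n + y2))"
  proof -
    have "\<beta> 1 - \<beta> 0 = a + 1" "\<beta> 2 - \<beta> 1 = d + 1" "\<beta> 3 - \<beta> 2 = c + 1" unfolding \<beta> by simp_all
    then show ?thesis
      unfolding racah2_weight_reg_def racah2_weight_reg_den_def by (simp only: \<beta> B1_def B2_def B3_def)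
  qed
  have g1: "Gamma (a + 1 + real y1) = pochhammer (a + 1) y1 * Gamma (a + 1)"
    "Gamma (b + 1 + real y1) = pochhammer (b + 1) y1 * Gamma (b + 1)"
    "Gamma (d + 1 + real (y2 - y1)) = pochhammer (d + 1) (y2 - y1) * Gamma (d + 1)"
    "Gamma (c + 1 + real (n - y2)) = pochhammer (c + 1) (n - y2) * Gamma (c + 1)"
    using ab by (auto intro!: Gamma_plus_nat)
  have g2: "Gamma (2 * real y1 + a + b + 2) = pochhammer (B1 + 1) (2 * y1) * Gamma (B1 + 1)"
    using Gamma_plus_nat[of "B1 + 1" "2 * y1"] B by (simp add: B1_def algebra_simps)
  have g3: "Gamma (a + b + 2 * real y1 + 1 + 1 + real (y2 - y1)) = pochhammer (B1 + 1) (y2 + y1) * Gamma (B1 + 1)"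
    using Gamma_plus_nat[of "B1 + 1" "y2 + y1"] B y by (simp add: B1_def of_nat_diff algebra_simps)
  have g4: "Gamma (2 * real (y2 - y1) + (a + b + 2 * real y1 + 1) + d + 2) = pochhammer (B2 + 1) (2 * y2) * Gamma (B2 + 1)"
    using Gamma_plus_nat[of "B2 + 1" "2 * y2"] B y by (simp add: B2_def of_nat_diff algebra_simps)
  have g5: "Gamma (a + b + d + 2 * real y1 + 2 * real (y2 - y1) + 2 + 1 + real (n - y2)) =
      pochhammer (B2 + 1) (n + y2) * Gamma (B2 + 1)"
    using Gamma_plus_nat[of "B2 + 1" "n + y2"] B y by (simp add: B2_def of_nat_diff algebra_simps)
  have g6: "Gamma (2 * real (n - y2) + (a + b + d + 2 * real y1 + 2 * real (y2 - y1) + 2) + c + 2) =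
      Gamma (B3 + 1 + 2 * real n)"
    using y by (simp add: B3_def of_nat_diff algebra_simps)
  have p1: "pochhammer (real y1 + a + b + 1) y1 = pochhammer (B1 + real y1) y1" by (simp add: B1_def add_ac)
  have p2: "pochhammer (real (y2 - y1) + (a + b + 2 * real y1 + 1) + d + 1) (y2 - y1) = pochhammer (B2 + real y2 + real y1) (y2 - y1)"
    using y by (simp add: B2_def of_nat_diff algebra_simps)
  have p3: "pochhammer (real (n - y2) + (a + b + d + 2 * real y1 + 2 * real (y2 - y1) + 2) + c + 1) (n - y2) =
      pochhammer (B3 + real n + real y2) (n - y2)"
    using y by (simp add: B3_def of_nat_diff algebra_simps)
  have q1: "pochhammer (B1 + 1) (2 * y1) = well_poised_factor B1 y1 0 * pochhammer (B1 + real y1) y1"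
    using well_poised_factor_times_pochhammer[of 0 y1 B1] by simp
  have q2: "pochhammer (B2 + 1) (2 * y2) = well_poised_factor B2 y2 y1 * pochhammer (B2 + real y2 + real y1) (y2 - y1)"
    using well_poised_factor_times_pochhammer[OF y(1), of B2] by simp
  have q3: "pochhammer (B3 + 1) (2 * n - 1) = pochhammer (B3 + 1) (n + y2 - 1) * pochhammer (B3 + real n + real y2) (n - y2)"
  proof (cases n)
    case (Suc r)
    have e: "r + y2 + (n - y2) = 2 * n - 1" "B3 + 1 + real (r + y2) = B3 + real n + real y2" "n + y2 - 1 = r + y2"
      using y Suc by simp_all
    show ?thesis
      using pochhammer_product'[of "B3 + 1" "r + y2" "n - y2"] unfolding e .
  qed (use y in simp)
  have nz: "pochhammer (b + 1) y1 \<noteq> 0" "pochhammer (B1 + 1) (y2 + y1) \<noteq> 0" "pochhammer (B2 + 1) (n + y2) \<noteq> 0"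
    "pochhammer (B1 + 1) (2 * y1) \<noteq> 0" "pochhammer (B2 + 1) (2 * y2) \<noteq> 0"
    using ab B by (auto intro!: pochhammer_neq_0_if_pos)
  have nz2: "well_poised_factor B1 y1 0 \<noteq> 0" "pochhammer (B1 + real y1) y1 \<noteq> 0" "well_poised_factor B2 y2 y1 \<noteq> 0"
    "pochhammer (B2 + real y2 + real y1) (y2 - y1) \<noteq> 0"
    using nz(4,5) unfolding q1 q2 by auto
  have nz3: "Gamma (B1 + 1) > 0" "Gamma (B2 + 1) > 0" using B by (auto intro!: Gamma_real_pos)
  have cancel: "A * D * C * v1 * v2 * P / (f1 * f2 * f3 * b * x1 * x2) *
      (A * Ga * (b * Gb) * p1 / (f1 * (v1 * p1 * g1)) * (x1 * g1 * (D * Gd) * p2 / (f2 * (v2 * p2 * g2))) *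
       (x2 * g2 * (C * Gc) * p3 / (f3 * G))) =
      Ga * Gb * Gc * Gd * (P * p3) / G * (A * D * C / (f1 * f2 * f3))\<^sup>2"
    if "b \<noteq> 0" "x1 \<noteq> 0" "x2 \<noteq> 0" "v1 \<noteq> 0" "p1 \<noteq> 0" "v2 \<noteq> 0" "p2 \<noteq> 0" "g1 \<noteq> 0" "g2 \<noteq> 0"
    for A D C v1 v2 P f1 f2 f3 b x1 x2 Ga Gb Gc Gd p1 p2 p3 g1 g2 G :: real
    using that by (simp add: power2_eq_square mult_ac)
  show ?thesis
    unfolding w tree3_norm2_def jac_norm2_def g1 g2 g3 g4 g5 g6 p1 p2 p3 q1 q2 \<beta>(4) B3_def[symmetric] q3
    by (rule cancel) (use nz nz2 nz3 in auto)
qed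

text \<open>The duality \<open>racah_4F3_dual\<close> brings the two \<open>\<^sub>4F\<^sub>3\<close> into the form in which \<open>k\<close> and \<open>j\<close> are the degrees.
  The factors \<open>(a + d + 2 k + 2)\<^bsub>y2-k\<^esub>\<close> and \<open>(y2 - k)!\<close> of the two exchanges cancel, so that \<open>k\<close>, \<open>j\<close> and \<open>y1\<close>, \<open>y2\<close>
  separate outside the Racah polynomial.\<close>

lemma swap_pair_coeff_eq_racah2_poly:
  assumes ab: "a > -1" "b > -1" "c > -1" "d > -1" and y: "y1 \<le> y2" "y2 \<le> n" and kj: "k + j \<le> n"
    and \<beta>: "\<beta> 0 = b" "\<beta> 1 = a + b + 1" "\<beta> 2 = a + b + d + 2" "\<beta> 3 = a + b + c + d + 3"
  shows "swap_pair_coeff n y1 y2 k j a b c d = (-1) ^ (n - y1) *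
    (fact (n - k - j) / (pochhammer (a + 1) k * pochhammer (d + 1) k * pochhammer (a + d + 1 + real k) k *
       pochhammer (a + d + 2 * real k + 2) j * pochhammer (c + 1) j *
       pochhammer (a + d + 2 * real k + 1 + c + 1 + real j) j *
       pochhammer (a + d + 2 * real k + 1 + c + 2 * real j + 2) (n - k - j))) *
    (pochhammer (a + 1) y1 * pochhammer (d + 1) (y2 - y1) * pochhammer (c + 1) (n - y2) /
     (fact y1 * fact (y2 - y1) * fact (n - y2))) * racah2_poly n k j y1 y2 \<beta>"
proof (cases "k \<le> y2")
  case False
  then have "hyp_4F3_reg k A (- real y1) C u v (- real y2) = 0" for A C u v
    using y by (intro hyp_4F3_reg_eq_0) auto
  then show ?thesis using False by (simp add: swap_pair_coeff_def racah2_poly_def)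
next
  case True
  define B where "B = a + d + 2 * real k + 1"
  have B: "B > -1" using ab by (simp add: B_def)
  define F1 where "F1 = racah_4F3 y2 y1 k a b d"
  define F2 where "F2 = racah_4F3 (n - k) (y2 - k) j B b c"
  define V1 where "V1 = pochhammer (real y2 + a + b + d + 2) k"
  define V2 where "V2 = pochhammer (real (n - k) + B + b + c + 2) j"
  have V1: "V1 \<noteq> 0" unfolding V1_def using pochhammer_top_neq_0[OF ab(1,2,4) True] .
  have V2: "V2 \<noteq> 0" unfolding V2_def using pochhammer_top_neq_0[OF B ab(2,3), of j "n - k"] kj by simp
  have t1: "pochhammer (- real y2) k = (-1) ^ k * fact y2 / fact (y2 - k)"
    by (rule pochhammer_neg_of_nat[OF True])
  have t2: "pochhammer (- real (n - k)) j = (-1) ^ j * fact (n - k) / fact (n - k - j)"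
    using kj by (intro pochhammer_neg_of_nat) auto
  have u: "pochhammer (a + 1) k \<noteq> 0" "pochhammer (B + 1) j \<noteq> 0" "pochhammer (B + 1) (y2 - k) \<noteq> 0"
    using ab B by (auto intro!: pochhammer_neq_0_if_pos)
  have R1: "hyp_4F3_reg k (real k + \<beta> 2 - \<beta> 0 - 1) (- real y1) (\<beta> 1 + real y1) (\<beta> 1 - \<beta> 0) (\<beta> 2 + real y2) (- real y2) =
     pochhammer (a + 1) k * V1 * ((-1) ^ k * fact y2 / fact (y2 - k)) * F1"
  proof -
    have e: "real k + \<beta> 2 - \<beta> 0 - 1 = real k + a + d + 1" "\<beta> 1 + real y1 = real y1 + a + b + 1" "\<beta> 1 - \<beta> 0 = a + 1"
      "\<beta> 2 + real y2 = real y2 + a + d + b + 2"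
      unfolding \<beta> by simp_all
    have V1': "V1 = pochhammer (real y2 + a + d + b + 2) k" by (simp add: V1_def add_ac)
    have "F1 = hyp_4F3 k (real k + a + d + 1) (- real y1) (real y1 + a + b + 1) (- real y2) (real y2 + a + d + b + 2) (a + 1)"
      unfolding F1_def by (rule racah_4F3_dual[OF y(1) True])
    also have "\<dots> = hyp_4F3 k (real k + a + d + 1) (- real y1) (real y1 + a + b + 1) (a + 1) (real y2 + a + d + b + 2) (- real y2)"
      unfolding hyp_4F3_def by (simp add: mult_ac)
    finally have F1: "F1 = \<dots>" .
    show ?thesis
      unfolding e F1 V1' t1[symmetric]
      by (rule hyp_4F3_reg_eq) (use u V1 V1' True in \<open>auto simp: pochhammer_of_nat_eq_0_iff\<close>)
  qed
  have R2: "hyp_4F3_reg j (real j + 2 * real k + \<beta> 3 - \<beta> 0 - 1) (real k - real y2) (real k + \<beta> 2 + real y2)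
       (2 * real k + \<beta> 2 - \<beta> 0) (real k + \<beta> 3 + real n) (real k - real n) =
     pochhammer (B + 1) j * V2 * ((-1) ^ j * fact (n - k) / fact (n - k - j)) * F2"
  proof -
    have e: "real j + 2 * real k + \<beta> 3 - \<beta> 0 - 1 = real j + B + c + 1" "real k - real y2 = - real (y2 - k)"
      "real k + \<beta> 2 + real y2 = real (y2 - k) + B + b + 1" "2 * real k + \<beta> 2 - \<beta> 0 = B + 1"
      "real k + \<beta> 3 + real n = real (n - k) + B + c + b + 2" "real k - real n = - real (n - k)"
      using True kj unfolding \<beta> by (simp_all add: B_def of_nat_diff)
    have V2': "V2 = pochhammer (real (n - k) + B + c + b + 2) j" by (simp add: V2_def add_ac)
    have "F2 = hyp_4F3 j (real j + B + c + 1) (- real (y2 - k)) (real (y2 - k) + B + b + 1) (- real (n - k)) (real (n - k) + B + c + b + 2) (B + 1)"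
      unfolding F2_def by (rule racah_4F3_dual) (use y kj in auto)
    also have "\<dots> = hyp_4F3 j (real j + B + c + 1) (- real (y2 - k)) (real (y2 - k) + B + b + 1) (B + 1) (real (n - k) + B + c + b + 2) (- real (n - k))"
      unfolding hyp_4F3_def by (simp add: mult_ac)
    finally have F2: "F2 = \<dots>" .
    have nz: "pochhammer (- real (n - k)) j \<noteq> 0" using kj by (subst pochhammer_of_nat_eq_0_iff) auto
    show ?thesis
      unfolding e F2 V2' t2[symmetric]
      by (rule hyp_4F3_reg_eq) (use u V2 V2' nz in auto)
  qed
  have sign: "(-1 :: real) ^ (y2 - y1 + k) * (-1) ^ (n - k - (y2 - k) + j) = (-1) ^ (n - y1) * (-1) ^ k * (-1) ^ j"
  proof -
    have "n - y1 = (y2 - y1) + (n - k - (y2 - k))" using y True by simp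
    then show ?thesis by (simp only: power_add mult_ac)
  qed
  have Bk: "a + d + 2 * real k + 2 = B + 1" by (simp add: B_def)
  have bin1: "real (y2 choose y1) = fact y2 / (fact y1 * fact (y2 - y1))" using y by (simp add: binomial_fact)
  have bin2: "real ((n - k) choose (y2 - k)) = fact (n - k) / (fact (y2 - k) * fact (n - y2))"
    using y True by (simp add: binomial_fact)
  have nk: "n - k - (y2 - k) = n - y2" using y True by simp
  have "swap_pair_coeff n y1 y2 k j a b c d = ((-1) ^ (y2 - y1 + k) * (-1) ^ (n - k - (y2 - k) + j)) *
     (real (y2 choose y1) * pochhammer (d + 1) (y2 - y1) * pochhammer (a + 1) y1 * V1 /
      (pochhammer (d + 1) k * pochhammer (a + d + 1 + real k) k * pochhammer (B + 1) (y2 - k)) * F1) *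
     (real ((n - k) choose (y2 - k)) * pochhammer (c + 1) (n - y2) * pochhammer (B + 1) (y2 - k) * V2 /
      (pochhammer (c + 1) j * pochhammer (B + c + 1 + real j) j * pochhammer (B + c + 2 * real j + 2) (n - k - j)) * F2)"
    using True unfolding swap_pair_coeff_def swap_coeff_def B_def[symmetric] F1_def[symmetric] F2_def[symmetric] V1_def[symmetric] V2_def[symmetric] Bk nk
    by (simp add: mult_ac)
  also have "\<dots> = (-1) ^ (n - y1) *
    (fact (n - k - j) / (pochhammer (a + 1) k * pochhammer (d + 1) k * pochhammer (a + d + 1 + real k) k *
       pochhammer (B + 1) j * pochhammer (c + 1) j * pochhammer (B + c + 1 + real j) j *
       pochhammer (B + c + 2 * real j + 2) (n - k - j))) *
    (pochhammer (a + 1) y1 * pochhammer (d + 1) (y2 - y1) * pochhammer (c + 1) (n - y2) /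
     (fact y1 * fact (y2 - y1) * fact (n - y2))) *
    ((pochhammer (a + 1) k * V1 * ((-1) ^ k * fact y2 / fact (y2 - k)) * F1) *
     (pochhammer (B + 1) j * V2 * ((-1) ^ j * fact (n - k) / fact (n - k - j)) * F2))"
    unfolding sign bin1 bin2 using u by (simp add: mult_ac)
  finally show ?thesis
    unfolding racah2_poly_def R1 R2 Bk B_def[symmetric] by (simp add: add_ac)
qed

lemma isCont_coordinate: "isCont (\<lambda>\<beta>. \<beta> i) (p :: nat \<Rightarrow> real)"
  using continuous_on_eq_continuous_at[OF open_UNIV, of "\<lambda>\<beta> :: nat \<Rightarrow> real. \<beta> i"] by simp

lemma isCont_racah2_poly: "isCont (racah2_poly N k j y1 y2) p"
  unfolding racah2_poly_def hyp_4F3_reg_def by (intro continuous_intros isCont_coordinate) auto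

lemma isCont_racah2_weight_reg_den: "isCont (racah2_weight_reg_den N y1 y2) p"
  unfolding racah2_weight_reg_den_def by (intro continuous_intros isCont_coordinate)

lemma isCont_racah2_weight_reg:
  assumes "racah2_weight_reg_den N y1 y2 p \<noteq> 0"
  shows "isCont (racah2_weight_reg N y1 y2) p"
  unfolding racah2_weight_reg_def using assms
  by (intro continuous_intros isCont_coordinate isCont_racah2_weight_reg_den)

text \<open>Singularities occur only for \<open>\<beta>\<^sub>1 = 0\<close>, \<open>\<beta>\<^sub>2 = 0\<close> or \<open>\<beta>\<^sub>3 = 0\<close>; increasing all parameters by
  the same amount leaves this set.\<close>

theorem racah_fun_eq:
  assumes ab: "a > -1" "b > -1" "c > -1" "d > -1" and x: "x 1 \<le> x 2" "x 2 \<le> n" and kj: "k + j \<le> n"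
    and \<nu>: "\<nu> 1 = k" "\<nu> 2 = j"
    and \<beta>: "\<beta> 0 = b" "\<beta> 1 = a + b + 1" "\<beta> 2 = a + b + d + 2" "\<beta> 3 = a + b + c + d + 3"
  shows "racah_fun 2 n \<nu> x \<beta> = (-1) ^ (n - x 1) * swap_pair_coeff n (x 1) (x 2) k j a b c d *
    sqrt (tree3_norm2 k j (n - k - j) a d c b / tree3_norm2 (x 1) (x 2 - x 1) (n - x 2) a b d c)"
proof -
  define W where "W y = racah2_weight_reg n (y 1) (y 2)" for y :: "nat \<Rightarrow> nat"
  define R where "R y = racah2_poly n k j (y 1) (y 2)" for y :: "nat \<Rightarrow> nat"
  define norm2 where "norm2 \<beta> = (\<Sum>y\<in>racah_dom 2 n. W y \<beta> * (R y \<beta>)\<^sup>2)" for \<beta>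
  define H where "H y = tree3_norm2 (y 1) (y 2 - y 1) (n - y 2) a b d c" for y :: "nat \<Rightarrow> nat"
  define Hm where "Hm = tree3_norm2 k j (n - k - j) a d c b"
  define C where "C y = swap_pair_coeff n (y 1) (y 2) k j a b c d" for y :: "nat \<Rightarrow> nat"
  define q where "q = Gamma (a + 1) * Gamma (b + 1) * Gamma (c + 1) * Gamma (d + 1) * pochhammer (\<beta> 3 + 1) (2 * n - 1) / Gamma (\<beta> 3 + 1 + 2 * real n)"
  define p where "p y = pochhammer (a + 1) (y 1) * pochhammer (d + 1) (y 2 - y 1) * pochhammer (c + 1) (n - y 2) /
     (fact (y 1) * fact (y 2 - y 1) * fact (n - y 2))" for y :: "nat \<Rightarrow> nat"
  define g where "g = fact (n - k - j) / (pochhammer (a + 1) k * pochhammer (d + 1) k * pochhammer (a + d + 1 + real k) k *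
       pochhammer (a + d + 2 * real k + 2) j * pochhammer (c + 1) j *
       pochhammer (a + d + 2 * real k + 1 + c + 1 + real j) j *
       pochhammer (a + d + 2 * real k + 1 + c + 2 * real j + 2) (n - k - j))"
  have dom: "y 1 \<le> y 2 \<and> y 2 \<le> n" if "y \<in> racah_dom 2 n" for y
    using that unfolding racah_dom_2 by simp
  have \<beta>3: "\<beta> 3 + 1 > 0" using ab unfolding \<beta> by simp
  have H_pos: "H y > 0" if "y \<in> racah_dom 2 n" for y unfolding H_def using ab by (intro tree3_norm2_pos)
  have Hm_pos: "Hm > 0" unfolding Hm_def using ab by (intro tree3_norm2_pos)
  have q_pos: "q > 0"
    unfolding q_def using ab \<beta>3 by (intro divide_pos_pos mult_pos_pos Gamma_real_pos pochhammer_pos) auto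
  have p_pos: "p y > 0" if "y \<in> racah_dom 2 n" for y
    unfolding p_def using ab by (intro divide_pos_pos mult_pos_pos pochhammer_pos) auto
  have g_pos: "g > 0"
  proof -
    have "pochhammer (a + d + 1 + real k) k > 0" using ab by (cases k) (auto intro!: pochhammer_pos)
    moreover have "pochhammer (a + d + 2 * real k + 1 + c + 1 + real j) j > 0"
      using ab by (cases j) (auto intro!: pochhammer_pos)
    ultimately show ?thesis
      unfolding g_def using ab
      by (intro divide_pos_pos mult_pos_pos) (auto intro!: pochhammer_pos)
  qed
  have weight: "W y \<beta> * H y = q * (p y)\<^sup>2" if "y \<in> racah_dom 2 n" for y
    unfolding W_def H_def q_def p_def using dom[OF that] by (intro racah2_weight_reg_times_norm ab \<beta>) auto
  have conn: "C y = (-1) ^ (n - y 1) * g * p y * R y \<beta>" if "y \<in> racah_dom 2 n" for y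
    unfolding C_def g_def p_def R_def using dom[OF that] by (intro swap_pair_coeff_eq_racah2_poly ab kj \<beta>) auto
  have sign: "((-1) ^ (n - y 1) :: real)\<^sup>2 = 1" if "y \<in> racah_dom 2 n" for y
    by (simp flip: power_mult)
  have orth: "(\<Sum>y\<in>racah_dom 2 n. (C y)\<^sup>2 * Hm / H y) = 1"
    unfolding C_def Hm_def H_def
    using sum_racah_dom_2[of "\<lambda>y1 y2. (swap_pair_coeff n y1 y2 k j a b c d)\<^sup>2 * tree3_norm2 k j (n - k - j) a d c b /
      tree3_norm2 y1 (y2 - y1) (n - y2) a b d c" n] swap_pair_coeff_orthonormal[OF ab kj] by simp
  have norm2_pos: "norm2 \<beta> > 0" unfolding norm2_def
    by (intro normalized_weight(1)[where H = H and Hm = Hm and C = C and e = "\<lambda>y. (-1) ^ (n - y 1)" and q = q and g = g and p = p]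
        finite_racah_dom_2 H_pos Hm_pos q_pos g_pos p_pos weight conn sign orth)
  have main: "R x \<beta> * sqrt (W x \<beta> / norm2 \<beta>) = (-1) ^ (n - x 1) * C x * sqrt (Hm / H x)"
  proof -
    \<comment> \<open>Only the first two entries of \<open>x\<close> matter; \<open>x'\<close> is the representative that is summed over.\<close>
    define x' where "x' = chain_2 (x 1) (x 2)"
    have "x' \<in> racah_dom 2 n" unfolding x'_def using x by (rule chain_2_in)
    then have "R x' \<beta> * sqrt (W x' \<beta> / norm2 \<beta>) = (-1) ^ (n - x' 1) * C x' * sqrt (Hm / H x')"
      unfolding norm2_def
      by (intro normalized_weight(2)[where H = H and Hm = Hm and C = C and e = "\<lambda>y. (-1) ^ (n - y 1)" and q = q and g = g and p = p] finite_racah_dom_2 H_pos Hm_pos q_pos g_pos p_pos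
          weight conn sign orth)
    then show ?thesis by (simp add: R_def W_def C_def H_def x'_def)
  qed
  have poly: "racah_poly 2 n \<nu> y = R y" for y
    unfolding R_def by (rule ext) (simp only: racah_poly_2 \<nu>)
  have weight_eq: "racah_weight 2 n y \<gamma> = (if n = 0 then 1 else \<gamma> 3) * W y \<gamma>"
    if "racah_weight_den 2 n y \<gamma> \<noteq> 0" "y 1 \<le> y 2" "y 2 \<le> n" for y \<gamma>
    using racah_weight_2[OF that] by (simp only: W_def)
  have norm2_eq: "racah_norm2 2 n \<nu> \<gamma> = (if n = 0 then 1 else \<gamma> 3) * norm2 \<gamma>"
    if "\<forall>y\<in>racah_dom 2 n. racah_weight_den 2 n y \<gamma> \<noteq> 0" for \<gamma>
    unfolding racah_norm2_def norm2_def sum_distrib_left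
  proof (intro sum.cong refl)
    fix y assume y: "y \<in> racah_dom 2 n"
    then show "racah_weight 2 n y \<gamma> * (racah_poly 2 n \<nu> y \<gamma>)\<^sup>2 = (if n = 0 then 1 else \<gamma> 3) * (W y \<gamma> * (R y \<gamma>)\<^sup>2)"
      using weight_eq[of y \<gamma>] that dom[OF y] by (simp add: poly)
  qed
  have den_nz: "racah2_weight_reg_den n (y 1) (y 2) \<beta> \<noteq> 0" for y :: "nat \<Rightarrow> nat"
    unfolding racah2_weight_reg_den_def \<beta> using ab by (auto simp: pochhammer_neq_0_if_pos)
  have cont_R: "isCont (R y) \<beta>" for y unfolding R_def by (rule isCont_racah2_poly)
  have cont_W: "isCont (W y) \<beta>" for y unfolding W_def by (rule isCont_racah2_weight_reg[OF den_nz])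
  have cont_norm: "isCont norm2 \<beta>"
    unfolding norm2_def by (intro continuous_intros cont_R cont_W)
  define path where "path t = (\<lambda>i. \<beta> i + t)" for t :: real
  have "continuous_on UNIV path"
    unfolding path_def by (intro continuous_on_coordinatewise_then_product continuous_intros)
  then have "isCont path 0" by (simp add: continuous_on_eq_continuous_at)
  then have "(path \<longlongrightarrow> path 0) (at 0)" by (simp add: isCont_def)
  then have "(path \<longlongrightarrow> path 0) (at_right 0)" by (rule tendsto_within_subset) simp
  then have lim: "(path \<longlongrightarrow> \<beta>) (at_right 0)" by (simp add: path_def)
  have "racah_fun 2 n \<nu> x \<beta> = R x \<beta> * sqrt (W x \<beta> / norm2 \<beta>)"
    unfolding racah_fun_def
  proof (rule cont_ext_eq[OF _ _ lim])
    fix \<gamma> assume \<gamma>: "\<gamma> \<in> racah_regular 2 n \<nu>"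
    then have den: "\<forall>y\<in>racah_dom 2 n. racah_weight_den 2 n y \<gamma> \<noteq> 0" and nz: "racah_norm2 2 n \<nu> \<gamma> \<noteq> 0"
      by (auto simp: racah_regular_def)
    have "racah_weight_den 2 n x \<gamma> = racah_weight_den 2 n (chain_2 (x 1) (x 2)) \<gamma>"
      by (simp add: racah_weight_den_2)
    then have "racah_weight_den 2 n x \<gamma> \<noteq> 0"
      using den chain_2_in[OF x] by simp
    then show "racah_poly 2 n \<nu> x \<gamma> * sqrt (racah_weight 2 n x \<gamma> / racah_norm2 2 n \<nu> \<gamma>) = R x \<gamma> * sqrt (W x \<gamma> / norm2 \<gamma>)"
      using nz unfolding norm2_eq[OF den] by (simp add: weight_eq[OF _ x] poly)
  next
    show "isCont (\<lambda>\<gamma>. R x \<gamma> * sqrt (W x \<gamma> / norm2 \<gamma>)) \<beta>"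
      using norm2_pos by (intro continuous_intros cont_R cont_W cont_norm) auto
  next
    have along: "\<forall>\<^sub>F t in at_right 0. F (path t) \<noteq> 0" if "isCont F \<beta>" "F \<beta> \<noteq> 0" for F :: "_ \<Rightarrow> real"
      using isCont_tendsto_compose[OF that(1) lim] that(2) by (rule tendsto_imp_eventually_ne)
    have "\<forall>\<^sub>F t in at_right 0. racah2_weight_reg_den n (y 1) (y 2) (path t) \<noteq> 0" for y :: "nat \<Rightarrow> nat"
      by (rule along[OF isCont_racah2_weight_reg_den den_nz])
    then have "\<forall>\<^sub>F t in at_right 0. \<forall>y\<in>racah_dom 2 n. racah2_weight_reg_den n (y 1) (y 2) (path t) \<noteq> 0"
      using finite_racah_dom_2 by (intro eventually_ball_finite) auto
    moreover have "\<forall>\<^sub>F t in at_right 0. norm2 (path t) \<noteq> 0"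
      using along[OF cont_norm] norm2_pos by simp
    moreover have "\<forall>\<^sub>F t in at_right 0. \<beta> i + t \<noteq> 0" for i
      using eventually_neq_at_within[of "- \<beta> i" 0 "{0<..}"] by eventually_elim auto
    then have "\<forall>\<^sub>F t in at_right 0. \<beta> 1 + t \<noteq> 0 \<and> \<beta> 2 + t \<noteq> 0 \<and> \<beta> 3 + t \<noteq> 0"
      by (intro eventually_conj)
    moreover have "\<forall>\<^sub>F t in at_right 0. t > (0::real)"
      by (rule eventually_at_right_less)
    ultimately show "\<forall>\<^sub>F t in at_right 0. path t \<in> racah_regular 2 n \<nu> \<and> path t \<noteq> \<beta>"
    proof eventually_elim
      case (elim t)
      have "\<beta> 1 + t > -1" "\<beta> 2 + t > -1" using elim ab unfolding \<beta> by auto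
      then have half: "pochhammer (path t 1 / 2) u \<noteq> 0" "pochhammer (path t 2 / 2) u \<noteq> 0" for u
        using elim unfolding path_def by (simp_all add: pochhammer_half_neq_0 del: One_nat_def)
      have den: "\<forall>y\<in>racah_dom 2 n. racah_weight_den 2 n y (path t) \<noteq> 0"
        using elim half by (simp add: racah_weight_den_2)
      moreover have "racah_norm2 2 n \<nu> (path t) \<noteq> 0"
        using elim unfolding norm2_eq[OF den] by (simp add: path_def)
      moreover have "path t \<noteq> \<beta>" using elim by (auto simp: path_def fun_eq_iff)
      ultimately show ?case by (simp add: racah_regular_def)
    qed
  qed
  also note main
  finally show ?thesis by (simp only: C_def H_def Hm_def)
qed

section \<open>The connection coefficients as a sum of Racah polynomials\<close>

lemma list_vec_pair: "list_vec [u, v] 1 = u" "list_vec [u, v] 2 = v"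
  by (simp_all add: list_vec_def)

theorem proposition5p7:
  fixes \<kappa> :: "nat \<Rightarrow> real" and \<nu> \<mu> :: "nat \<Rightarrow> nat" and n :: nat
  assumes "\<forall>i\<in>{1..4}. \<kappa> i > -1"
    and "\<nu> \<in> multi_indices 3 n" and "\<mu> \<in> multi_indices 3 n"
  shows "conn_coeff_hat 3 (Transposition.transpose 1 3) \<kappa> \<nu> \<mu> =
    (let K = (\<Sum>i=1..4. \<kappa> i);
         \<sigma> = (- real n + real (\<nu> 3) - 1,
              real n + real (\<nu> 3) + K - \<kappa> 3 + 2,
              \<kappa> 1 + \<kappa> 4 + 2 * real (\<nu> 3) + 1,
              \<kappa> 3);
         \<beta> = (\<lambda>j. [\<kappa> 1, \<kappa> 1 + \<kappa> 4 + 1, \<kappa> 1 + \<kappa> 3 + \<kappa> 4 + 2, K + 3] ! j)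
     in (-1) ^ \<nu> 2 *
        (\<Sum>l=0..n - \<nu> 3. (-1) ^ l * racah1_fun (n - \<nu> 3) (\<nu> 2) l \<sigma> *
           racah_fun 2 n (list_vec [\<mu> 3, \<mu> 2]) (list_vec [\<nu> 3, l + \<nu> 3]) \<beta>))"
proof -
  define a b c d where "a = \<kappa> 4" and "b = \<kappa> 1" and "c = \<kappa> 2" and "d = \<kappa> 3"
  have ab: "a > -1" "b > -1" "c > -1" "d > -1"
    using assms(1) by (auto simp: a_def b_def c_def d_def)
  define K where "K = (\<Sum>i=1..4. \<kappa> i)"
  have K: "K = a + b + c + d"
  proof -
    have "{1..4::nat} = {1, 2, 3, 4}" by auto
    then show ?thesis by (simp add: K_def a_def b_def c_def d_def)
  qed
  have \<nu>: "\<nu> 1 + \<nu> 2 + \<nu> 3 = n" and \<mu>: "\<mu> 1 + \<mu> 2 + \<mu> 3 = n"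
    using assms(2,3) by (auto simp: multi_indices_3)
  define N where "N = n - \<nu> 3"
  \<comment> \<open>The branch \<open>x\<^sub>4 + x\<^sub>1\<close>, of degree \<open>\<nu> 3\<close>, counts as one variable with exponent \<open>A\<close>.\<close>
  define A where "A = a + b + 2 * real (\<nu> 3) + 1"
  have A: "A > -1" using ab by (simp add: A_def)
  have n: "n = N + \<nu> 3" using \<nu> by (simp add: N_def)
  define \<sigma> where "\<sigma> = (- real n + real (\<nu> 3) - 1, real n + real (\<nu> 3) + K - \<kappa> 3 + 2,
              \<kappa> 1 + \<kappa> 4 + 2 * real (\<nu> 3) + 1, \<kappa> 3)"
  have \<sigma>: "\<sigma> = (- real N - 1, real N + A + c + 1, A, d)"
    by (simp add: \<sigma>_def n K A_def a_def b_def c_def d_def)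
  define \<beta> where "\<beta> = (\<lambda>j. [\<kappa> 1, \<kappa> 1 + \<kappa> 4 + 1, \<kappa> 1 + \<kappa> 3 + \<kappa> 4 + 2, K + 3] ! j)"
  have \<beta>: "\<beta> 0 = b" "\<beta> 1 = a + b + 1" "\<beta> 2 = a + b + d + 2" "\<beta> 3 = a + b + c + d + 3"
    by (simp_all add: \<beta>_def K a_def b_def d_def)
  define H\<nu> where "H\<nu> = tree3_norm2 (\<nu> 3) (\<nu> 2) (\<nu> 1) a b c d"
  define H\<mu> where "H\<mu> = tree3_norm2 (\<mu> 3) (\<mu> 2) (\<mu> 1) a d c b"
  define Hl where "Hl l = tree3_norm2 (\<nu> 3) l (N - l) a b d c" for l
  define c1 where "c1 l = swap_coeff N (\<nu> 2) l A c d" for l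
  define c2 where "c2 l = swap_pair_coeff n (\<nu> 3) (\<nu> 3 + l) (\<mu> 3) (\<mu> 2) a b c d" for l
  have H_pos: "H\<nu> > 0" "H\<mu> > 0" "Hl l > 0" for l
    unfolding H\<nu>_def H\<mu>_def Hl_def by (intro tree3_norm2_pos ab)+
  have norms: "simplex_jacobi_norm2 3 \<kappa> \<mu> / simplex_jacobi_norm2 3 (\<kappa> \<circ> swap13) \<nu> = H\<mu> / H\<nu>"
  proof -
    have \<kappa>': "\<forall>i\<in>{1..4}. (\<kappa> \<circ> swap13) i > -1" using assms(1) by (auto simp: Transposition.transpose_def)
    have t: "(\<kappa> \<circ> swap13) 1 = \<kappa> 3" "(\<kappa> \<circ> swap13) 2 = \<kappa> 2" "(\<kappa> \<circ> swap13) 3 = \<kappa> 1" "(\<kappa> \<circ> swap13) 4 = \<kappa> 4"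
      by (auto simp: Transposition.transpose_def)
    define G where "G = Gamma (a + b + c + d + 4) / (Gamma (a + 1) * Gamma (b + 1) * Gamma (c + 1) * Gamma (d + 1))"
    have G: "G > 0" unfolding G_def
      using ab by (intro divide_pos_pos mult_pos_pos Gamma_real_pos) auto
    have "simplex_jacobi_norm2 3 \<kappa> \<mu> = G * H\<mu>"
      unfolding simplex_jacobi_norm2_3[OF assms(1)] H\<mu>_def G_def a_def b_def c_def d_def by (simp add: add_ac mult_ac)
    moreover have "simplex_jacobi_norm2 3 (\<kappa> \<circ> swap13) \<nu> = G * H\<nu>"
      unfolding simplex_jacobi_norm2_3[OF \<kappa>'] t H\<nu>_def G_def a_def b_def c_def d_def by (simp add: add_ac mult_ac)
    ultimately show ?thesis using G by simp
  qed
  have lhs: "conn_coeff_hat 3 swap13 \<kappa> \<nu> \<mu> = (\<Sum>l\<le>N. sqrt (H\<mu> / H\<nu>) * (c1 l * c2 l))"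
    unfolding conn_coeff_hat_def norms conn_coeff_13[OF assms] reverse_coeff_def sum_distrib_left
    by (simp add: c1_def c2_def N_def A_def a_def b_def c_def d_def)
  have "(-1) ^ \<nu> 2 * ((-1) ^ l * racah1_fun N (\<nu> 2) l \<sigma> *
      racah_fun 2 n (list_vec [\<mu> 3, \<mu> 2]) (list_vec [\<nu> 3, l + \<nu> 3]) \<beta>) = sqrt (H\<mu> / H\<nu>) * (c1 l * c2 l)"
    if l: "l \<le> N" for l
  proof -
    define J where "J = jac_norm2 (\<nu> 3) a b"
    have J: "J > 0" unfolding J_def using ab by (intro jac_norm2_pos)
    have "N - \<nu> 2 = \<nu> 1" using \<nu> by (simp add: N_def)
    then have H\<nu>: "H\<nu> = J * tree_norm2 N (\<nu> 2) A c d"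
      by (simp add: H\<nu>_def J_def tree3_norm2_def tree_norm2_def A_def algebra_simps)
    have Hl: "Hl l = J * tree_norm2 N l A d c"
      by (simp add: Hl_def J_def tree3_norm2_def tree_norm2_def A_def algebra_simps)
    have ratio: "tree_norm2 N l A d c / tree_norm2 N (\<nu> 2) A c d = Hl l / H\<nu>"
      unfolding H\<nu> Hl using J by simp
    have f1: "racah1_fun N (\<nu> 2) l \<sigma> = (-1) ^ (N - l + \<nu> 2) * c1 l * sqrt (Hl l / H\<nu>)"
      unfolding \<sigma> c1_def ratio[symmetric] using \<nu> l by (intro racah1_fun_eq A ab) (auto simp: N_def)
    have f2: "racah_fun 2 n (list_vec [\<mu> 3, \<mu> 2]) (list_vec [\<nu> 3, l + \<nu> 3]) \<beta> =
        (-1) ^ (n - \<nu> 3) * c2 l * sqrt (H\<mu> / Hl l)"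
    proof -
      have e: "n - \<mu> 3 - \<mu> 2 = \<mu> 1" "l + \<nu> 3 - \<nu> 3 = l" "n - (l + \<nu> 3) = N - l" "\<nu> 3 + l = l + \<nu> 3"
        using \<mu> by (auto simp: N_def)
      have "racah_fun 2 n (list_vec [\<mu> 3, \<mu> 2]) (list_vec [\<nu> 3, l + \<nu> 3]) \<beta> =
        (-1) ^ (n - list_vec [\<nu> 3, l + \<nu> 3] 1) * swap_pair_coeff n (list_vec [\<nu> 3, l + \<nu> 3] 1) (list_vec [\<nu> 3, l + \<nu> 3] 2) (\<mu> 3) (\<mu> 2) a b c d *
        sqrt (tree3_norm2 (\<mu> 3) (\<mu> 2) (n - \<mu> 3 - \<mu> 2) a d c b /
          tree3_norm2 (list_vec [\<nu> 3, l + \<nu> 3] 1) (list_vec [\<nu> 3, l + \<nu> 3] 2 - list_vec [\<nu> 3, l + \<nu> 3] 1)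
            (n - list_vec [\<nu> 3, l + \<nu> 3] 2) a b d c)"
        by (rule racah_fun_eq[OF ab]) (use l n \<mu> \<beta> in \<open>auto simp only: list_vec_pair\<close>)
      then show ?thesis
        unfolding list_vec_pair e c2_def H\<mu>_def Hl_def .
    qed
    have sign: "(-1 :: real) ^ \<nu> 2 * ((-1) ^ l * ((-1) ^ (N - l + \<nu> 2) * (-1) ^ (n - \<nu> 3))) = 1"
    proof -
      have "\<nu> 2 + (l + ((N - l + \<nu> 2) + (n - \<nu> 3))) = 2 * (\<nu> 2 + N)" using l by (simp add: N_def)
      then show ?thesis by (simp only: power_add[symmetric]) simp
    qed
    have roots: "sqrt (Hl l / H\<nu>) * sqrt (H\<mu> / Hl l) = sqrt (H\<mu> / H\<nu>)"
      using H_pos(3)[of l] by (simp flip: real_sqrt_mult)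
    have "(-1) ^ \<nu> 2 * ((-1) ^ l * racah1_fun N (\<nu> 2) l \<sigma> *
      racah_fun 2 n (list_vec [\<mu> 3, \<mu> 2]) (list_vec [\<nu> 3, l + \<nu> 3]) \<beta>) =
      ((-1) ^ \<nu> 2 * ((-1) ^ l * ((-1) ^ (N - l + \<nu> 2) * (-1) ^ (n - \<nu> 3)))) *
      (sqrt (Hl l / H\<nu>) * sqrt (H\<mu> / Hl l)) * (c1 l * c2 l)"
      unfolding f1 f2 by (simp only: mult_ac)
    then show ?thesis unfolding sign roots by simp
  qed
  then have "conn_coeff_hat 3 swap13 \<kappa> \<nu> \<mu> = (-1) ^ \<nu> 2 * (\<Sum>l=0..N. (-1) ^ l * racah1_fun N (\<nu> 2) l \<sigma> *
      racah_fun 2 n (list_vec [\<mu> 3, \<mu> 2]) (list_vec [\<nu> 3, l + \<nu> 3]) \<beta>)"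
    unfolding lhs sum_distrib_left atMost_atLeast0 by (intro sum.cong refl) simp
  then show ?thesis
    unfolding Let_def K_def[symmetric] \<sigma>_def[symmetric] \<beta>_def[symmetric] N_def[symmetric] .
qed

end
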